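(* Let $r>1$ and let $\mathcal X$ be a geometric $SL_{r+1}$-crystal on $(X,\gamma)$, with $\gamma:X\to T$ a regular surjective morphism; let $X_0=\gamma^{-1}(e)$. Let $\omega_1,\dots,\omega_r$ be the fundamental weights in the standard order and write $\omega_i(x)=\omega_i(\gamma(x))$. Then the morphism $\tau:X\to X_0$ given by $$\tau(x)=\left(e_1^{\frac{1}{\omega_r(x)}}\cdots e_r^{\frac{1}{\omega_r(x)}}\right)\left(e_1^{\frac{\omega_r(x)}{\omega_{r-1}(x)}}\cdots e_{r-1}^{\frac{\omega_r(x)}{\omega_{r-1}(x)}}\right)\cdots\left(e_1^{\frac{\omega_3(x)}{\omega_2(x)}}e_2^{\frac{\omega_3(x)}{\omega_2(x)}}\right)\left(e_1^{\frac{\omega_2(x)}{\omega_1(x)}}\right)(x)$$ is a trivialization of $\mathcal X$, i.e. a $W$-invariant rational projection $X\to X_0$.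
   Context: Let $G=SL_{r+1}$ over $\mathbb Q$, $T$ its diagonal torus, $I=\{1,\dots,r\}$ with standard labelling, $\alpha_i,\alpha_i^\vee$ simple roots and coroots, $W$ the Weyl group with simple reflections $s_i$. A rational action $\alpha:H\times X\to X$ is unital if its domain of definition contains $\{e\}\times X$. Let $X$ be an irreducible variety over $\mathbb Q$ and $\gamma:X\to T$ a rational morphism. A geometric $G$-pre-crystal on $(X,\gamma)$ is a family of unital rational actions $e_i:\mathbb G_m\times X\to X$, $(c,x)\mapsto e_i^c(x)$, $i\in I$, with $\gamma(e_i^c(x))=\alpha_i^\vee(c)\gamma(x)$. For a reduced sequence $\mathbf i=(i_1,\dots,i_l)$ put $e_{\mathbf i}^t(x)=e_{i_1}^{\alpha^{(1)}(t)}\circ\cdots\circ e_{i_l}^{\alpha^{(l)}(t)}(x)$ for $t\in T$, where $\alpha^{(k)}=s_{i_l}\cdots s_{i_{k+1}}(\alpha_{i_k})$. It is a geometric crystal if $e_{\mathbf i}=e_{\mathbf i'}$ for all reduced sequences $\mathbf i,\mathbf i'$ of the same $w\in W$; then $e_w:=e_{\mathbf i}$ is well defined. For a geometric crystal, $W$ acts rationally on $X$ by $w(x)=e_w^{\gamma(x)^{-1}}(x)$; in particular $s_i(x)=e_i^{1/\alpha_i(\gamma(x))}(x)$, and $W$ fixes $X_0$ pointwise. A trivialization of $\mathcal X$ is a $W$-invariant rational projection $\tau:X\to X_0$ (i.e. $\tau(w(x))=\tau(x)$ for $w\in W$, and $\tau$ restricts to the identity on $X_0$). In the formula for $\tau$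 products of the $e_i^c$ denote compositions, and the exponents are all evaluated at the original point $x$. *)

theory Defs
  imports "HOL-Analysis.Analysis" "HOL-Combinatorics.Permutations"
begin

section \<open>Varieties over the rationals\<close>

text \<open>
  A reduced scheme of finite type over \<open>\<rat>\<close> is represented by its set of complex points, together
  with the \<open>\<rat>\<close>-Zariski topology and the sheaf of regular functions defined over \<open>\<rat>\<close>, regarded as
  complex-valued functions (the complex numbers serve as a universal domain).  Since \<open>\<complex>\<close> is
  algebraically closed of infinite transcendence degree over \<open>\<rat>\<close>, every scheme point is the image
  of a complex point, so nothing is lost: morphisms over \<open>\<rat>\<close>, open and closed subschemes,
  irreducibility over \<open>\<rat>\<close>, separatedness, surjectivity and products can all be read off this datum.
\<close>

record 'p qspace =
  zariski :: "'p topology"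
  regular :: "'p set \<Rightarrow> ('p \<Rightarrow> complex) set"

abbreviation points :: "'p qspace \<Rightarrow> 'p set" where
  "points X \<equiv> topspace (zariski X)"

text \<open>The members of \<open>regular X U\<close> are total functions of which only the values on \<open>U\<close> matter;
  \<open>regular X U\<close> is meaningful for open \<open>U\<close> only.\<close>

definition sheaf_of_functions :: "'p qspace \<Rightarrow> bool" where
  "sheaf_of_functions X \<longleftrightarrow>
     (\<forall>U f g. openin (zariski X) U \<longrightarrow> f \<in> regular X U \<longrightarrow> (\<forall>x\<in>U. f x = g x) \<longrightarrow> g \<in> regular X U) \<and>
     (\<forall>U V f. openin (zariski X) U \<longrightarrow> openin (zariski X) V \<longrightarrow> V \<subseteq> U \<longrightarrow>
        f \<in> regular X U \<longrightarrow> f \<in> regular X V) \<and>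
     (\<forall>U f. openin (zariski X) U \<longrightarrow>
        (\<forall>x\<in>U. \<exists>V. openin (zariski X) V \<and> x \<in> V \<and> V \<subseteq> U \<and> f \<in> regular X V) \<longrightarrow>
        f \<in> regular X U)"

definition morphism :: "'p qspace \<Rightarrow> 'q qspace \<Rightarrow> ('p \<Rightarrow> 'q) \<Rightarrow> bool" where
  "morphism X Y f \<longleftrightarrow> continuous_map (zariski X) (zariski Y) f \<and>
     (\<forall>V g. openin (zariski Y) V \<longrightarrow> g \<in> regular Y V \<longrightarrow>
        (\<lambda>x. g (f x)) \<in> regular X {x \<in> points X. f x \<in> V})"

definition isomorphic :: "'p qspace \<Rightarrow> 'q qspace \<Rightarrow> bool" where
  "isomorphic X Y \<longleftrightarrow> (\<exists>f g. morphism X Y f \<and> morphism Y X g \<and>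
     (\<forall>x\<in>points X. g (f x) = x) \<and> (\<forall>y\<in>points Y. f (g y) = y))"

text \<open>The structure induced on a locally closed subset (for closed subsets: the reduced one).\<close>

definition subspace_of :: "'p qspace \<Rightarrow> 'p set \<Rightarrow> 'p qspace" where
  "subspace_of X S = \<lparr>
     zariski = subtopology (zariski X) S,
     regular = (\<lambda>U. {f. \<forall>x\<in>U. \<exists>V g. openin (zariski X) V \<and> x \<in> V \<and> V \<inter> S \<subseteq> U \<and>
                  g \<in> regular X V \<and> (\<forall>y\<in>V \<inter> S. f y = g y)}) \<rparr>"

inductive_set rat_algebra :: "('p \<Rightarrow> complex) set \<Rightarrow> ('p \<Rightarrow> complex) set"
  for F :: "('p \<Rightarrow> complex) set" where
  gen: "f \<in> F \<Longrightarrow> f \<in> rat_algebra F"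
| const: "(\<lambda>_. of_rat q) \<in> rat_algebra F"
| add: "f \<in> rat_algebra F \<Longrightarrow> g \<in> rat_algebra F \<Longrightarrow> (\<lambda>x. f x + g x) \<in> rat_algebra F"
| mult: "f \<in> rat_algebra F \<Longrightarrow> g \<in> rat_algebra F \<Longrightarrow> (\<lambda>x. f x * g x) \<in> rat_algebra F"

text \<open>The space with point set \<open>S\<close> whose topology is generated by the non-vanishing loci of the
  functions in \<open>A\<close>, and whose regular functions are locally fractions of functions in \<open>A\<close>.\<close>

definition fraction_space :: "'p set \<Rightarrow> ('p \<Rightarrow> complex) set \<Rightarrow> 'p qspace" where
  "fraction_space S A = (let Z = topology_generated_by {{x \<in> S. f x \<noteq> 0} |f. f \<in> A} in \<lparr>
     zariski = Z,
     regular = (\<lambda>U. {h. \<forall>x\<in>U. \<exists>V f g. openin Z V \<and> x \<in> V \<and> V \<subseteq> U \<and> f \<in> A \<and> g \<in> A \<and>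
                  (\<forall>y\<in>V. g y \<noteq> 0 \<and> h y = f y / g y)}) \<rparr>)"

definition rat_polynomials :: "nat \<Rightarrow> ((nat \<Rightarrow> complex) \<Rightarrow> complex) set" where
  "rat_polynomials n = rat_algebra {(\<lambda>x. x i) |i. i < n}"

definition algebraic_set :: "nat \<Rightarrow> (nat \<Rightarrow> complex) set \<Rightarrow> bool" where
  "algebraic_set n Z \<longleftrightarrow>
     (\<exists>P \<subseteq> rat_polynomials n. Z = {x. (\<forall>i\<ge>n. x i = 0) \<and> (\<forall>p\<in>P. p x = 0)})"

definition affine_variety :: "'p qspace \<Rightarrow> bool" where
  "affine_variety X \<longleftrightarrow>
     (\<exists>n Z. algebraic_set n Z \<and> isomorphic X (fraction_space Z (rat_polynomials n)))"

text \<open>Functions on \<open>U \<times> V\<close> coming from the tensor product of the rings of regular functions.\<close>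

definition tensor_functions ::
    "'p qspace \<Rightarrow> 'q qspace \<Rightarrow> 'p set \<Rightarrow> 'q set \<Rightarrow> ('p \<times> 'q \<Rightarrow> complex) set" where
  "tensor_functions X Y U V = {h. \<exists>(n::nat) f g.
     (\<forall>k<n. f k \<in> regular X U \<and> g k \<in> regular Y V) \<and>
     h = (\<lambda>(x, y). \<Sum>k<n. f k x * g k y)}"

definition product_space :: "'p qspace \<Rightarrow> 'q qspace \<Rightarrow> ('p \<times> 'q) qspace" (infixr "\<times>\<^sub>q" 80) where
  "X \<times>\<^sub>q Y = \<lparr>
     zariski = topology_generated_by {{z \<in> U \<times> V. h z \<noteq> 0} |U V h.
        openin (zariski X) U \<and> openin (zariski Y) V \<and> h \<in> tensor_functions X Y U V},
     regular = (\<lambda>W. {h. \<forall>w\<in>W. \<exists>U V f g.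
        openin (zariski X) U \<and> openin (zariski Y) V \<and>
        f \<in> tensor_functions X Y U V \<and> g \<in> tensor_functions X Y U V \<and>
        w \<in> {z \<in> U \<times> V. g z \<noteq> 0} \<and> {z \<in> U \<times> V. g z \<noteq> 0} \<subseteq> W \<and>
        (\<forall>z\<in>{z \<in> U \<times> V. g z \<noteq> 0}. h z = f z / g z)}) \<rparr>"

definition separated :: "'p qspace \<Rightarrow> bool" where
  "separated X \<longleftrightarrow> closedin (zariski (X \<times>\<^sub>q X)) {(x, x) |x. x \<in> points X}"

definition rat_variety :: "'p qspace \<Rightarrow> bool" where
  "rat_variety X \<longleftrightarrow> sheaf_of_functions X \<and>
     (\<exists>\<U>. finite \<U> \<and> \<Union>\<U> = points X \<and>
        (\<forall>U\<in>\<U>. openin (zariski X) U \<and> affine_variety (subspace_of X U))) \<and>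
     separated X"

definition irreducible_variety :: "'p qspace \<Rightarrow> bool" where
  "irreducible_variety X \<longleftrightarrow> rat_variety X \<and> points X \<noteq> {} \<and>
     (\<forall>U V. openin (zariski X) U \<longrightarrow> openin (zariski X) V \<longrightarrow> U \<noteq> {} \<longrightarrow> V \<noteq> {} \<longrightarrow> U \<inter> V \<noteq> {})"


section \<open>Rational morphisms and rational actions\<close>

text \<open>
  A rational morphism is represented by a partial function whose domain is a dense open set on
  which it is regular.  Two representatives define the same rational morphism iff they
  agree on a dense open set; identities between rational morphisms are stated with \<open>rat_eq\<close>, which
  includes the requirement that both sides are defined on a dense open set.
\<close>

definition dense_open :: "'p qspace \<Rightarrow> 'p set \<Rightarrow> bool" where
  "dense_open X U \<longleftrightarrow> openin (zariski X) U \<and> (zariski X) closure_of U = points X"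

definition rational_morphism :: "'p qspace \<Rightarrow> 'q qspace \<Rightarrow> ('p \<rightharpoonup> 'q) \<Rightarrow> bool" where
  "rational_morphism X Y f \<longleftrightarrow>
     dense_open X (dom f) \<and> morphism (subspace_of X (dom f)) Y (\<lambda>x. the (f x))"

definition rat_eq :: "'p qspace \<Rightarrow> ('p \<rightharpoonup> 'q) \<Rightarrow> ('p \<rightharpoonup> 'q) \<Rightarrow> bool" where
  "rat_eq X f g \<longleftrightarrow> (\<exists>U. dense_open X U \<and> U \<subseteq> dom f \<inter> dom g \<and> (\<forall>x\<in>U. f x = g x))"

text \<open>
  \<open>H\<close> is an algebraic group with multiplication \<open>m\<close> and unit \<open>u\<close>.  That the action is unital says that
  its domain of definition contains \<open>{u} \<times> X\<close>; accordingly it is represented by a partial function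
  defined on all of \<open>{u} \<times> X\<close> (the maximal representative is one such), and the unit axiom holds at
  every point.
\<close>

definition unital_rational_action ::
    "'h qspace \<Rightarrow> ('h \<Rightarrow> 'h \<Rightarrow> 'h) \<Rightarrow> 'h \<Rightarrow> 'p qspace \<Rightarrow> ('h \<times> 'p \<rightharpoonup> 'p) \<Rightarrow> bool" where
  "unital_rational_action H m u X a \<longleftrightarrow>
     rational_morphism (H \<times>\<^sub>q X) X a \<and>
     {u} \<times> points X \<subseteq> dom a \<and>
     (\<forall>x\<in>points X. a (u, x) = Some x) \<and>
     rat_eq (H \<times>\<^sub>q H \<times>\<^sub>q X)
       (\<lambda>(h, h', x). Option.bind (a (h', x)) (\<lambda>y. a (h, y)))
       (\<lambda>(h, h', x). a (m h h', x))"


section \<open>The root datum of \<open>SL\<^bsub>r+1\<^esub>\<close>\<close>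

definition Gm :: "complex qspace" where
  "Gm = fraction_space {c. c \<noteq> 0} (rat_algebra {\<lambda>c. c})"

text \<open>An element \<open>diag (t\<^sub>1, \<dots>, t\<^bsub>r+1\<^esub>)\<close> of \<open>T\<close> is the sequence of its diagonal entries, extended by 1
  outside \<open>{1..r+1}\<close>, so that the group operations of \<open>T\<close> are the pointwise ones.\<close>

definition torus_points :: "nat \<Rightarrow> (nat \<Rightarrow> complex) set" where
  "torus_points r = {t. (\<forall>j. j \<notin> {1..r+1} \<longrightarrow> t j = 1) \<and> (\<Prod>j=1..r+1. t j) = 1}"

definition torus :: "nat \<Rightarrow> (nat \<Rightarrow> complex) qspace" where
  "torus r = fraction_space (torus_points r) (rat_algebra {(\<lambda>t. t j) |j. j \<in> {1..r+1}})"

definition torus_mult :: "(nat \<Rightarrow> complex) \<Rightarrow> (nat \<Rightarrow> complex) \<Rightarrow> nat \<Rightarrow> complex" where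
  "torus_mult s t = (\<lambda>j. s j * t j)"

definition torus_one :: "nat \<Rightarrow> complex" where
  "torus_one = (\<lambda>_. 1)"

definition torus_inverse :: "(nat \<Rightarrow> complex) \<Rightarrow> nat \<Rightarrow> complex" where
  "torus_inverse t = (\<lambda>j. inverse (t j))"

type_synonym torus_char = "(nat \<Rightarrow> complex) \<Rightarrow> complex"

definition simple_root :: "nat \<Rightarrow> torus_char" where
  "simple_root i = (\<lambda>t. t i / t (i+1))"

definition simple_coroot :: "nat \<Rightarrow> complex \<Rightarrow> nat \<Rightarrow> complex" where
  "simple_coroot i c = (\<lambda>j. if j = i then c else if j = i+1 then inverse c else 1)"

definition fundamental_weight :: "nat \<Rightarrow> torus_char" where
  "fundamental_weight i = (\<lambda>t. \<Prod>j=1..i. t j)"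

text \<open>The Weyl group is the symmetric group on \<open>{1..r+1}\<close>, where \<open>w\<close> moves the \<open>j\<close>-th diagonal entry
  to position \<open>w j\<close>; on characters it acts by \<open>(w \<mu>) (t) = \<mu> (w\<^sup>-\<^sup>1 t)\<close>.\<close>

definition weyl_group :: "nat \<Rightarrow> (nat \<Rightarrow> nat) set" where
  "weyl_group r = {w. w permutes {1..r+1}}"

definition simple_reflection :: "nat \<Rightarrow> nat \<Rightarrow> nat" where
  "simple_reflection i = Transposition.transpose i (i+1)"

definition weyl_torus :: "(nat \<Rightarrow> nat) \<Rightarrow> (nat \<Rightarrow> complex) \<Rightarrow> nat \<Rightarrow> complex" where
  "weyl_torus w t = (\<lambda>j. t (inv w j))"

definition weyl_char :: "(nat \<Rightarrow> nat) \<Rightarrow> torus_char \<Rightarrow> torus_char" where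
  "weyl_char w \<mu> = (\<lambda>t. \<mu> (weyl_torus (inv w) t))"

definition word_product :: "nat list \<Rightarrow> nat \<Rightarrow> nat" where
  "word_product is = foldr (\<lambda>i w. simple_reflection i \<circ> w) is id"

definition reduced_word :: "nat \<Rightarrow> (nat \<Rightarrow> nat) \<Rightarrow> nat list \<Rightarrow> bool" where
  "reduced_word r w is \<longleftrightarrow> set is \<subseteq> {1..r} \<and> word_product is = w \<and>
     (\<forall>js. set js \<subseteq> {1..r} \<longrightarrow> word_product js = w \<longrightarrow> length is \<le> length js)"


section \<open>Geometric crystals\<close>

definition geometric_precrystal ::
    "nat \<Rightarrow> 'p qspace \<Rightarrow> ('p \<rightharpoonup> nat \<Rightarrow> complex) \<Rightarrow> (nat \<Rightarrow> complex \<times> 'p \<rightharpoonup> 'p) \<Rightarrow> bool" where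
  "geometric_precrystal r X \<gamma> e \<longleftrightarrow>
     irreducible_variety X \<and>
     rational_morphism X (torus r) \<gamma> \<and>
     (\<forall>i\<in>{1..r}.
        unital_rational_action Gm (*) 1 X (e i) \<and>
        rat_eq (Gm \<times>\<^sub>q X)
          (\<lambda>(c, x). Option.bind (e i (c, x)) \<gamma>)
          (\<lambda>(c, x). map_option (torus_mult (simple_coroot i c)) (\<gamma> x)))"

text \<open>\<open>e_seq e [(i\<^sub>1, c\<^sub>1), \<dots>, (i\<^sub>l, c\<^sub>l)]\<close> is the composition \<open>e\<^bsub>i\<^sub>1\<^esub>\<^bsup>c\<^sub>1\<^esup> \<circ> \<dots> \<circ> e\<^bsub>i\<^sub>l\<^esub>\<^bsup>c\<^sub>l\<^esup>\<close>.\<close>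

definition e_seq :: "(nat \<Rightarrow> complex \<times> 'p \<rightharpoonup> 'p) \<Rightarrow> (nat \<times> complex) list \<Rightarrow> 'p \<rightharpoonup> 'p" where
  "e_seq e ics x = foldr (\<lambda>(i, c) y. Option.bind y (\<lambda>z. e i (c, z))) ics (Some x)"

text \<open>List positions are counted from 0: \<open>word_root is k\<close> is the character \<open>\<alpha>\<^bsup>(k+1)\<^esup>\<close> attached to \<open>is\<close>.\<close>

definition word_root :: "nat list \<Rightarrow> nat \<Rightarrow> torus_char" where
  "word_root is k = weyl_char (word_product (rev (drop (Suc k) is))) (simple_root (is ! k))"

definition e_word ::
    "(nat \<Rightarrow> complex \<times> 'p \<rightharpoonup> 'p) \<Rightarrow> nat list \<Rightarrow> (nat \<Rightarrow> complex) \<times> 'p \<rightharpoonup> 'p" where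
  "e_word e is = (\<lambda>(t, x). e_seq e (map (\<lambda>k. (is ! k, word_root is k t)) [0..<length is]) x)"

definition geometric_crystal ::
    "nat \<Rightarrow> 'p qspace \<Rightarrow> ('p \<rightharpoonup> nat \<Rightarrow> complex) \<Rightarrow> (nat \<Rightarrow> complex \<times> 'p \<rightharpoonup> 'p) \<Rightarrow> bool" where
  "geometric_crystal r X \<gamma> e \<longleftrightarrow> geometric_precrystal r X \<gamma> e \<and>
     (\<forall>w\<in>weyl_group r. \<forall>is is'. reduced_word r w is \<longrightarrow> reduced_word r w is' \<longrightarrow>
        rat_eq (torus r \<times>\<^sub>q X) (e_word e is) (e_word e is'))"

text \<open>For a geometric crystal the choice of the reduced word does not matter, as an equality of
  rational morphisms.\<close>

definition e_weyl ::
    "nat \<Rightarrow> (nat \<Rightarrow> complex \<times> 'p \<rightharpoonup> 'p) \<Rightarrow> (nat \<Rightarrow> nat) \<Rightarrow> (nat \<Rightarrow> complex) \<times> 'p \<rightharpoonup> 'p" where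
  "e_weyl r e w = e_word e (SOME is. reduced_word r w is)"

definition weyl_action ::
    "nat \<Rightarrow> ('p \<rightharpoonup> nat \<Rightarrow> complex) \<Rightarrow> (nat \<Rightarrow> complex \<times> 'p \<rightharpoonup> 'p) \<Rightarrow> (nat \<Rightarrow> nat) \<Rightarrow> 'p \<rightharpoonup> 'p" where
  "weyl_action r \<gamma> e w x = Option.bind (\<gamma> x) (\<lambda>t. e_weyl r e w (torus_inverse t, x))"

definition unit_fibre :: "('p \<rightharpoonup> nat \<Rightarrow> complex) \<Rightarrow> 'p set" where
  "unit_fibre \<gamma> = {x. \<gamma> x = Some torus_one}"

definition trivialization ::
    "nat \<Rightarrow> 'p qspace \<Rightarrow> ('p \<rightharpoonup> nat \<Rightarrow> complex) \<Rightarrow> (nat \<Rightarrow> complex \<times> 'p \<rightharpoonup> 'p) \<Rightarrow> ('p \<rightharpoonup> 'p) \<Rightarrow> bool" where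
  "trivialization r X \<gamma> e \<tau> \<longleftrightarrow>
     rational_morphism X (subspace_of X (unit_fibre \<gamma>)) \<tau> \<and>
     (\<forall>w\<in>weyl_group r. rat_eq X (\<lambda>x. Option.bind (weyl_action r \<gamma> e w x) \<tau>) \<tau>) \<and>
     (\<forall>x\<in>unit_fibre \<gamma>. \<tau> x = Some x)"

text \<open>The exponents are \<open>\<omega>\<^bsub>m+1\<^esub> / \<omega>\<^sub>m\<close> for \<open>m < r\<close> and \<open>1 / \<omega>\<^sub>r\<close> for \<open>m = r\<close>; the block
  \<open>e\<^sub>1 \<cdots> e\<^sub>m\<close> with \<open>m = r\<close> comes first, i.e. is applied last.\<close>

definition tau_exponent :: "nat \<Rightarrow> nat \<Rightarrow> torus_char" where
  "tau_exponent r m t =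
     (if m = r then 1 else fundamental_weight (m+1) t) / fundamental_weight m t"

definition tau :: "nat \<Rightarrow> ('p \<rightharpoonup> nat \<Rightarrow> complex) \<Rightarrow> (nat \<Rightarrow> complex \<times> 'p \<rightharpoonup> 'p) \<Rightarrow> 'p \<rightharpoonup> 'p" where
  "tau r \<gamma> e x = Option.bind (\<gamma> x) (\<lambda>t.
     e_seq e (concat (map (\<lambda>m. map (\<lambda>i. (i, tau_exponent r m t)) [1..<m+1]) (rev [1..<r+1]))) x)"

end

(* All the identities of rational maps in the definition of a geometric crystal hold at every point
   where both sides are defined, because the equalizer of two morphisms into a separated space is
   closed in their common domain.  So one may compute with words of operators e_i^c whose exponents c
   are invertible regular functions on X.  If the exponents equal 1 on the nonempty fibre X_0, such
   a word fixes X_0, hence its domain is open and dense; this makes "equal where both are defined, in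
   every context" a congruence on words.

   Put t_j for the diagonal entries of gamma(x) and B_m(c) = e_1^c ... e_m^c.  Then
   omega_{m+1} / omega_m = t_{m+1} and 1 / omega_r = t_{r+1}, so
   tau(x) = B_r(t_{r+1}) ... B_1(t_2)(x).  Replacing x by s_k(x) exchanges t_k and t_{k+1} and appends
   e_k^{t_{k+1}/t_k} on the right.  Since e_k commutes with B_m for m < k - 1, invariance under s_k
   is the identity B_k(a) B_{k-1}(b) e_k^{b/a} = B_k(b) B_{k-1}(a), which follows by induction on k
   from the braid relation e_k^a e_{k-1}^b e_k^{b/a} = e_{k-1}^{b/a} e_k^b e_{k-1}^a. *)

theory Submission
  imports Defs
begin

section \<open>Spaces of functions\<close>

text \<open>The axioms are identities of rational maps on G_m x G_m x X and T x X, each valid on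
  some unspecified dense open set. In the argument the exponents are functions of x, so the axioms
  get evaluated along graphs such as x -> (c(x), d(x), x), and such a graph may miss the dense open
  set entirely. This is why every axiom is first upgraded to an identity at all points where both
  sides are defined. The price is that undefinedness must be controlled: a chain of equalities may
  pass through a word that is undefined at the point in question. Unitality gives this control,
  since e_i^1 is defined on all of X, and surjectivity of gamma supplies a point of X_0.

  The upgrade takes place on products of G_m, T and X. What it uses of them is a sheaf of functions
  that form rings, with inverses of nonvanishing functions, and openness of nonvanishing loci.
  \<open>ring_space\<close> isolates these properties; they pass to products directly by computing
  with tensor functions, so that no affine charts of products have to be constructed.\<close>

locale ring_space =
  fixes Y :: "'p qspace"
  assumes sheaf: "sheaf_of_functions Y"
    and regular_const: "openin (zariski Y) U \<Longrightarrow> (\<lambda>_. of_rat q) \<in> regular Y U"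
    and regular_add: "openin (zariski Y) U \<Longrightarrow> f \<in> regular Y U \<Longrightarrow> g \<in> regular Y U \<Longrightarrow>
      (\<lambda>x. f x + g x) \<in> regular Y U"
    and regular_mult: "openin (zariski Y) U \<Longrightarrow> f \<in> regular Y U \<Longrightarrow> g \<in> regular Y U \<Longrightarrow>
      (\<lambda>x. f x * g x) \<in> regular Y U"
    and regular_inverse: "openin (zariski Y) U \<Longrightarrow> f \<in> regular Y U \<Longrightarrow>
      (\<And>x. x \<in> U \<Longrightarrow> f x \<noteq> 0) \<Longrightarrow> (\<lambda>x. inverse (f x)) \<in> regular Y U"
    and openin_nonzero: "openin (zariski Y) U \<Longrightarrow> f \<in> regular Y U \<Longrightarrow>
      openin (zariski Y) {x \<in> U. f x \<noteq> 0}"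
begin

lemma regular_cong:
  assumes "openin (zariski Y) U" "f \<in> regular Y U" "\<And>x. x \<in> U \<Longrightarrow> f x = g x"
  shows "g \<in> regular Y U"
  using sheaf[unfolded sheaf_of_functions_def, THEN conjunct1, rule_format, OF assms(1,2)] assms(3) by blast

lemma regular_mono:
  assumes "openin (zariski Y) U" "f \<in> regular Y U" "openin (zariski Y) V" "V \<subseteq> U"
  shows "f \<in> regular Y V"
  using sheaf[unfolded sheaf_of_functions_def, THEN conjunct2, THEN conjunct1, rule_format, OF assms(1,3,4,2)] .

lemma regular_local:
  assumes "openin (zariski Y) U"
    and "\<And>x. x \<in> U \<Longrightarrow> \<exists>V. openin (zariski Y) V \<and> x \<in> V \<and> V \<subseteq> U \<and> f \<in> regular Y V"
  shows "f \<in> regular Y U"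
  using sheaf[unfolded sheaf_of_functions_def, THEN conjunct2, THEN conjunct2, rule_format, OF assms(1)] assms(2) by blast

lemma regular_divide:
  assumes "openin (zariski Y) U" "f \<in> regular Y U" "g \<in> regular Y U"
    and "\<And>x. x \<in> U \<Longrightarrow> g x \<noteq> 0"
  shows "(\<lambda>x. f x / g x) \<in> regular Y U"
  unfolding divide_inverse by (intro regular_mult regular_inverse assms)

lemma regular_diff:
  assumes "openin (zariski Y) U" "f \<in> regular Y U" "g \<in> regular Y U"
  shows "(\<lambda>x. f x - g x) \<in> regular Y U"
proof -
  have "(\<lambda>x. f x + of_rat (- 1) * g x) \<in> regular Y U"
    by (intro regular_add regular_mult regular_const assms)
  then show ?thesis by simp
qed

lemma regular_sum:
  assumes "openin (zariski Y) U" "\<And>k. k < n \<Longrightarrow> f k \<in> regular Y U"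
  shows "(\<lambda>x. \<Sum>k<(n::nat). f k x) \<in> regular Y U"
  using assms(2)
proof (induction n)
  case 0
  then show ?case using regular_const[OF assms(1), of 0] by simp
next
  case (Suc n)
  then show ?case by (simp add: regular_add[OF assms(1)])
qed

text \<open>The locus where \<open>f - g\<close> does not vanish is open in \<open>U\<close>, so it
  would meet the dense set \<open>D\<close> if it contained a point.\<close>

lemma openin_equal_dense:
  assumes U: "openin (zariski Y) U" and f: "f \<in> regular Y U" and g: "g \<in> regular Y U"
    and D: "dense_open Y D" and eq: "\<And>x. x \<in> D \<inter> U \<Longrightarrow> f x = g x" and x: "x \<in> U"
  shows "f x = g x"
proof (rule ccontr)
  assume ne: "f x \<noteq> g x"
  have "openin (zariski Y) {x \<in> U. f x - g x \<noteq> 0}"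
    by (intro openin_nonzero regular_diff U f g)
  moreover have "x \<in> {x \<in> U. f x - g x \<noteq> 0}" using x ne by simp
  ultimately have "D \<inter> {x \<in> U. f x - g x \<noteq> 0} \<noteq> {}"
    using D unfolding dense_open_def dense_intersects_open by blast
  then show False using eq by auto
qed

end

lemma ring_space_cong:
  assumes "ring_space Y" and z: "zariski Y' = zariski Y"
    and r: "\<And>U. openin (zariski Y) U \<Longrightarrow> regular Y' U = regular Y U"
  shows "ring_space Y'"
proof -
  interpret ring_space Y by fact
  show ?thesis
  proof
    show "sheaf_of_functions Y'"
      unfolding sheaf_of_functions_def z
    proof (intro conjI allI impI)
      fix U f g
      assume U: "openin (zariski Y) U" and f: "f \<in> regular Y' U" and eq: "\<forall>x\<in>U. f x = g x"
      have "g \<in> regular Y U" by (rule regular_cong[OF U f[unfolded r[OF U]]]) (use eq in simp)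
      then show "g \<in> regular Y' U" by (simp add: r U)
    next
      fix U V f
      assume *: "openin (zariski Y) U" "openin (zariski Y) V" "V \<subseteq> U" "f \<in> regular Y' U"
      have "f \<in> regular Y V" by (rule regular_mono[OF *(1) _ *(2,3)]) (use * r in simp)
      then show "f \<in> regular Y' V" by (simp add: r *)
    next
      fix U f
      assume U: "openin (zariski Y) U"
        and loc: "\<forall>x\<in>U. \<exists>V. openin (zariski Y) V \<and> x \<in> V \<and> V \<subseteq> U \<and> f \<in> regular Y' V"
      have "f \<in> regular Y U"
      proof (rule regular_local[OF U])
        fix x assume "x \<in> U"
        then obtain V where V: "openin (zariski Y) V" "x \<in> V" "V \<subseteq> U" "f \<in> regular Y' V"
          using loc by blast
        then show "\<exists>V. openin (zariski Y) V \<and> x \<in> V \<and> V \<subseteq> U \<and> f \<in> regular Y V"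
          by (auto simp: r)
      qed
      then show "f \<in> regular Y' U" by (simp add: r U)
    qed
  qed (simp_all add: z r regular_const regular_add regular_mult regular_inverse openin_nonzero)
qed

section \<open>Spaces whose regular functions are locally fractions\<close>

definition local_fractions :: "('p set \<times> ('p \<Rightarrow> complex) set) set \<Rightarrow> 'p qspace" where
  "local_fractions F = \<lparr>
     zariski = topology_generated_by {{z \<in> S. h z \<noteq> 0} |S A h. (S, A) \<in> F \<and> h \<in> A},
     regular = (\<lambda>W. {h. \<forall>w\<in>W. \<exists>S A f g. (S, A) \<in> F \<and> f \<in> A \<and> g \<in> A \<and>
        w \<in> {z \<in> S. g z \<noteq> 0} \<and> {z \<in> S. g z \<noteq> 0} \<subseteq> W \<and>
        (\<forall>z\<in>{z \<in> S. g z \<noteq> 0}. h z = f z / g z)}) \<rparr>"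

text \<open>A pair \<open>(S, A)\<close> is a basic domain with its ring of numerators and
  denominators. Functions are total, so the inclusions in \<open>inter\<close> express restriction
  to the smaller set. Spaces of fractions (one pair) and products (boxes of open sets with their
  tensor functions) are both of this kind.\<close>

locale fraction_family =
  fixes F :: "('p set \<times> ('p \<Rightarrow> complex) set) set"
  assumes const: "(S, A) \<in> F \<Longrightarrow> (\<lambda>_. of_rat q) \<in> A"
    and add: "(S, A) \<in> F \<Longrightarrow> f \<in> A \<Longrightarrow> g \<in> A \<Longrightarrow> (\<lambda>x. f x + g x) \<in> A"
    and mult: "(S, A) \<in> F \<Longrightarrow> f \<in> A \<Longrightarrow> g \<in> A \<Longrightarrow> (\<lambda>x. f x * g x) \<in> A"
    and inter: "(S, A) \<in> F \<Longrightarrow> (S', A') \<in> F \<Longrightarrow>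
      \<exists>A''. (S \<inter> S', A'') \<in> F \<and> A \<subseteq> A'' \<and> A' \<subseteq> A''"
begin

lemma openin_basic:
  assumes "(S, A) \<in> F" "h \<in> A"
  shows "openin (zariski (local_fractions F)) {z \<in> S. h z \<noteq> 0}"
  unfolding local_fractions_def using assms by (auto intro!: topology_generated_by_Basis)

text \<open>The nonvanishing loci are a priori only a subbasis. They form a basis because the loci
  of \<open>g\<close> and \<open>g'\<close> intersect in the locus of their product over
  \<open>S \<inter> S'\<close>.\<close>

lemma openin_iff:
  "openin (zariski (local_fractions F)) W \<longleftrightarrow>
   (\<forall>w\<in>W. \<exists>S A g. (S, A) \<in> F \<and> g \<in> A \<and> w \<in> {z \<in> S. g z \<noteq> 0} \<and> {z \<in> S. g z \<noteq> 0} \<subseteq> W)"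
  (is "?L \<longleftrightarrow> ?R W")
proof
  assume ?L
  then have "generate_topology_on {{z \<in> S. h z \<noteq> 0} |S A h. (S, A) \<in> F \<and> h \<in> A} W"
    unfolding local_fractions_def by (simp add: openin_topology_generated_by_iff)
  then show "?R W"
  proof induction
    case Empty
    then show ?case by simp
  next
    case (Int a b)
    show ?case
    proof
      fix w assume w: "w \<in> a \<inter> b"
      obtain S A g where 1: "(S, A) \<in> F" "g \<in> A" "w \<in> {z \<in> S. g z \<noteq> 0}" "{z \<in> S. g z \<noteq> 0} \<subseteq> a"
        using Int.IH(1) w by (meson IntD1)
      obtain S' A' g' where 2: "(S', A') \<in> F" "g' \<in> A'" "w \<in> {z \<in> S'. g' z \<noteq> 0}"
          "{z \<in> S'. g' z \<noteq> 0} \<subseteq> b"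
        using Int.IH(2) w by (meson IntD2)
      obtain A'' where 3: "(S \<inter> S', A'') \<in> F" "A \<subseteq> A''" "A' \<subseteq> A''"
        using inter[OF 1(1) 2(1)] by blast
      have "(\<lambda>x. g x * g' x) \<in> A''" using mult 3 1 2 by blast
      then show "\<exists>S A g. (S, A) \<in> F \<and> g \<in> A \<and> w \<in> {z \<in> S. g z \<noteq> 0} \<and> {z \<in> S. g z \<noteq> 0} \<subseteq> a \<inter> b"
        by (rule_tac exI[of _ "S \<inter> S'"], rule_tac exI[of _ A''],
            rule_tac exI[of _ "\<lambda>x. g x * g' x"]) (use 1 2 3 in auto)
    qed
  next
    case (UN K)
    show ?case
    proof
      fix w assume "w \<in> \<Union> K"
      then obtain k where "k \<in> K" "w \<in> k" by blast
      then show "\<exists>S A g. (S, A) \<in> F \<and> g \<in> A \<and> w \<in> {z \<in> S. g z \<noteq> 0} \<and> {z \<in> S. g z \<noteq> 0} \<subseteq> \<Union> K"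
        using UN.IH[of k] by (meson Sup_upper subset_trans)
    qed
  next
    case (Basis s)
    then show ?case by blast
  qed
next
  assume R: "?R W"
  show ?L
  proof (subst openin_subopen, intro ballI)
    fix w assume "w \<in> W"
    then obtain S A g where "(S, A) \<in> F" "g \<in> A" "w \<in> {z \<in> S. g z \<noteq> 0}" "{z \<in> S. g z \<noteq> 0} \<subseteq> W"
      using R by meson
    then show "\<exists>T. openin (zariski (local_fractions F)) T \<and> w \<in> T \<and> T \<subseteq> W"
      by (intro exI[of _ "{z \<in> S. g z \<noteq> 0}"] conjI openin_basic)
  qed
qed

lemma regular_localI:
  assumes "\<And>w. w \<in> W \<Longrightarrow> \<exists>S A f g. (S, A) \<in> F \<and> f \<in> A \<and> g \<in> A \<and>
        w \<in> {z \<in> S. g z \<noteq> 0} \<and> {z \<in> S. g z \<noteq> 0} \<subseteq> W \<and>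
        (\<forall>z\<in>{z \<in> S. g z \<noteq> 0}. h z = f z / g z)"
  shows "h \<in> regular (local_fractions F) W"
  using assms unfolding local_fractions_def by simp

lemma regular_localE:
  assumes "h \<in> regular (local_fractions F) W" "w \<in> W"
  obtains S A f g where "(S, A) \<in> F" "f \<in> A" "g \<in> A"
        "w \<in> {z \<in> S. g z \<noteq> 0}" "{z \<in> S. g z \<noteq> 0} \<subseteq> W"
        "\<forall>z\<in>{z \<in> S. g z \<noteq> 0}. h z = f z / g z"
  using assms(1)[unfolded local_fractions_def, simplified, THEN bspec, OF assms(2)] by (auto intro: that)

lemma regular_common_denominator:
  assumes h: "h \<in> regular (local_fractions F) U" and h': "h' \<in> regular (local_fractions F) U'"
    and w: "w \<in> U" "w \<in> U'"
  obtains S A f f' g where "(S, A) \<in> F" "f \<in> A" "f' \<in> A" "g \<in> A"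
        "w \<in> {z \<in> S. g z \<noteq> 0}" "{z \<in> S. g z \<noteq> 0} \<subseteq> U \<inter> U'"
        "\<forall>z\<in>{z \<in> S. g z \<noteq> 0}. h z = f z / g z \<and> h' z = f' z / g z"
proof -
  obtain S A f g where 1: "(S, A) \<in> F" "f \<in> A" "g \<in> A"
        "w \<in> {z \<in> S. g z \<noteq> 0}" "{z \<in> S. g z \<noteq> 0} \<subseteq> U"
        "\<forall>z\<in>{z \<in> S. g z \<noteq> 0}. h z = f z / g z"
    by (rule regular_localE[OF h w(1)])
  obtain S' A' f' g' where 2: "(S', A') \<in> F" "f' \<in> A'" "g' \<in> A'"
        "w \<in> {z \<in> S'. g' z \<noteq> 0}" "{z \<in> S'. g' z \<noteq> 0} \<subseteq> U'"
        "\<forall>z\<in>{z \<in> S'. g' z \<noteq> 0}. h' z = f' z / g' z"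
    by (rule regular_localE[OF h' w(2)])
  obtain A'' where 3: "(S \<inter> S', A'') \<in> F" "A \<subseteq> A''" "A' \<subseteq> A''"
    using inter[OF 1(1) 2(1)] by blast
  have mem: "f \<in> A''" "g \<in> A''" "f' \<in> A''" "g' \<in> A''" using 1 2 3 by auto
  show thesis
    by (rule that[of "S \<inter> S'" A'' "\<lambda>x. f x * g' x" "\<lambda>x. f' x * g x" "\<lambda>x. g x * g' x"])
      (use mem mult[OF 3(1)] 1 2 3 in \<open>auto simp: field_simps\<close>)
qed

lemma regular_const_local:
  assumes "openin (zariski (local_fractions F)) U"
  shows "(\<lambda>_. of_rat q) \<in> regular (local_fractions F) U"
proof (rule regular_localI)
  fix w assume "w \<in> U"
  then obtain S A g where 1: "(S, A) \<in> F" "g \<in> A" "w \<in> {z \<in> S. g z \<noteq> 0}" "{z \<in> S. g z \<noteq> 0} \<subseteq> U"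
    using assms unfolding openin_iff by meson
  \<comment> \<open>A fraction has to be given on the whole nonvanishing locus of its denominator,
    so the constant is written as \<open>q g / g\<close>, where \<open>g\<close> cuts out a
    neighbourhood inside \<open>U\<close>.\<close>
  have "(\<lambda>x. of_rat q * g x) \<in> A" using mult[OF 1(1) const[OF 1(1)] 1(2)] .
  then show "\<exists>S A f g. (S, A) \<in> F \<and> f \<in> A \<and> g \<in> A \<and>
        w \<in> {z \<in> S. g z \<noteq> 0} \<and> {z \<in> S. g z \<noteq> 0} \<subseteq> U \<and>
        (\<forall>z\<in>{z \<in> S. g z \<noteq> 0}. of_rat q = f z / g z)"
    using 1 by (rule_tac x = S in exI, rule_tac x = A in exI,
            rule_tac x = "\<lambda>x. of_rat q * g x" in exI, rule_tac x = g in exI) auto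
qed

sublocale ring_space "local_fractions F"
proof
  show "sheaf_of_functions (local_fractions F)"
    unfolding sheaf_of_functions_def
  proof (intro conjI allI impI)
    fix U f f' assume f: "f \<in> regular (local_fractions F) U" and eq: "\<forall>x\<in>U. f x = f' x"
    show "f' \<in> regular (local_fractions F) U"
    proof (rule regular_localI)
      fix w assume "w \<in> U"
      then obtain S A h g where "(S, A) \<in> F" "h \<in> A" "g \<in> A"
        "w \<in> {z \<in> S. g z \<noteq> 0}" "{z \<in> S. g z \<noteq> 0} \<subseteq> U"
        "\<forall>z\<in>{z \<in> S. g z \<noteq> 0}. f z = h z / g z"
        by (rule regular_localE[OF f])
      then show "\<exists>S A h g. (S, A) \<in> F \<and> h \<in> A \<and> g \<in> A \<and>
        w \<in> {z \<in> S. g z \<noteq> 0} \<and> {z \<in> S. g z \<noteq> 0} \<subseteq> U \<and>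
        (\<forall>z\<in>{z \<in> S. g z \<noteq> 0}. f' z = h z / g z)"
        using eq
        by (rule_tac x = S in exI, rule_tac x = A in exI,
                rule_tac x = h in exI, rule_tac x = g in exI)
          (metis (mono_tags, lifting) subsetD)
    qed
  next
    fix U V f
    assume V: "openin (zariski (local_fractions F)) V" "V \<subseteq> U" and f: "f \<in> regular (local_fractions F) U"
    show "f \<in> regular (local_fractions F) V"
    proof (rule regular_localI)
      fix w assume w: "w \<in> V"
      then have wU: "w \<in> U" using V by blast
      \<comment> \<open>The zero function on \<open>V\<close> serves only to find a common
        denominator whose locus lies in \<open>V\<close>.\<close>
      obtain S A h h' g where 1: "(S, A) \<in> F" "h \<in> A" "h' \<in> A" "g \<in> A"
        "w \<in> {z \<in> S. g z \<noteq> 0}" "{z \<in> S. g z \<noteq> 0} \<subseteq> U \<inter> V"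
        "\<forall>z\<in>{z \<in> S. g z \<noteq> 0}. f z = h z / g z \<and> of_rat 0 = h' z / g z"
        by (rule regular_common_denominator[OF f regular_const_local[OF V(1), of 0] wU w])
      show "\<exists>S A h g. (S, A) \<in> F \<and> h \<in> A \<and> g \<in> A \<and>
        w \<in> {z \<in> S. g z \<noteq> 0} \<and> {z \<in> S. g z \<noteq> 0} \<subseteq> V \<and>
        (\<forall>z\<in>{z \<in> S. g z \<noteq> 0}. f z = h z / g z)"
        using 1 by (rule_tac x = S in exI, rule_tac x = A in exI,
                rule_tac x = h in exI, rule_tac x = g in exI) auto
    qed
  next
    fix U f assume *: "\<forall>x\<in>U. \<exists>V. openin (zariski (local_fractions F)) V \<and> x \<in> V \<and> V \<subseteq> U \<and>
      f \<in> regular (local_fractions F) V"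
    show "f \<in> regular (local_fractions F) U"
    proof (rule regular_localI)
      fix w assume "w \<in> U"
      then obtain V where V: "w \<in> V" "V \<subseteq> U" "f \<in> regular (local_fractions F) V" using * by blast
      obtain S A h g where "(S, A) \<in> F" "h \<in> A" "g \<in> A"
        "w \<in> {z \<in> S. g z \<noteq> 0}" "{z \<in> S. g z \<noteq> 0} \<subseteq> V"
        "\<forall>z\<in>{z \<in> S. g z \<noteq> 0}. f z = h z / g z"
        by (rule regular_localE[OF V(3,1)])
      then show "\<exists>S A h g. (S, A) \<in> F \<and> h \<in> A \<and> g \<in> A \<and>
        w \<in> {z \<in> S. g z \<noteq> 0} \<and> {z \<in> S. g z \<noteq> 0} \<subseteq> U \<and>
        (\<forall>z\<in>{z \<in> S. g z \<noteq> 0}. f z = h z / g z)"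
        using V(2) by (rule_tac x = S in exI, rule_tac x = A in exI,
                rule_tac x = h in exI, rule_tac x = g in exI) auto
    qed
  qed
next
  fix U q assume "openin (zariski (local_fractions F)) U"
  then show "(\<lambda>_. of_rat q) \<in> regular (local_fractions F) U" by (rule regular_const_local)
next
  fix U f f'
  assume f: "f \<in> regular (local_fractions F) U" and f': "f' \<in> regular (local_fractions F) U"
  show "(\<lambda>x. f x + f' x) \<in> regular (local_fractions F) U"
  proof (rule regular_localI)
    fix w assume w: "w \<in> U"
    obtain S A h h' g where 1: "(S, A) \<in> F" "h \<in> A" "h' \<in> A" "g \<in> A"
        "w \<in> {z \<in> S. g z \<noteq> 0}" "{z \<in> S. g z \<noteq> 0} \<subseteq> U \<inter> U"
        "\<forall>z\<in>{z \<in> S. g z \<noteq> 0}. f z = h z / g z \<and> f' z = h' z / g z"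
      by (rule regular_common_denominator[OF f f' w w])
    have "(\<lambda>x. h x + h' x) \<in> A" by (rule add[OF 1(1-3)])
    then show "\<exists>S A h g. (S, A) \<in> F \<and> h \<in> A \<and> g \<in> A \<and>
        w \<in> {z \<in> S. g z \<noteq> 0} \<and> {z \<in> S. g z \<noteq> 0} \<subseteq> U \<and>
        (\<forall>z\<in>{z \<in> S. g z \<noteq> 0}. f z + f' z = h z / g z)"
      using 1 by (rule_tac x = S in exI, rule_tac x = A in exI,
              rule_tac x = "\<lambda>x. h x + h' x" in exI, rule_tac x = g in exI)
        (auto simp: add_divide_distrib)
  qed
next
  fix U f f'
  assume f: "f \<in> regular (local_fractions F) U" and f': "f' \<in> regular (local_fractions F) U"
  show "(\<lambda>x. f x * f' x) \<in> regular (local_fractions F) U"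
  proof (rule regular_localI)
    fix w assume w: "w \<in> U"
    obtain S A h h' g where 1: "(S, A) \<in> F" "h \<in> A" "h' \<in> A" "g \<in> A"
        "w \<in> {z \<in> S. g z \<noteq> 0}" "{z \<in> S. g z \<noteq> 0} \<subseteq> U \<inter> U"
        "\<forall>z\<in>{z \<in> S. g z \<noteq> 0}. f z = h z / g z \<and> f' z = h' z / g z"
      by (rule regular_common_denominator[OF f f' w w])
    have "(\<lambda>x. h x * h' x) \<in> A" "(\<lambda>x. g x * g x) \<in> A" using mult[OF 1(1)] 1(2,3,4) by blast+
    then show "\<exists>S A h g. (S, A) \<in> F \<and> h \<in> A \<and> g \<in> A \<and>
        w \<in> {z \<in> S. g z \<noteq> 0} \<and> {z \<in> S. g z \<noteq> 0} \<subseteq> U \<and>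
        (\<forall>z\<in>{z \<in> S. g z \<noteq> 0}. f z * f' z = h z / g z)"
      using 1 by (rule_tac x = S in exI, rule_tac x = A in exI,
              rule_tac x = "\<lambda>x. h x * h' x" in exI, rule_tac x = "\<lambda>x. g x * g x" in exI)
        auto
  qed
next
  fix U f
  assume f: "f \<in> regular (local_fractions F) U" and nz: "\<And>x. x \<in> U \<Longrightarrow> f x \<noteq> 0"
  show "(\<lambda>x. inverse (f x)) \<in> regular (local_fractions F) U"
  proof (rule regular_localI)
    fix w assume w: "w \<in> U"
    obtain S A h g where 1: "(S, A) \<in> F" "h \<in> A" "g \<in> A"
        "w \<in> {z \<in> S. g z \<noteq> 0}" "{z \<in> S. g z \<noteq> 0} \<subseteq> U"
        "\<forall>z\<in>{z \<in> S. g z \<noteq> 0}. f z = h z / g z"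
      by (rule regular_localE[OF f w])
    \<comment> \<open>The inverse of \<open>h / g\<close> is taken as \<open>g g / (g h)\<close>
      instead of \<open>g / h\<close>: the factor \<open>g\<close> keeps the locus of the new
      denominator inside \<open>U\<close>.\<close>
    have "(\<lambda>x. g x * h x) \<in> A" "(\<lambda>x. g x * g x) \<in> A" using mult[OF 1(1)] 1(2,3) by blast+
    then show "\<exists>S A h g. (S, A) \<in> F \<and> h \<in> A \<and> g \<in> A \<and>
        w \<in> {z \<in> S. g z \<noteq> 0} \<and> {z \<in> S. g z \<noteq> 0} \<subseteq> U \<and>
        (\<forall>z\<in>{z \<in> S. g z \<noteq> 0}. inverse (f z) = h z / g z)"
      using 1 nz[OF w]
      by (rule_tac x = S in exI, rule_tac x = A in exI,
              rule_tac x = "\<lambda>x. g x * g x" in exI, rule_tac x = "\<lambda>x. g x * h x" in exI)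
        auto
  qed
next
  fix U f
  assume U: "openin (zariski (local_fractions F)) U" and f: "f \<in> regular (local_fractions F) U"
  show "openin (zariski (local_fractions F)) {x \<in> U. f x \<noteq> 0}"
    unfolding openin_iff
  proof
    fix w assume w: "w \<in> {x \<in> U. f x \<noteq> 0}"
    then have wU: "w \<in> U" by simp
    obtain S A h g where 1: "(S, A) \<in> F" "h \<in> A" "g \<in> A"
        "w \<in> {z \<in> S. g z \<noteq> 0}" "{z \<in> S. g z \<noteq> 0} \<subseteq> U"
        "\<forall>z\<in>{z \<in> S. g z \<noteq> 0}. f z = h z / g z"
      by (rule regular_localE[OF f wU])
    have "(\<lambda>x. g x * h x) \<in> A" using mult[OF 1(1)] 1(2,3) by blast
    then show "\<exists>S A g. (S, A) \<in> F \<and> g \<in> A \<and> w \<in> {z \<in> S. g z \<noteq> 0} \<and>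
        {z \<in> S. g z \<noteq> 0} \<subseteq> {x \<in> U. f x \<noteq> 0}"
      using 1 w by (rule_tac x = S in exI, rule_tac x = A in exI,
              rule_tac x = "\<lambda>x. g x * h x" in exI) auto
  qed
qed

lemma regular_member:
  assumes S: "(S, A) \<in> F" and f: "f \<in> A" and U: "openin (zariski (local_fractions F)) U" "U \<subseteq> S"
  shows "f \<in> regular (local_fractions F) U"
proof (rule regular_mono[OF _ _ U])
  show "openin (zariski (local_fractions F)) S"
    using openin_basic[OF S const[OF S, of 1]] by simp
  show "f \<in> regular (local_fractions F) S"
    using S f const[OF S, of 1]
    by (intro regular_localI, rule_tac x = S in exI, rule_tac x = A in exI,
            rule_tac x = f in exI, rule_tac x = "\<lambda>_. of_rat 1" in exI) auto
qed

end

section \<open>Products and tensor functions\<close>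

lemma tensor_functions_sum:
  assumes "finite I" "\<And>i. i \<in> I \<Longrightarrow> f i \<in> regular X U" "\<And>i. i \<in> I \<Longrightarrow> g i \<in> regular Y V"
  shows "(\<lambda>(x, y). \<Sum>i\<in>I. f i x * g i y) \<in> tensor_functions X Y U V"
proof -
  obtain h where h: "bij_betw h {0..<card I} I"
    using ex_bij_betw_nat_finite[OF assms(1)] by blast
  have "(\<Sum>i\<in>I. f i x * g i y) = (\<Sum>k<card I. f (h k) x * g (h k) y)" for x y
    using sum.reindex_bij_betw[OF h, of "\<lambda>i. f i x * g i y"] by (simp add: lessThan_atLeast0)
  moreover have "\<forall>k<card I. f (h k) \<in> regular X U \<and> g (h k) \<in> regular Y V"
    using bij_betw_apply[OF h] assms(2,3) by simp
  ultimately show ?thesis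
    unfolding tensor_functions_def
    by (intro CollectI exI[of _ "card I"] exI[of _ "\<lambda>k. f (h k)"] exI[of _ "\<lambda>k. g (h k)"]) auto
qed

lemma tensor_functionsE:
  assumes "h \<in> tensor_functions X Y U V"
  obtains n f g where "\<forall>k<(n::nat). f k \<in> regular X U" "\<forall>k<n. g k \<in> regular Y V"
    "h = (\<lambda>(x, y). \<Sum>k<n. f k x * g k y)"
  using assms unfolding tensor_functions_def by blast

definition product_family ::
    "'p qspace \<Rightarrow> 'q qspace \<Rightarrow> (('p \<times> 'q) set \<times> ('p \<times> 'q \<Rightarrow> complex) set) set" where
  "product_family X Y =
     {(U \<times> V, tensor_functions X Y U V) |U V. openin (zariski X) U \<and> openin (zariski Y) V}"

lemma product_space_eq: "X \<times>\<^sub>q Y = local_fractions (product_family X Y)"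
proof -
  have "{{z \<in> U \<times> V. h z \<noteq> 0} |U V h.
        openin (zariski X) U \<and> openin (zariski Y) V \<and> h \<in> tensor_functions X Y U V} =
      {{z \<in> S. h z \<noteq> 0} |S A h. (S, A) \<in> product_family X Y \<and> h \<in> A}"
    unfolding product_family_def by blast
  moreover have "(\<exists>S A f g. (S, A) \<in> product_family X Y \<and> f \<in> A \<and> g \<in> A \<and> P S f g) \<longleftrightarrow>
     (\<exists>U V f g. openin (zariski X) U \<and> openin (zariski Y) V \<and>
        f \<in> tensor_functions X Y U V \<and> g \<in> tensor_functions X Y U V \<and> P (U \<times> V) f g)" for P
    unfolding product_family_def by (simp, metis)
  ultimately show ?thesis
    unfolding product_space_def local_fractions_def by (simp only:)
qed

text \<open>A sum of two tensors is indexed by the disjoint union of their index sets, a product by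
  the pairs of indices; boxes intersect in boxes, to which tensors restrict factor by
  factor.\<close>

lemma fraction_family_product:
  assumes X: "ring_space X" and Y: "ring_space Y"
  shows "fraction_family (product_family X Y)"
proof
  interpret X: ring_space X by fact
  interpret Y: ring_space Y by fact
  fix S A q assume "(S, A) \<in> product_family X Y"
  then obtain U V where 1: "openin (zariski X) U" "openin (zariski Y) V"
      "A = tensor_functions X Y U V"
    unfolding product_family_def by blast
  have "(\<lambda>(x::'a, y::'b). \<Sum>i\<in>{()}. of_rat q * of_rat 1) \<in> tensor_functions X Y U V"
    by (rule tensor_functions_sum) (use 1 X.regular_const Y.regular_const in blast)+
  then show "(\<lambda>_. of_rat q) \<in> A" using 1 by (simp add: case_prod_unfold)
next
  interpret X: ring_space X by fact
  interpret Y: ring_space Y by fact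
  fix S A h h' assume "(S, A) \<in> product_family X Y" and h: "h \<in> A" "h' \<in> A"
  then obtain U V where 1: "openin (zariski X) U" "openin (zariski Y) V"
      "A = tensor_functions X Y U V"
    unfolding product_family_def by blast
  obtain n f g where 2: "\<forall>k<(n::nat). f k \<in> regular X U" "\<forall>k<n. g k \<in> regular Y V"
    "h = (\<lambda>(x, y). \<Sum>k<n. f k x * g k y)"
    by (rule tensor_functionsE[OF h(1)[unfolded 1(3)]])
  obtain m f' g' where 3: "\<forall>k<(m::nat). f' k \<in> regular X U" "\<forall>k<m. g' k \<in> regular Y V"
    "h' = (\<lambda>(x, y). \<Sum>k<m. f' k x * g' k y)"
    by (rule tensor_functionsE[OF h(2)[unfolded 1(3)]])
  have "(\<lambda>(x, y). \<Sum>i\<in>{..<n} <+> {..<m}. case_sum f f' i x * case_sum g g' i y)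
      \<in> tensor_functions X Y U V"
    by (rule tensor_functions_sum) (use 2 3 in auto)
  then show "(\<lambda>x. h x + h' x) \<in> A" using 1 2 3 by (simp add: case_prod_unfold sum.Plus)
  have "(\<lambda>(x, y). \<Sum>i\<in>{..<n} \<times> {..<m}. (f (fst i) x * f' (snd i) x) * (g (fst i) y * g' (snd i) y))
      \<in> tensor_functions X Y U V"
    by (rule tensor_functions_sum) (use 1 2 3 X.regular_mult Y.regular_mult in auto)
  moreover have "h z * h' z = (\<Sum>i\<in>{..<n} \<times> {..<m}.
      (f (fst i) (fst z) * f' (snd i) (fst z)) * (g (fst i) (snd z) * g' (snd i) (snd z)))" for z
    unfolding 2(3) 3(3) case_prod_unfold sum_product sum.cartesian_product by (simp add: mult_ac)
  ultimately show "(\<lambda>x. h x * h' x) \<in> A" using 1(3) by (simp add: case_prod_unfold)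
next
  interpret X: ring_space X by fact
  interpret Y: ring_space Y by fact
  fix S A S' A' assume "(S, A) \<in> product_family X Y" "(S', A') \<in> product_family X Y"
  then obtain U V U' V' where 1: "openin (zariski X) U" "openin (zariski Y) V" "S = U \<times> V"
      "A = tensor_functions X Y U V" "openin (zariski X) U'" "openin (zariski Y) V'" "S' = U' \<times> V'"
      "A' = tensor_functions X Y U' V'"
    unfolding product_family_def by blast
  have mono: "tensor_functions X Y U0 V0 \<subseteq> tensor_functions X Y (U \<inter> U') (V \<inter> V')"
    if "openin (zariski X) U0" "openin (zariski Y) V0" "U \<inter> U' \<subseteq> U0" "V \<inter> V' \<subseteq> V0" for U0 V0
  proof
    fix h assume "h \<in> tensor_functions X Y U0 V0"
    then obtain n f g where 2: "\<forall>k<(n::nat). f k \<in> regular X U0"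
      "\<forall>k<n. g k \<in> regular Y V0" "h = (\<lambda>(x, y). \<Sum>k<n. f k x * g k y)"
      by (rule tensor_functionsE)
    have "(\<lambda>(x, y). \<Sum>k\<in>{..<n}. f k x * g k y) \<in> tensor_functions X Y (U \<inter> U') (V \<inter> V')"
    proof (rule tensor_functions_sum)
      fix k assume k: "k \<in> {..<n}"
      show "f k \<in> regular X (U \<inter> U')"
        using X.regular_mono[OF that(1) _ openin_Int[OF 1(1,5)] that(3)] 2(1) k by simp
      show "g k \<in> regular Y (V \<inter> V')"
        using Y.regular_mono[OF that(2) _ openin_Int[OF 1(2,6)] that(4)] 2(2) k by simp
    qed simp
    then show "h \<in> tensor_functions X Y (U \<inter> U') (V \<inter> V')" using 2(3) by simp
  qed
  show "\<exists>A''. (S \<inter> S', A'') \<in> product_family X Y \<and> A \<subseteq> A'' \<and> A' \<subseteq> A''"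
  proof (intro exI[of _ "tensor_functions X Y (U \<inter> U') (V \<inter> V')"] conjI)
    show "(S \<inter> S', tensor_functions X Y (U \<inter> U') (V \<inter> V')) \<in> product_family X Y"
      unfolding product_family_def using 1
      by (intro CollectI exI[of _ "U \<inter> U'"] exI[of _ "V \<inter> V'"]) auto
  qed (use mono 1 in auto)
qed

lemma ring_space_product:
  assumes "ring_space X" "ring_space Y"
  shows "ring_space (X \<times>\<^sub>q Y)"
proof -
  interpret fraction_family "product_family X Y" using fraction_family_product assms .
  show ?thesis unfolding product_space_eq by (rule ring_space_axioms)
qed

lemma points_product:
  assumes "ring_space X" "ring_space Y"
  shows "points (X \<times>\<^sub>q Y) = points X \<times> points Y"
proof
  interpret F: fraction_family "product_family X Y" using fraction_family_product assms .
  show "points (X \<times>\<^sub>q Y) \<subseteq> points X \<times> points Y"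
  proof
    fix z assume z: "z \<in> points (X \<times>\<^sub>q Y)"
    obtain S A and g :: "_ \<Rightarrow> complex" where "(S, A) \<in> product_family X Y" "z \<in> {z \<in> S. g z \<noteq> 0}"
      using F.openin_iff[of "points (X \<times>\<^sub>q Y)"] z unfolding product_space_eq
      by (meson openin_topspace)
    then show "z \<in> points X \<times> points Y"
      unfolding product_family_def by (auto dest: openin_subset)
  qed
  have "(points X \<times> points Y, tensor_functions X Y (points X) (points Y)) \<in> product_family X Y"
    unfolding product_family_def by blast
  from F.openin_basic[OF this F.const[OF this, of 1]]
  show "points X \<times> points Y \<subseteq> points (X \<times>\<^sub>q Y)"
    unfolding product_space_eq by (auto dest!: openin_subset)
qed

section \<open>Spaces of fractions, the torus and the multiplicative group\<close>

lemma fraction_family_singleton: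
  "fraction_family {(S, rat_algebra F)}"
  by standard (auto intro: rat_algebra.intros)

lemma zariski_fraction_space:
  "zariski (fraction_space S A) = zariski (local_fractions {(S, A)})"
  unfolding fraction_space_def local_fractions_def Let_def by simp

text \<open>The two descriptions differ in shape: \<open>fraction_space\<close> allows a fraction on
  any open set where the denominator is nonzero, \<open>local_fractions\<close> insists on its
  entire nonvanishing locus.\<close>

lemma regular_fraction_space:
  assumes U: "openin (zariski (fraction_space S (rat_algebra F))) U"
  shows "regular (fraction_space S (rat_algebra F)) U = regular (local_fractions {(S, rat_algebra F)}) U"
proof (intro set_eqI iffI)
  interpret L: fraction_family "{(S, rat_algebra F)}" by (rule fraction_family_singleton)
  let ?Z = "zariski (local_fractions {(S, rat_algebra F)})"
  have eq: "h \<in> regular (fraction_space S (rat_algebra F)) U \<longleftrightarrow>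
      (\<forall>x\<in>U. \<exists>V f g. openin ?Z V \<and> x \<in> V \<and> V \<subseteq> U \<and> f \<in> rat_algebra F \<and> g \<in> rat_algebra F \<and>
                  (\<forall>y\<in>V. g y \<noteq> 0 \<and> h y = f y / g y))" for h
    unfolding zariski_fraction_space[symmetric] unfolding fraction_space_def Let_def by simp
  {
    fix h assume h: "h \<in> regular (fraction_space S (rat_algebra F)) U"
    show "h \<in> regular (local_fractions {(S, rat_algebra F)}) U"
    proof (rule L.regular_localI)
      fix w assume "w \<in> U"
      then obtain V f g where V: "openin ?Z V" "w \<in> V" "V \<subseteq> U" "f \<in> rat_algebra F" "g \<in> rat_algebra F"
        "\<forall>y\<in>V. g y \<noteq> 0 \<and> h y = f y / g y"
        using h unfolding eq by meson
      obtain k where k: "k \<in> rat_algebra F" "w \<in> {z \<in> S. k z \<noteq> 0}" "{z \<in> S. k z \<noteq> 0} \<subseteq> V"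
        using V(1)[unfolded L.openin_iff] V(2) by auto
      \<comment> \<open>Expanding the fraction by \<open>k\<close> shrinks the locus of the
        denominator to the basic set of \<open>k\<close>, which lies in \<open>V\<close>.\<close>
      have "(\<lambda>x. f x * k x) \<in> rat_algebra F" "(\<lambda>x. g x * k x) \<in> rat_algebra F"
        using V k by (auto intro: rat_algebra.mult)
      moreover have "{z \<in> S. g z * k z \<noteq> 0} = {z \<in> S. k z \<noteq> 0}"
        using V(6) k(3) by (auto simp: subset_iff)
      moreover have "h z = (f z * k z) / (g z * k z)" if "z \<in> {z \<in> S. k z \<noteq> 0}" for z
        using that V(6) k(3) by (auto simp: subset_iff)
      ultimately show "\<exists>S' A f g. (S', A) \<in> {(S, rat_algebra F)} \<and> f \<in> A \<and> g \<in> A \<and>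
        w \<in> {z \<in> S'. g z \<noteq> 0} \<and> {z \<in> S'. g z \<noteq> 0} \<subseteq> U \<and>
        (\<forall>z\<in>{z \<in> S'. g z \<noteq> 0}. h z = f z / g z)"
        using k(2,3) V(3)
        by (rule_tac x = S in exI, rule_tac x = "rat_algebra F" in exI,
            rule_tac x = "\<lambda>x. f x * k x" in exI,
                    rule_tac x = "\<lambda>x. g x * k x" in exI) auto
    qed
  next
    fix h assume h: "h \<in> regular (local_fractions {(S, rat_algebra F)}) U"
    show "h \<in> regular (fraction_space S (rat_algebra F)) U"
      unfolding eq
    proof
      fix x assume "x \<in> U"
      from h this obtain S' A f g where 1: "(S', A) \<in> {(S, rat_algebra F)}" "f \<in> A" "g \<in> A"
        "x \<in> {z \<in> S'. g z \<noteq> 0}" "{z \<in> S'. g z \<noteq> 0} \<subseteq> U"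
        "\<forall>z\<in>{z \<in> S'. g z \<noteq> 0}. h z = f z / g z"
        by (rule L.regular_localE)
      then show "\<exists>V f g. openin ?Z V \<and> x \<in> V \<and> V \<subseteq> U \<and> f \<in> rat_algebra F \<and> g \<in> rat_algebra F \<and>
                  (\<forall>y\<in>V. g y \<noteq> 0 \<and> h y = f y / g y)"
        using L.openin_basic[OF 1(1,3)]
        by (rule_tac x = "{z \<in> S. g z \<noteq> 0}" in exI, rule_tac x = f in exI,
                rule_tac x = g in exI)
          auto
    qed
  }
qed

lemma ring_space_fraction_space: "ring_space (fraction_space S (rat_algebra F))"
proof -
  interpret fraction_family "{(S, rat_algebra F)}" by (rule fraction_family_singleton)
  show ?thesis
    by (rule ring_space_cong[OF ring_space_axioms])
      (simp_all add: regular_fraction_space zariski_fraction_space)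
qed

lemma points_fraction_space: "points (fraction_space S (rat_algebra F)) = S"
proof
  interpret L: fraction_family "{(S, rat_algebra F)}" by (rule fraction_family_singleton)
  show "points (fraction_space S (rat_algebra F)) \<subseteq> S"
    using L.openin_iff[of "points (fraction_space S (rat_algebra F))"]
    unfolding zariski_fraction_space by auto
  show "S \<subseteq> points (fraction_space S (rat_algebra F))"
    using openin_subset[OF L.openin_basic[OF _ rat_algebra.const[of 1], of S]]
    unfolding zariski_fraction_space by simp
qed

lemma ring_space_torus: "ring_space (torus r)"
  unfolding torus_def by (rule ring_space_fraction_space)

lemma points_torus: "points (torus r) = torus_points r"
  unfolding torus_def by (rule points_fraction_space)

lemma ring_space_Gm: "ring_space Gm"
  unfolding Gm_def by (rule ring_space_fraction_space)

lemma points_Gm: "points Gm = {c. c \<noteq> 0}"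
  unfolding Gm_def by (rule points_fraction_space)

lemma regular_generator:
  assumes "f \<in> F" "openin (zariski (fraction_space S (rat_algebra F))) U"
  shows "f \<in> regular (fraction_space S (rat_algebra F)) U"
proof -
  interpret L: fraction_family "{(S, rat_algebra F)}" by (rule fraction_family_singleton)
  show ?thesis
    unfolding regular_fraction_space[OF assms(2)]
    by (rule L.regular_member[of S "rat_algebra F"])
      (use assms openin_subset[OF assms(2), unfolded points_fraction_space] in
        \<open>auto simp: zariski_fraction_space intro: rat_algebra.gen\<close>)
qed

section \<open>Open subspaces and the passage from affine charts to varieties\<close>

lemma zariski_subspace: "zariski (subspace_of X S) = subtopology (zariski X) S"
  unfolding subspace_of_def by simp

lemma regular_subspace_iff:
  "f \<in> regular (subspace_of X S) U \<longleftrightarrow> (\<forall>x\<in>U. \<exists>V g. openin (zariski X) V \<and> x \<in> V \<and> V \<inter> S \<subseteq> U \<and>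
                  g \<in> regular X V \<and> (\<forall>y\<in>V \<inter> S. f y = g y))"
  unfolding subspace_of_def by simp

lemma sheaf_cong:
  assumes "sheaf_of_functions X" "openin (zariski X) U" "f \<in> regular X U" "\<And>x. x \<in> U \<Longrightarrow> f x = g x"
  shows "g \<in> regular X U"
  using assms(1)[unfolded sheaf_of_functions_def, THEN conjunct1, rule_format, OF assms(2,3)] assms(4)
  by blast

lemma sheaf_mono:
  assumes "sheaf_of_functions X" "openin (zariski X) U" "f \<in> regular X U" "openin (zariski X) V" "V \<subseteq> U"
  shows "f \<in> regular X V"
  by (rule assms(1)[unfolded sheaf_of_functions_def, THEN conjunct2, THEN conjunct1, rule_format,
        OF assms(2,4,5,3)])

lemma sheaf_local:
  assumes "sheaf_of_functions X" "openin (zariski X) U"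
    and "\<And>x. x \<in> U \<Longrightarrow> \<exists>V. openin (zariski X) V \<and> x \<in> V \<and> V \<subseteq> U \<and> f \<in> regular X V"
  shows "f \<in> regular X U"
  using assms(1)[unfolded sheaf_of_functions_def, THEN conjunct2, THEN conjunct2, rule_format, OF assms(2)]
    assms(3) by blast

lemma regular_open_subspace:
  assumes X: "sheaf_of_functions X" and D: "openin (zariski X) D" and U: "openin (zariski X) U" "U \<subseteq> D"
  shows "regular (subspace_of X D) U = regular X U"
proof (intro set_eqI iffI)
  fix f assume f: "f \<in> regular (subspace_of X D) U"
  show "f \<in> regular X U"
  proof (rule sheaf_local[OF X U(1)])
    fix x assume x: "x \<in> U"
    then obtain V g where V: "openin (zariski X) V" "x \<in> V" "V \<inter> D \<subseteq> U" "g \<in> regular X V"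
        "\<forall>y\<in>V \<inter> D. f y = g y"
      using f unfolding regular_subspace_iff by meson
    have VD: "openin (zariski X) (V \<inter> D)" using V D by blast
    have "g \<in> regular X (V \<inter> D)" by (rule sheaf_mono[OF X V(1,4) VD]) simp
    then have "f \<in> regular X (V \<inter> D)" by (rule sheaf_cong[OF X VD]) (use V in auto)
    then show "\<exists>V. openin (zariski X) V \<and> x \<in> V \<and> V \<subseteq> U \<and> f \<in> regular X V"
      using VD V x U by (rule_tac x = "V \<inter> D" in exI) auto
  qed
next
  fix f assume f: "f \<in> regular X U"
  show "f \<in> regular (subspace_of X D) U"
    unfolding regular_subspace_iff
  proof
    fix x assume "x \<in> U"
    then show "\<exists>V g. openin (zariski X) V \<and> x \<in> V \<and> V \<inter> D \<subseteq> U \<and>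
                  g \<in> regular X V \<and> (\<forall>y\<in>V \<inter> D. f y = g y)"
      using f U by (rule_tac x = U in exI, rule_tac x = f in exI) auto
  qed
qed

text \<open>Transport of structure along one chart: a function on \<open>V\<close> is pushed to the
  model \<open>B\<close>, the operation is performed there, and the result is pulled back.
  Identification of functions on \<open>V\<close> with functions on the subspace uses that
  \<open>D\<close> is open.\<close>

lemma ring_space_isomorphic:
  assumes X: "sheaf_of_functions X" and D: "openin (zariski X) D"
    and iso: "isomorphic (subspace_of X D) B" and B: "ring_space B"
    and V: "openin (zariski X) V" "V \<subseteq> D"
  shows regular_const_iso: "(\<lambda>_. of_rat q) \<in> regular X V"
    and regular_add_iso: "a \<in> regular X V \<Longrightarrow> b \<in> regular X V \<Longrightarrow> (\<lambda>x. a x + b x) \<in> regular X V"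
    and regular_mult_iso: "a \<in> regular X V \<Longrightarrow> b \<in> regular X V \<Longrightarrow> (\<lambda>x. a x * b x) \<in> regular X V"
    and regular_inverse_iso: "a \<in> regular X V \<Longrightarrow> (\<And>x. x \<in> V \<Longrightarrow> a x \<noteq> 0) \<Longrightarrow>
      (\<lambda>x. inverse (a x)) \<in> regular X V"
    and openin_nonzero_iso: "a \<in> regular X V \<Longrightarrow> openin (zariski X) {x \<in> V. a x \<noteq> 0}"
proof -
  interpret B: ring_space B by fact
  let ?A = "subspace_of X D"
  have ptsA: "points ?A = D"
    using openin_subset[OF D] by (auto simp: zariski_subspace)
  obtain f g where f: "morphism ?A B f" and g: "morphism B ?A g"
      and gf: "\<And>x. x \<in> D \<Longrightarrow> g (f x) = x" and fg: "\<And>y. y \<in> points B \<Longrightarrow> f (g y) = y"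
    using iso unfolding isomorphic_def ptsA by blast
  have openA: "openin (zariski ?A) W \<longleftrightarrow> openin (zariski X) W \<and> W \<subseteq> D" for W
    unfolding zariski_subspace using D openin_open_subtopology by blast
  have VA: "openin (zariski ?A) V" using openA V by blast
  define V' where "V' = {y \<in> points B. g y \<in> V}"
  have contg: "continuous_map (zariski B) (zariski ?A) g" using g unfolding morphism_def by blast
  have contf: "continuous_map (zariski ?A) (zariski B) f" using f unfolding morphism_def by blast
  have V': "openin (zariski B) V'"
    unfolding V'_def using openin_continuous_map_preimage[OF contg VA] .
  have fB: "f x \<in> points B" if "x \<in> D" for x
    using contf that unfolding continuous_map_def ptsA by auto
  have preV: "{x \<in> D. f x \<in> V'} = V"
    unfolding V'_def using gf fB V(2) by auto
  have push: "(\<lambda>y. a (g y)) \<in> regular B V'" if "a \<in> regular X V" for a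
  proof -
    have "a \<in> regular ?A V" using that regular_open_subspace[OF X D V] by simp
    then show ?thesis using g VA unfolding morphism_def V'_def by blast
  qed
  have pull: "b \<in> regular X V" if "k \<in> regular B V'" "\<And>x. x \<in> V \<Longrightarrow> k (f x) = b x" for k b
  proof -
    have "(\<lambda>x. k (f x)) \<in> regular ?A {x \<in> points ?A. f x \<in> V'}"
      using f V' that(1) unfolding morphism_def by blast
    then have "(\<lambda>x. k (f x)) \<in> regular X V"
      unfolding ptsA preV regular_open_subspace[OF X D V] .
    then show ?thesis by (rule sheaf_cong[OF X V(1)]) (rule that(2))
  qed
  have gfV: "g (f x) = x" if "x \<in> V" for x using gf that V by blast
  show "(\<lambda>_. of_rat q) \<in> regular X V"
    by (rule pull[OF B.regular_const[OF V']]) simp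
  show "(\<lambda>x. a x + b x) \<in> regular X V" if "a \<in> regular X V" "b \<in> regular X V"
    by (rule pull[OF B.regular_add[OF V' push[OF that(1)] push[OF that(2)]]]) (simp add: gfV)
  show "(\<lambda>x. a x * b x) \<in> regular X V" if "a \<in> regular X V" "b \<in> regular X V"
    by (rule pull[OF B.regular_mult[OF V' push[OF that(1)] push[OF that(2)]]]) (simp add: gfV)
  show "(\<lambda>x. inverse (a x)) \<in> regular X V" if "a \<in> regular X V" "\<And>x. x \<in> V \<Longrightarrow> a x \<noteq> 0"
    by (rule pull[OF B.regular_inverse[OF V' push[OF that(1)]]]) (use that(2) in \<open>auto simp: gfV V'_def\<close>)
  show "openin (zariski X) {x \<in> V. a x \<noteq> 0}" if a: "a \<in> regular X V"
  proof -
    have "openin (zariski ?A) {x \<in> points ?A. f x \<in> {y \<in> V'. a (g y) \<noteq> 0}}"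
      by (rule openin_continuous_map_preimage[OF contf B.openin_nonzero[OF V' push[OF a]]])
    moreover have "{x \<in> points ?A. f x \<in> {y \<in> V'. a (g y) \<noteq> 0}} = {x \<in> V. a x \<noteq> 0}"
      unfolding ptsA preV[symmetric] using gf by auto
    ultimately show ?thesis using openA by simp
  qed
qed

text \<open>All properties in question are local, so each is checked on intersections with affine
  charts, which are isomorphic to spaces of fractions.\<close>

lemma ring_space_rat_variety:
  assumes "rat_variety X"
  shows "ring_space X"
proof -
  have X: "sheaf_of_functions X" using assms unfolding rat_variety_def by blast
  have cover: "\<exists>D B. openin (zariski X) D \<and> x \<in> D \<and> isomorphic (subspace_of X D) B \<and>
      ring_space (B :: (nat \<Rightarrow> complex) qspace)" if x: "x \<in> points X" for x
  proof -
    obtain \<U> where \<U>: "\<Union>\<U> = points X"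
        "\<forall>U\<in>\<U>. openin (zariski X) U \<and> affine_variety (subspace_of X U)"
      using assms unfolding rat_variety_def by metis
    obtain D where "D \<in> \<U>" "x \<in> D" using \<U>(1) x by auto
    with \<U>(2) have D: "openin (zariski X) D" "x \<in> D" "affine_variety (subspace_of X D)"
      by simp_all
    then obtain n Z where "isomorphic (subspace_of X D) (fraction_space Z (rat_polynomials n))"
      unfolding affine_variety_def by metis
    moreover have "ring_space (fraction_space Z (rat_polynomials n))"
      unfolding rat_polynomials_def by (rule ring_space_fraction_space)
    ultimately show ?thesis using D by (intro exI conjI)
  qed
  have loc: "b \<in> regular X U"
    if U: "openin (zariski X) U"
      and *: "\<And>D B V. openin (zariski X) D \<Longrightarrow> isomorphic (subspace_of X D) B \<Longrightarrow>
        ring_space (B :: (nat \<Rightarrow> complex) qspace) \<Longrightarrow> openin (zariski X) V \<Longrightarrow> V \<subseteq> D \<Longrightarrow> V \<subseteq> U \<Longrightarrow>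
        b \<in> regular X V" for b U
  proof (rule sheaf_local[OF X U])
    fix x assume x: "x \<in> U"
    then have xX: "x \<in> points X" using openin_subset[OF U] by auto
    obtain D B where D: "openin (zariski X) D" "x \<in> D" "isomorphic (subspace_of X D) B"
        "ring_space (B :: (nat \<Rightarrow> complex) qspace)"
      using cover[OF xX] by (elim exE conjE)
    have "openin (zariski X) (D \<inter> U)" using D U by blast
    moreover from this have "b \<in> regular X (D \<inter> U)" by (intro *[OF D(1,3,4)]) auto
    ultimately show "\<exists>V. openin (zariski X) V \<and> x \<in> V \<and> V \<subseteq> U \<and> b \<in> regular X V"
      using D x by (rule_tac x = "D \<inter> U" in exI) auto
  qed
  show ?thesis
  proof
    fix U q assume U: "openin (zariski X) U"
    show "(\<lambda>_. of_rat q) \<in> regular X U"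
      by (rule loc[OF U]) (rule regular_const_iso[OF X])
  next
    fix U f g assume U: "openin (zariski X) U" and f: "f \<in> regular X U" and g: "g \<in> regular X U"
    show "(\<lambda>x. f x + g x) \<in> regular X U"
      by (rule loc[OF U], rule regular_add_iso[OF X])
        (assumption | rule sheaf_mono[OF X U f] sheaf_mono[OF X U g])+
    show "(\<lambda>x. f x * g x) \<in> regular X U"
      by (rule loc[OF U], rule regular_mult_iso[OF X])
        (assumption | rule sheaf_mono[OF X U f] sheaf_mono[OF X U g])+
  next
    fix U f assume U: "openin (zariski X) U" and f: "f \<in> regular X U" and nz: "\<And>x. x \<in> U \<Longrightarrow> f x \<noteq> 0"
    show "(\<lambda>x. inverse (f x)) \<in> regular X U"
      by (rule loc[OF U], rule regular_inverse_iso[OF X])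
        (assumption | rule sheaf_mono[OF X U f] nz | erule subsetD)+
  next
    fix U f assume U: "openin (zariski X) U" and f: "f \<in> regular X U"
    show "openin (zariski X) {x \<in> U. f x \<noteq> 0}"
    proof (subst openin_subopen, intro ballI)
      fix x assume x: "x \<in> {x \<in> U. f x \<noteq> 0}"
      then have xX: "x \<in> points X" using openin_subset[OF U] by auto
      obtain D B where D: "openin (zariski X) D" "x \<in> D" "isomorphic (subspace_of X D) B"
          "ring_space (B :: (nat \<Rightarrow> complex) qspace)"
        using cover[OF xX] by (elim exE conjE)
      have DU: "openin (zariski X) (D \<inter> U)" using D U by blast
      have "openin (zariski X) {y \<in> D \<inter> U. f y \<noteq> 0}"
        by (rule openin_nonzero_iso[OF X D(1,3,4) DU]) (auto intro: sheaf_mono[OF X U f DU])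
      then show "\<exists>T. openin (zariski X) T \<and> x \<in> T \<and> T \<subseteq> {x \<in> U. f x \<noteq> 0}"
        using x D(2) by (rule_tac x = "{y \<in> D \<inter> U. f y \<noteq> 0}" in exI) auto
    qed
  qed (rule X)
qed
section \<open>Partial morphisms\<close>

text \<open>A rational morphism without the demand that the domain be dense. In contrast to rational
  morphisms these compose freely; density of domains is settled separately, for the particular maps
  that occur.\<close>

definition partial_morphism :: "'p qspace \<Rightarrow> 'q qspace \<Rightarrow> ('p \<rightharpoonup> 'q) \<Rightarrow> bool" where
  "partial_morphism Y Z f \<longleftrightarrow> ran f \<subseteq> points Z \<and>
     (\<forall>V. openin (zariski Z) V \<longrightarrow> openin (zariski Y) (f -` Some ` V)) \<and>
     (\<forall>V g. openin (zariski Z) V \<longrightarrow> g \<in> regular Z V \<longrightarrow>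
        (\<lambda>y. g (the (f y))) \<in> regular Y (f -` Some ` V))"

lemma partial_morphism_ran: "partial_morphism Y Z f \<Longrightarrow> f y = Some z \<Longrightarrow> z \<in> points Z"
  unfolding partial_morphism_def by (auto intro: ranI)

lemma partial_morphism_openin:
  "partial_morphism Y Z f \<Longrightarrow> openin (zariski Z) V \<Longrightarrow> openin (zariski Y) (f -` Some ` V)"
  unfolding partial_morphism_def by simp

lemma partial_morphism_regular:
  "partial_morphism Y Z f \<Longrightarrow> openin (zariski Z) V \<Longrightarrow> g \<in> regular Z V \<Longrightarrow>
    (\<lambda>y. g (the (f y))) \<in> regular Y (f -` Some ` V)"
  unfolding partial_morphism_def by simp

lemma partial_morphism_dom_eq:
  assumes "partial_morphism Y Z f" shows "f -` Some ` points Z = dom f"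
  using partial_morphism_ran[OF assms] by (auto simp: dom_def)

lemma partial_morphism_dom:
  assumes "partial_morphism Y Z f" shows "openin (zariski Y) (dom f)"
  using partial_morphism_openin[OF assms openin_topspace] partial_morphism_dom_eq[OF assms] by simp

lemma partial_morphism_bind:
  assumes Y: "ring_space Y" and f: "partial_morphism Y Z f" and g: "partial_morphism Z W g"
  shows "partial_morphism Y W (\<lambda>y. Option.bind (f y) g)"
proof -
  interpret Y: ring_space Y by fact
  have pre: "(\<lambda>y. Option.bind (f y) g) -` Some ` V = f -` Some ` (g -` Some ` V)" for V
    by (auto simp: image_iff bind_eq_Some_conv)
  have op: "openin (zariski Y) (f -` Some ` (g -` Some ` V))" if "openin (zariski W) V" for V
    by (rule partial_morphism_openin[OF f partial_morphism_openin[OF g that]])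
  show ?thesis
    unfolding partial_morphism_def pre
  proof (intro conjI allI impI op)
    show "ran (\<lambda>y. Option.bind (f y) g) \<subseteq> points W"
      using partial_morphism_ran[OF g] by (auto simp: ran_def bind_eq_Some_conv)
    fix V h assume V: "openin (zariski W) V" and h: "h \<in> regular W V"
    have "(\<lambda>y. h (the (g (the (f y))))) \<in> regular Y (f -` Some ` (g -` Some ` V))"
      by (rule partial_morphism_regular[OF f partial_morphism_openin[OF g V]
            partial_morphism_regular[OF g V h]])
    then show "(\<lambda>y. h (the (Option.bind (f y) g))) \<in> regular Y (f -` Some ` (g -` Some ` V))"
      by (rule Y.regular_cong[OF op[OF V]]) auto
  qed
qed

definition option_pair :: "('p \<rightharpoonup> 'q) \<Rightarrow> ('p \<rightharpoonup> 'r) \<Rightarrow> 'p \<rightharpoonup> 'q \<times> 'r" where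
  "option_pair f g y = Option.bind (f y) (\<lambda>z. map_option (Pair z) (g y))"

lemma option_pair_eq_Some: "option_pair f g y = Some (z, w) \<longleftrightarrow> f y = Some z \<and> g y = Some w"
  unfolding option_pair_def by (auto simp: bind_eq_Some_conv)

lemma tensor_pullback:
  assumes Y: "ring_space Y" and f: "partial_morphism Y Z f" and g: "partial_morphism Y W g"
    and U: "openin (zariski Z) U" and V: "openin (zariski W) V" and h: "h \<in> tensor_functions Z W U V"
  shows "(\<lambda>y. h (the (f y), the (g y))) \<in> regular Y (f -` Some ` U \<inter> g -` Some ` V)"
proof -
  interpret Y: ring_space Y by fact
  obtain n a b where ab: "\<forall>k<(n::nat). a k \<in> regular Z U" "\<forall>k<n. b k \<in> regular W V"
    "h = (\<lambda>(x, y). \<Sum>k<n. a k x * b k y)"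
    using h by (rule tensor_functionsE)
  have fU: "openin (zariski Y) (f -` Some ` U)" and gV: "openin (zariski Y) (g -` Some ` V)"
    using partial_morphism_openin f g U V by blast+
  then have O: "openin (zariski Y) (f -` Some ` U \<inter> g -` Some ` V)" by blast
  have "(\<lambda>y. \<Sum>k<n. a k (the (f y)) * b k (the (g y))) \<in> regular Y (f -` Some ` U \<inter> g -` Some ` V)"
  proof (intro Y.regular_sum Y.regular_mult O)
    fix k assume k: "k < n"
    show "(\<lambda>y. a k (the (f y))) \<in> regular Y (f -` Some ` U \<inter> g -` Some ` V)"
      by (rule Y.regular_mono[OF fU partial_morphism_regular[OF f U] O]) (use ab k in auto)
    show "(\<lambda>y. b k (the (g y))) \<in> regular Y (f -` Some ` U \<inter> g -` Some ` V)"
      by (rule Y.regular_mono[OF gV partial_morphism_regular[OF g V] O]) (use ab k in auto)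
  qed
  then show ?thesis unfolding ab(3) by simp
qed

text \<open>Universal property of the product. Tensor functions pull back to regular functions;
  hence basic open sets of the product pull back to open sets, and local fractions of tensors to
  quotients of regular functions.\<close>

lemma partial_morphism_pair:
  assumes Y: "ring_space Y" and Z: "ring_space Z" and W: "ring_space W"
    and f: "partial_morphism Y Z f" and g: "partial_morphism Y W g"
  shows "partial_morphism Y (Z \<times>\<^sub>q W) (option_pair f g)"
proof -
  interpret Y: ring_space Y by fact
  interpret F: fraction_family "product_family Z W" by (rule fraction_family_product[OF Z W])
  have basic: "openin (zariski Y) {y \<in> f -` Some ` U \<inter> g -` Some ` V. h (the (f y), the (g y)) \<noteq> 0}"
    if "openin (zariski Z) U" "openin (zariski W) V" "h \<in> tensor_functions Z W U V" for U V h
  proof (rule Y.openin_nonzero[OF _ tensor_pullback[OF Y f g that]])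
    show "openin (zariski Y) (f -` Some ` U \<inter> g -` Some ` V)"
      by (rule openin_Int[OF partial_morphism_openin[OF f that(1)] partial_morphism_openin[OF g that(2)]])
  qed
  have op: "openin (zariski Y) (option_pair f g -` Some ` V)" if V: "openin (zariski (Z \<times>\<^sub>q W)) V" for V
  proof (subst openin_subopen, intro ballI)
    fix y assume "y \<in> option_pair f g -` Some ` V"
    then obtain z w where zw: "(z, w) \<in> V" "f y = Some z" "g y = Some w"
      by (auto simp: option_pair_eq_Some)
    obtain S A h where S: "(S, A) \<in> product_family Z W" "h \<in> A" "(z, w) \<in> {z \<in> S. h z \<noteq> 0}"
        "{z \<in> S. h z \<noteq> 0} \<subseteq> V"
      using V[unfolded product_space_eq F.openin_iff] zw(1) by meson
    obtain U U' where U: "openin (zariski Z) U" "openin (zariski W) U'" "S = U \<times> U'"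
        "A = tensor_functions Z W U U'"
      using S(1) unfolding product_family_def by auto
    let ?T = "{y \<in> f -` Some ` U \<inter> g -` Some ` U'. h (the (f y), the (g y)) \<noteq> 0}"
    have "y \<in> ?T" using zw S(3) U(3) by auto
    moreover have "?T \<subseteq> option_pair f g -` Some ` V"
    proof
      fix x assume "x \<in> ?T"
      then obtain a b where ab: "f x = Some a" "g x = Some b" "a \<in> U" "b \<in> U'" "h (a, b) \<noteq> 0" by auto
      then have "(a, b) \<in> V" using S(4) U(3) by auto
      then show "x \<in> option_pair f g -` Some ` V"
        using ab option_pair_eq_Some[of f g x a b] by auto
    qed
    ultimately show "\<exists>T. openin (zariski Y) T \<and> y \<in> T \<and> T \<subseteq> option_pair f g -` Some ` V"
      using basic[OF U(1,2) S(2)[unfolded U(4)]] by (intro exI[of _ ?T] conjI)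
  qed
  show ?thesis
    unfolding partial_morphism_def
  proof (intro conjI allI impI op)
    show "ran (option_pair f g) \<subseteq> points (Z \<times>\<^sub>q W)"
      unfolding points_product[OF Z W]
      using partial_morphism_ran[OF f] partial_morphism_ran[OF g]
      by (auto simp: ran_def option_pair_eq_Some)
    fix V k assume V: "openin (zariski (Z \<times>\<^sub>q W)) V" and k: "k \<in> regular (Z \<times>\<^sub>q W) V"
    show "(\<lambda>y. k (the (option_pair f g y))) \<in> regular Y (option_pair f g -` Some ` V)"
    proof (rule Y.regular_local[OF op[OF V]])
      fix y assume "y \<in> option_pair f g -` Some ` V"
      then obtain z w where zw: "(z, w) \<in> V" "f y = Some z" "g y = Some w"
        by (auto simp: option_pair_eq_Some)
      from k[unfolded product_space_eq] zw(1) obtain S A h h' where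
          S: "(S, A) \<in> product_family Z W" "h \<in> A" "h' \<in> A" "(z, w) \<in> {z \<in> S. h' z \<noteq> 0}"
          "{z \<in> S. h' z \<noteq> 0} \<subseteq> V" "\<forall>z\<in>{z \<in> S. h' z \<noteq> 0}. k z = h z / h' z"
        by (rule F.regular_localE)
      obtain U U' where U: "openin (zariski Z) U" "openin (zariski W) U'" "S = U \<times> U'"
          "A = tensor_functions Z W U U'"
        using S(1) unfolding product_family_def by auto
      let ?T = "{y \<in> f -` Some ` U \<inter> g -` Some ` U'. h' (the (f y), the (g y)) \<noteq> 0}"
      have T: "openin (zariski Y) ?T" by (rule basic[OF U(1,2) S(3)[unfolded U(4)]])
      have yT: "y \<in> ?T" using zw S(4) U(3) by auto
      have TE: "\<exists>a b. f x = Some a \<and> g x = Some b \<and> (a, b) \<in> {z \<in> S. h' z \<noteq> 0}" if "x \<in> ?T" for x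
        using that U(3) by auto
      have TV: "?T \<subseteq> option_pair f g -` Some ` V"
      proof
        fix x assume "x \<in> ?T"
        then obtain a b where ab: "f x = Some a" "g x = Some b" "(a, b) \<in> {z \<in> S. h' z \<noteq> 0}"
          using TE by blast
        then have "(a, b) \<in> V" using S(5) by (rule_tac subsetD)
        then show "x \<in> option_pair f g -` Some ` V"
          using ab option_pair_eq_Some[of f g x a b] by auto
      qed
      have O: "openin (zariski Y) (f -` Some ` U \<inter> g -` Some ` U')"
        by (rule openin_Int[OF partial_morphism_openin[OF f U(1)] partial_morphism_openin[OF g U(2)]])
      have reg: "(\<lambda>y. q (the (f y), the (g y))) \<in> regular Y ?T" if "q \<in> A" for q
        by (rule Y.regular_mono[OF O tensor_pullback[OF Y f g U(1,2) that[unfolded U(4)]] T]) auto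
      have "(\<lambda>y. h (the (f y), the (g y)) / h' (the (f y), the (g y))) \<in> regular Y ?T"
        by (rule Y.regular_divide[OF T reg[OF S(2)] reg[OF S(3)]]) auto
      then have "(\<lambda>y. k (the (option_pair f g y))) \<in> regular Y ?T"
      proof (rule Y.regular_cong[OF T])
        fix x assume "x \<in> ?T"
        then obtain a b where ab: "f x = Some a" "g x = Some b" "(a, b) \<in> {z \<in> S. h' z \<noteq> 0}"
          using TE by blast
        then have "option_pair f g x = Some (a, b)" by (simp add: option_pair_eq_Some)
        then show "h (the (f x), the (g x)) / h' (the (f x), the (g x)) = k (the (option_pair f g x))"
          using ab(1,2) S(6)[rule_format, OF ab(3)] by simp
      qed
      then show "\<exists>T. openin (zariski Y) T \<and> y \<in> T \<and> T \<subseteq> option_pair f g -` Some ` V \<and>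
          (\<lambda>y. k (the (option_pair f g y))) \<in> regular Y T"
        using T yT TV by (intro exI[of _ ?T] conjI)
    qed
  qed
qed

lemma dense_open_Int_nonempty:
  assumes "dense_open Y D" "openin (zariski Y) U" "x \<in> U"
  shows "\<exists>y. y \<in> D \<and> y \<in> U"
  using assms unfolding dense_open_def dense_intersects_open by blast

text \<open>The complement of the diagonal is open, and its preimage under the pair
  \<open>(f, g)\<close> consists of the points where both maps are defined and differ. This open set
  would have to meet \<open>D\<close>.\<close>

lemma partial_morphism_eq:
  assumes Y: "ring_space Y" and X: "ring_space X" and sep: "separated X"
    and f: "partial_morphism Y X f" and g: "partial_morphism Y X g"
    and D: "dense_open Y D" and eq: "\<And>y. y \<in> D \<Longrightarrow> y \<in> dom f \<Longrightarrow> y \<in> dom g \<Longrightarrow> f y = g y"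
    and y: "f y = Some a" "g y = Some b"
  shows "a = b"
proof (rule ccontr)
  assume ne: "a \<noteq> b"
  let ?V = "points (X \<times>\<^sub>q X) - {(x, x) |x. x \<in> points X}"
  have "openin (zariski (X \<times>\<^sub>q X)) ?V"
    using sep unfolding separated_def by (rule openin_diff[OF openin_topspace])
  then have O: "openin (zariski Y) (option_pair f g -` Some ` ?V)"
    by (rule partial_morphism_openin[OF partial_morphism_pair[OF Y X X f g]])
  have "(a, b) \<in> ?V"
    using ne partial_morphism_ran[OF f y(1)] partial_morphism_ran[OF g y(2)]
    by (simp add: points_product[OF X X])
  then have "y \<in> option_pair f g -` Some ` ?V"
    using y option_pair_eq_Some[of f g y a b] by auto
  from dense_open_Int_nonempty[OF D O this]
  obtain z where z: "z \<in> D" "z \<in> option_pair f g -` Some ` ?V" by (elim exE conjE)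
  then obtain p where p: "p \<in> ?V" "option_pair f g z = Some p" by auto
  obtain c d where "p = (c, d)" by (cases p)
  with p have cd: "(c, d) \<in> ?V" "f z = Some c" "g z = Some d"
    by (simp_all add: option_pair_eq_Some)
  then have "c = d" using eq[OF z(1)] by (simp add: dom_def)
  then show False using cd partial_morphism_ran[OF f cd(2)] by simp
qed

lemma partial_morphism_total:
  assumes Y: "ring_space Y" and f: "\<And>y. y \<in> points Y \<Longrightarrow> f y \<in> points Z"
    and op: "\<And>V. openin (zariski Z) V \<Longrightarrow> openin (zariski Y) {y \<in> points Y. f y \<in> V}"
    and reg: "\<And>V g. openin (zariski Z) V \<Longrightarrow> g \<in> regular Z V \<Longrightarrow>
        (\<lambda>y. g (f y)) \<in> regular Y {y \<in> points Y. f y \<in> V}"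
  shows "partial_morphism Y Z ((\<lambda>y. Some (f y)) |` points Y)"
proof -
  interpret Y: ring_space Y by fact
  have pre: "((\<lambda>y. Some (f y)) |` points Y) -` Some ` V = {y \<in> points Y. f y \<in> V}" for V
    by (auto simp: restrict_map_def split: if_splits)
  show ?thesis
    unfolding partial_morphism_def pre
  proof (intro conjI allI impI op)
    show "ran ((\<lambda>y. Some (f y)) |` points Y) \<subseteq> points Z"
      using f by (auto simp: ran_def restrict_map_def split: if_splits)
    fix V g assume V: "openin (zariski Z) V" "g \<in> regular Z V"
    show "(\<lambda>y. g (the (((\<lambda>y. Some (f y)) |` points Y) y))) \<in> regular Y {y \<in> points Y. f y \<in> V}"
      by (rule Y.regular_cong[OF op[OF V(1)] reg[OF V]]) (simp add: restrict_map_def)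
  qed
qed

lemma partial_morphism_id:
  assumes "ring_space Y"
  shows "partial_morphism Y Y (Some |` points Y)"
proof -
  have pre: "{y \<in> points Y. y \<in> V} = V" if "openin (zariski Y) V" for V
    using openin_subset[OF that] by auto
  show ?thesis
    using partial_morphism_total[OF assms, of "\<lambda>y. y" Y] by (simp add: pre)
qed

lemma partial_morphism_fst:
  assumes Y: "ring_space Y" and Z: "ring_space Z"
  shows "partial_morphism (Y \<times>\<^sub>q Z) Y ((\<lambda>y. Some (fst y)) |` points (Y \<times>\<^sub>q Z))"
proof (rule partial_morphism_total[OF ring_space_product[OF Y Z]])
  interpret Y: ring_space Y by fact
  interpret Z: ring_space Z by fact
  interpret F: fraction_family "product_family Y Z" by (rule fraction_family_product[OF Y Z])
  show "fst y \<in> points Y" if "y \<in> points (Y \<times>\<^sub>q Z)" for y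
    using that by (auto simp: points_product[OF Y Z])
  have pre: "{y \<in> points (Y \<times>\<^sub>q Z). fst y \<in> V} = V \<times> points Z" if "openin (zariski Y) V" for V
    using openin_subset[OF that] by (auto simp: points_product[OF Y Z])
  have mem: "(V \<times> points Z, tensor_functions Y Z V (points Z)) \<in> product_family Y Z"
    if "openin (zariski Y) V" for V
    using that unfolding product_family_def by blast
  show op: "openin (zariski (Y \<times>\<^sub>q Z)) {y \<in> points (Y \<times>\<^sub>q Z). fst y \<in> V}" if "openin (zariski Y) V" for V
    using F.openin_basic[OF mem[OF that] F.const[OF mem[OF that], of 1]]
    unfolding pre[OF that] unfolding product_space_eq by simp
  fix V g assume V: "openin (zariski Y) V" and g: "g \<in> regular Y V"
  have "(\<lambda>(x, y). \<Sum>i\<in>{()}. g x * of_rat 1) \<in> tensor_functions Y Z V (points Z)"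
    by (rule tensor_functions_sum) (use g Z.regular_const in blast)+
  then have "(\<lambda>y. g (fst y)) \<in> tensor_functions Y Z V (points Z)" by (simp add: case_prod_unfold)
  then show "(\<lambda>y. g (fst y)) \<in> regular (Y \<times>\<^sub>q Z) {y \<in> points (Y \<times>\<^sub>q Z). fst y \<in> V}"
    using F.regular_member[OF mem[OF V]] op[OF V] unfolding pre[OF V] unfolding product_space_eq by simp
qed

lemma partial_morphism_snd:
  assumes Y: "ring_space Y" and Z: "ring_space Z"
  shows "partial_morphism (Y \<times>\<^sub>q Z) Z ((\<lambda>y. Some (snd y)) |` points (Y \<times>\<^sub>q Z))"
proof (rule partial_morphism_total[OF ring_space_product[OF Y Z]])
  interpret Y: ring_space Y by fact
  interpret Z: ring_space Z by fact
  interpret F: fraction_family "product_family Y Z" by (rule fraction_family_product[OF Y Z])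
  show "snd y \<in> points Z" if "y \<in> points (Y \<times>\<^sub>q Z)" for y
    using that by (auto simp: points_product[OF Y Z])
  have pre: "{y \<in> points (Y \<times>\<^sub>q Z). snd y \<in> V} = points Y \<times> V" if "openin (zariski Z) V" for V
    using openin_subset[OF that] by (auto simp: points_product[OF Y Z])
  have mem: "(points Y \<times> V, tensor_functions Y Z (points Y) V) \<in> product_family Y Z"
    if "openin (zariski Z) V" for V
    using that unfolding product_family_def by blast
  show op: "openin (zariski (Y \<times>\<^sub>q Z)) {y \<in> points (Y \<times>\<^sub>q Z). snd y \<in> V}" if "openin (zariski Z) V" for V
    using F.openin_basic[OF mem[OF that] F.const[OF mem[OF that], of 1]]
    unfolding pre[OF that] unfolding product_space_eq by simp
  fix V g assume V: "openin (zariski Z) V" and g: "g \<in> regular Z V"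
  have "(\<lambda>(x, y). \<Sum>i\<in>{()}. of_rat 1 * g y) \<in> tensor_functions Y Z (points Y) V"
    by (rule tensor_functions_sum) (use g Y.regular_const in blast)+
  then have "(\<lambda>y. g (snd y)) \<in> tensor_functions Y Z (points Y) V" by (simp add: case_prod_unfold)
  then show "(\<lambda>y. g (snd y)) \<in> regular (Y \<times>\<^sub>q Z) {y \<in> points (Y \<times>\<^sub>q Z). snd y \<in> V}"
    using F.regular_member[OF mem[OF V]] op[OF V] unfolding pre[OF V] unfolding product_space_eq by simp
qed

section \<open>Morphisms into subspaces and into spaces of fractions\<close>

lemma rational_morphism_iff:
  assumes "ring_space Y"
  shows "rational_morphism Y Z f \<longleftrightarrow> dense_open Y (dom f) \<and> partial_morphism Y Z f"
proof (cases "dense_open Y (dom f)")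
  case True
  interpret Y: ring_space Y by fact
  have D: "openin (zariski Y) (dom f)" using True unfolding dense_open_def by simp
  have pts: "points (subspace_of Y (dom f)) = dom f"
    using openin_subset[OF D] by (auto simp: zariski_subspace)
  have opn: "openin (zariski (subspace_of Y (dom f))) W \<longleftrightarrow> openin (zariski Y) W \<and> W \<subseteq> dom f" for W
    unfolding zariski_subspace using D openin_open_subtopology by blast
  have pre: "{x \<in> dom f. the (f x) \<in> V} = f -` Some ` V" for V by auto
  have sub: "f -` Some ` V \<subseteq> dom f" for V by auto
  have ran: "(\<lambda>x. the (f x)) \<in> dom f \<rightarrow> points Z \<longleftrightarrow> ran f \<subseteq> points Z"
    by (auto simp: ran_def dom_def Pi_def)
  have reg: "regular (subspace_of Y (dom f)) (f -` Some ` V) = regular Y (f -` Some ` V)"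
    if "openin (zariski Y) (f -` Some ` V)" for V
    by (rule regular_open_subspace[OF Y.sheaf D that sub])
  have "morphism (subspace_of Y (dom f)) Z (\<lambda>x. the (f x)) \<longleftrightarrow>
      ran f \<subseteq> points Z \<and> (\<forall>V. openin (zariski Z) V \<longrightarrow> openin (zariski Y) (f -` Some ` V)) \<and>
      (\<forall>V g. openin (zariski Z) V \<longrightarrow> g \<in> regular Z V \<longrightarrow>
        (\<lambda>y. g (the (f y))) \<in> regular (subspace_of Y (dom f)) (f -` Some ` V))"
    unfolding morphism_def continuous_map_def pts pre opn ran using sub by simp
  also have "\<dots> \<longleftrightarrow> partial_morphism Y Z f"
    unfolding partial_morphism_def by (intro conj_cong refl) (simp add: reg)
  finally show ?thesis using True unfolding rational_morphism_def by simp
qed (simp add: rational_morphism_def)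

text \<open>Needed for a target like X_0: a regular function on the subspace is locally the
  restriction of one on \<open>X\<close>, so it pulls back along a map with image in
  \<open>S\<close>.\<close>

lemma partial_morphism_subspace:
  assumes Y: "ring_space Y" and f: "partial_morphism Y X f" and ran: "ran f \<subseteq> S"
  shows "partial_morphism Y (subspace_of X S) f"
proof -
  interpret Y: ring_space Y by fact
  have pre: "f -` Some ` (T \<inter> S) = f -` Some ` T" for T
    using ran by (auto simp: ran_def)
  have op: "openin (zariski Y) (f -` Some ` V)" if "openin (zariski (subspace_of X S)) V" for V
  proof -
    obtain T where T: "openin (zariski X) T" "V = T \<inter> S"
      using \<open>openin (zariski (subspace_of X S)) V\<close> unfolding zariski_subspace openin_subtopology by blast
    show ?thesis unfolding T(2) pre by (rule partial_morphism_openin[OF f T(1)])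
  qed
  show ?thesis
    unfolding partial_morphism_def
  proof (intro conjI allI impI op)
    show "ran f \<subseteq> points (subspace_of X S)"
      using ran f unfolding partial_morphism_def zariski_subspace by simp
    fix V g assume V: "openin (zariski (subspace_of X S)) V" and g: "g \<in> regular (subspace_of X S) V"
    show "(\<lambda>y. g (the (f y))) \<in> regular Y (f -` Some ` V)"
    proof (rule Y.regular_local[OF op[OF V]])
      fix y assume y: "y \<in> f -` Some ` V"
      then obtain x where x: "f y = Some x" "x \<in> V" by auto
      obtain T h where T: "openin (zariski X) T" "x \<in> T" "T \<inter> S \<subseteq> V" "h \<in> regular X T"
          "\<forall>y\<in>T \<inter> S. g y = h y"
        using g x(2) unfolding regular_subspace_iff by meson
      have O: "openin (zariski Y) (f -` Some ` T)" by (rule partial_morphism_openin[OF f T(1)])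
      have "(\<lambda>y. h (the (f y))) \<in> regular Y (f -` Some ` T)"
        by (rule partial_morphism_regular[OF f T(1,4)])
      then have "(\<lambda>y. g (the (f y))) \<in> regular Y (f -` Some ` T)"
        by (rule Y.regular_cong[OF O]) (use ran T(5) in \<open>auto simp: ran_def\<close>)
      moreover have "f -` Some ` T \<subseteq> f -` Some ` V"
        unfolding pre[of T, symmetric] using T(3) by (intro vimage_mono image_mono)
      moreover have "y \<in> f -` Some ` T" using x T(2) by auto
      ultimately show "\<exists>W. openin (zariski Y) W \<and> y \<in> W \<and> W \<subseteq> f -` Some ` V \<and>
          (\<lambda>y. g (the (f y))) \<in> regular Y W"
        using O by (intro exI[of _ "f -` Some ` T"] conjI)
    qed
  qed
qed

text \<open>Pullback respects sums and products, so regularity of the coordinates passes to the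
  whole algebra and then to local fractions.\<close>

lemma partial_morphism_fraction_space:
  assumes Y: "ring_space Y" and \<phi>: "\<And>y. y \<in> points Y \<Longrightarrow> \<phi> y \<in> S"
    and gen: "\<And>f. f \<in> F \<Longrightarrow> (\<lambda>y. f (\<phi> y)) \<in> regular Y (points Y)"
  shows "partial_morphism Y (fraction_space S (rat_algebra F)) ((\<lambda>y. Some (\<phi> y)) |` points Y)"
proof (rule partial_morphism_total[OF Y])
  interpret Y: ring_space Y by fact
  interpret L: fraction_family "{(S, rat_algebra F)}" by (rule fraction_family_singleton)
  show "\<phi> y \<in> points (fraction_space S (rat_algebra F))" if "y \<in> points Y" for y
    using \<phi> that by (simp add: points_fraction_space)
  have alg: "(\<lambda>y. f (\<phi> y)) \<in> regular Y (points Y)" if "f \<in> rat_algebra F" for f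
    using that by induction (auto intro: gen Y.regular_const Y.regular_add Y.regular_mult)
  have nz: "openin (zariski Y) {y \<in> points Y. f (\<phi> y) \<noteq> 0}" if "f \<in> rat_algebra F" for f
    by (rule Y.openin_nonzero[OF _ alg[OF that]]) simp
  show op: "openin (zariski Y) {y \<in> points Y. \<phi> y \<in> V}"
    if V: "openin (zariski (fraction_space S (rat_algebra F))) V" for V
  proof (subst openin_subopen, intro ballI)
    fix y assume y: "y \<in> {y \<in> points Y. \<phi> y \<in> V}"
    then have yV: "\<phi> y \<in> V" by simp
    from V[unfolded zariski_fraction_space L.openin_iff, THEN bspec, OF this]
    obtain S' A f where f: "(S', A) \<in> {(S, rat_algebra F)}" "f \<in> A" "\<phi> y \<in> {z \<in> S'. f z \<noteq> 0}"
        "{z \<in> S'. f z \<noteq> 0} \<subseteq> V"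
      by (elim exE conjE)
    show "\<exists>T. openin (zariski Y) T \<and> y \<in> T \<and> T \<subseteq> {y \<in> points Y. \<phi> y \<in> V}"
    proof (intro exI[of _ "{y \<in> points Y. f (\<phi> y) \<noteq> 0}"] conjI nz)
      show "f \<in> rat_algebra F" using f by simp
      show "y \<in> {y \<in> points Y. f (\<phi> y) \<noteq> 0}" using f(3) y by simp
      show "{y \<in> points Y. f (\<phi> y) \<noteq> 0} \<subseteq> {y \<in> points Y. \<phi> y \<in> V}"
        using f(1,4) \<phi> by (auto simp: subset_iff)
    qed
  qed
  fix V g assume V: "openin (zariski (fraction_space S (rat_algebra F))) V"
    and g: "g \<in> regular (fraction_space S (rat_algebra F)) V"
  show "(\<lambda>y. g (\<phi> y)) \<in> regular Y {y \<in> points Y. \<phi> y \<in> V}"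
  proof (rule Y.regular_local[OF op[OF V]])
    fix y assume y: "y \<in> {y \<in> points Y. \<phi> y \<in> V}"
    then have yV: "\<phi> y \<in> V" by simp
    from g[unfolded regular_fraction_space[OF V]] yV obtain S' A f f' where
        f: "(S', A) \<in> {(S, rat_algebra F)}" "f \<in> A" "f' \<in> A" "\<phi> y \<in> {z \<in> S'. f' z \<noteq> 0}"
        "{z \<in> S'. f' z \<noteq> 0} \<subseteq> V" "\<forall>z\<in>{z \<in> S'. f' z \<noteq> 0}. g z = f z / f' z"
      by (rule L.regular_localE)
    have A: "S' = S" "A = rat_algebra F" using f(1) by simp_all
    let ?T = "{y \<in> points Y. f' (\<phi> y) \<noteq> 0}"
    have T: "openin (zariski Y) ?T" by (rule nz) (use f A in simp)
    have reg: "(\<lambda>y. q (\<phi> y)) \<in> regular Y ?T" if "q \<in> A" for q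
      by (rule Y.regular_mono[OF _ alg T]) (use that A in auto)
    have "(\<lambda>y. f (\<phi> y) / f' (\<phi> y)) \<in> regular Y ?T"
      by (rule Y.regular_divide[OF T reg[OF f(2)] reg[OF f(3)]]) simp
    then have "(\<lambda>y. g (\<phi> y)) \<in> regular Y ?T"
      by (rule Y.regular_cong[OF T]) (use f(6) \<phi> A in simp)
    moreover have "?T \<subseteq> {y \<in> points Y. \<phi> y \<in> V}"
      using f(5) \<phi> A by (auto simp: subset_iff)
    moreover have "y \<in> ?T" using y f(4) by simp
    ultimately show "\<exists>W. openin (zariski Y) W \<and> y \<in> W \<and> W \<subseteq> {y \<in> points Y. \<phi> y \<in> V} \<and>
        (\<lambda>y. g (\<phi> y)) \<in> regular Y W"
      using T by (intro exI[of _ ?T] conjI)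
  qed
qed

section \<open>Invertible functions as exponents, and words of operators\<close>

definition unit_function :: "'p qspace \<Rightarrow> ('p \<Rightarrow> complex) \<Rightarrow> bool" where
  "unit_function Y c \<longleftrightarrow> c \<in> regular Y (points Y) \<and> (\<forall>y\<in>points Y. c y \<noteq> 0)"

lemma partial_morphism_Gm:
  assumes "ring_space Y" "unit_function Y c"
  shows "partial_morphism Y Gm ((\<lambda>y. Some (c y)) |` points Y)"
  unfolding Gm_def
  by (rule partial_morphism_fraction_space) (use assms in \<open>auto simp: unit_function_def\<close>)

lemma unit_function_mult:
  assumes "ring_space Y" "unit_function Y c" "unit_function Y d"
  shows "unit_function Y (\<lambda>y. c y * d y)"
  using ring_space.regular_mult[OF assms(1) openin_topspace] assms(2,3)
  unfolding unit_function_def by simp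

lemma unit_function_divide:
  assumes "ring_space Y" "unit_function Y c" "unit_function Y d"
  shows "unit_function Y (\<lambda>y. c y / d y)"
  using ring_space.regular_divide[OF assms(1) openin_topspace] assms(2,3)
  unfolding unit_function_def by simp

lemma unit_function_pullback:
  assumes f: "partial_morphism W Y f" and dom: "dom f = points W" and c: "unit_function Y c"
  shows "unit_function W (\<lambda>w. c (the (f w)))"
  unfolding unit_function_def
proof
  show "(\<lambda>w. c (the (f w))) \<in> regular W (points W)"
    using partial_morphism_regular[OF f openin_topspace, of c] c
    unfolding partial_morphism_dom_eq[OF f] dom unit_function_def by simp
  show "\<forall>w\<in>points W. c (the (f w)) \<noteq> 0"
    using c dom partial_morphism_ran[OF f] unfolding unit_function_def by (metis domD option.sel)
qed

lemma unit_function_cong: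
  assumes "ring_space Y" "unit_function Y c" "\<And>y. y \<in> points Y \<Longrightarrow> c y = d y"
  shows "unit_function Y d"
  using ring_space.regular_cong[OF assms(1) openin_topspace, of c d] assms(2,3)
  unfolding unit_function_def by simp

lemma unit_function_fst:
  assumes "ring_space Y" "ring_space Z" "unit_function Y c"
  shows "unit_function (Y \<times>\<^sub>q Z) (\<lambda>z. c (fst z))"
  by (rule unit_function_cong[OF ring_space_product[OF assms(1,2)]
        unit_function_pullback[OF partial_morphism_fst[OF assms(1,2)] _ assms(3)]])
    (auto simp: restrict_map_def dom_def)

lemma unit_function_snd:
  assumes "ring_space Y" "ring_space Z" "unit_function Z c"
  shows "unit_function (Y \<times>\<^sub>q Z) (\<lambda>z. c (snd z))"
  by (rule unit_function_cong[OF ring_space_product[OF assms(1,2)]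
        unit_function_pullback[OF partial_morphism_snd[OF assms(1,2)] _ assms(3)]])
    (auto simp: restrict_map_def dom_def)

lemma unit_function_Gm: "unit_function Gm (\<lambda>c. c)"
  unfolding unit_function_def
proof
  show "(\<lambda>c. c) \<in> regular Gm (points Gm)"
    unfolding Gm_def by (rule regular_generator) simp_all
qed (simp add: points_Gm)

lemma torus_coordinate_nonzero:
  assumes "t \<in> torus_points r" shows "t j \<noteq> 0"
proof (cases "j \<in> {1..r+1}")
  case True
  show ?thesis
  proof
    assume "t j = 0"
    then have "(\<Prod>j=1..r+1. t j) = 0" using True by (intro prod_zero) auto
    moreover have "(\<Prod>j=1..r+1. t j) = 1" using assms unfolding torus_points_def by blast
    ultimately show False by (simp only: one_neq_zero)
  qed
qed (use assms in \<open>auto simp: torus_points_def\<close>)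

lemma unit_function_torus:
  assumes "j \<in> {1..r+1}"
  shows "unit_function (torus r) (\<lambda>t. t j)"
  unfolding unit_function_def
proof
  show "(\<lambda>t. t j) \<in> regular (torus r) (points (torus r))"
    unfolding torus_def by (rule regular_generator) (use assms in auto)
qed (use torus_coordinate_nonzero points_torus in auto)

text \<open>The parameter \<open>y\<close> determines both the exponents and the starting point
  \<open>p y\<close>. With \<open>p\<close> kept separate the same construction serves the parameter
  spaces G_m x G_m x X, T x X and X.\<close>

definition e_fun :: "(nat \<Rightarrow> complex \<times> 'p \<rightharpoonup> 'p) \<Rightarrow> (nat \<times> ('y \<Rightarrow> complex)) list \<Rightarrow>
    ('y \<rightharpoonup> 'p) \<Rightarrow> 'y \<rightharpoonup> 'p" where
  "e_fun e u p y = Option.bind (p y) (e_seq e (map (\<lambda>(i, c). (i, c y)) u))"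

lemma e_seq_Nil [simp]: "e_seq e [] x = Some x"
  unfolding e_seq_def by simp

lemma e_seq_Cons [simp]: "e_seq e ((i, c) # u) x = Option.bind (e_seq e u x) (\<lambda>z. e i (c, z))"
  unfolding e_seq_def by simp

lemma e_seq_append: "e_seq e (u @ v) x = Option.bind (e_seq e v x) (e_seq e u)"
proof (induction u)
  case Nil
  then show ?case by (cases "e_seq e v x") simp_all
next
  case (Cons a u)
  then show ?case by (cases a, cases "e_seq e v x") simp_all
qed

lemma e_fun_Nil: "e_fun e [] p = p"
proof
  show "e_fun e [] p y = p y" for y unfolding e_fun_def by (cases "p y") simp_all
qed

lemma e_fun_Cons: "e_fun e ((i, c) # u) p y = Option.bind (e_fun e u p y) (\<lambda>z. e i (c y, z))"
  unfolding e_fun_def by (cases "p y") simp_all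

text \<open>One letter is the pairing of its exponent, a morphism to G_m, with the map built so far,
  followed by the action.\<close>

lemma partial_morphism_e_fun:
  assumes Y: "ring_space Y" and X: "ring_space X" and p: "partial_morphism Y X p"
    and u: "\<And>i c. (i, c) \<in> set u \<Longrightarrow> unit_function Y c \<and> partial_morphism (Gm \<times>\<^sub>q X) X (e i)"
  shows "partial_morphism Y X (e_fun e u p)"
  using u
proof (induction u)
  case Nil
  then show ?case using p by (simp add: e_fun_Nil)
next
  case (Cons a u)
  obtain i c where a: "a = (i, c)" by (cases a)
  have ih: "partial_morphism Y X (e_fun e u p)"
    by (rule Cons.IH, rule Cons.prems) simp
  have c: "unit_function Y c" and i: "partial_morphism (Gm \<times>\<^sub>q X) X (e i)"
    using Cons.prems[of i c] a by simp_all
  let ?q = "option_pair ((\<lambda>y. Some (c y)) |` points Y) (e_fun e u p)"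
  have "partial_morphism Y X (\<lambda>y. Option.bind (?q y) (e i))"
    by (rule partial_morphism_bind[OF Y
          partial_morphism_pair[OF Y ring_space_Gm X partial_morphism_Gm[OF Y c] ih] i])
  moreover have "Option.bind (?q y) (e i) = e_fun e (a # u) p y" for y
  proof (cases "e_fun e u p y")
    case None
    then show ?thesis
      unfolding a e_fun_Cons option_pair_def by (cases "((\<lambda>y. Some (c y)) |` points Y) y") simp_all
  next
    case (Some z)
    then have "y \<in> points Y"
      using openin_subset[OF partial_morphism_dom[OF ih]] by (auto simp: dom_def)
    then show ?thesis using Some unfolding a e_fun_Cons option_pair_def by (simp add: restrict_map_def)
  qed
  ultimately show ?case by simp
qed
section \<open>Words in the simple reflections\<close>

lemma word_product_Nil [simp]: "word_product [] = id"
  unfolding word_product_def by simp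

lemma word_product_Cons [simp]: "word_product (i # is) = simple_reflection i \<circ> word_product is"
  unfolding word_product_def by simp

lemma word_product_append: "word_product (is @ js) = word_product is \<circ> word_product js"
  by (induction "is") (simp_all add: comp_assoc)

lemma simple_reflection_apply:
  "simple_reflection i j = (if j = i then i + 1 else if j = i + 1 then i else j)"
  unfolding simple_reflection_def by (simp add: Transposition.transpose_def)

lemma simple_reflection_permutes:
  assumes "i \<in> {1..r}" shows "simple_reflection i permutes {1..r+1}"
  unfolding simple_reflection_def using assms by (intro permutes_swap_id) auto

lemma word_product_permutes:
  assumes "set is \<subseteq> {1..r}" shows "word_product is permutes {1..r+1}"
  using assms
proof (induction "is")
  case (Cons i "is")
  then show ?case
    unfolding word_product_Cons by (intro permutes_compose simple_reflection_permutes) auto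
qed (simp add: permutes_id)

lemma permutation_word_product: "permutation (word_product is)"
proof (induction "is")
  case (Cons i "is")
  then show ?case
    unfolding word_product_Cons simple_reflection_def
    by (intro permutation_compose permutation_swap_id)
qed (simp add: permutation_id)

text \<open>Words for the same permutation have lengths of the same parity, which rules out most
  candidates for shorter words in the length estimates.\<close>

lemma sign_word_product: "sign (word_product is) = (- 1) ^ length is"
proof (induction "is")
  case (Cons i "is")
  have comp: "sign (simple_reflection i \<circ> word_product is) =
      sign (simple_reflection i) * sign (word_product is)"
    unfolding simple_reflection_def
    by (rule sign_compose[OF permutation_swap_id permutation_word_product])
  have "sign (simple_reflection i) = - 1"
    unfolding simple_reflection_def by (simp add: sign_swap_id)
  then show ?case unfolding word_product_Cons comp Cons.IH by simp
qed simp

text \<open>Induction on \<open>b\<close>: conjugating the transposition of \<open>a\<close> and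
  \<open>b\<close> by s_b gives that of \<open>a\<close> and \<open>b + 1\<close>.\<close>

lemma transposition_word:
  assumes "1 \<le> a" "Suc a \<le> b" "b \<le> r + 1"
  shows "\<exists>is. set is \<subseteq> {1..r} \<and> word_product is = Transposition.transpose a b"
  using assms(2,3)
proof (induction b rule: nat_induct_at_least)
  case base
  then show ?case using assms(1) by (intro exI[of _ "[a]"]) (auto simp: simple_reflection_def)
next
  case (Suc b)
  then obtain "is" where "is": "set is \<subseteq> {1..r}" "word_product is = Transposition.transpose a b"
    by auto
  have "word_product ([b] @ is @ [b]) = Transposition.transpose a (Suc b)"
    using Suc.hyps
    by (intro ext) (simp add: word_product_append "is"(2) simple_reflection_apply Transposition.transpose_def)
  moreover have "set ([b] @ is @ [b]) \<subseteq> {1..r}" using "is"(1) Suc assms(1) by auto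
  ultimately show ?case by blast
qed

lemma permutation_word:
  assumes "w permutes {1..r+1}"
  shows "\<exists>is. set is \<subseteq> {1..r} \<and> word_product is = w"
  using assms finite_atLeastAtMost
proof (induction rule: permutes_induct)
  case id
  then show ?case by (intro exI[of _ "[]"]) simp
next
  case (swap a b p)
  obtain "is" where "is": "set is \<subseteq> {1..r}" "word_product is = p" using swap by blast
  have "\<exists>js. set js \<subseteq> {1..r} \<and> word_product js = Transposition.transpose a b"
  proof (cases a b rule: linorder_cases)
    case less
    then show ?thesis using transposition_word[of a b r] swap by simp
  next
    case equal
    then show ?thesis by (intro exI[of _ "[]"]) simp
  next
    case greater
    then show ?thesis
      using transposition_word[of b a r] swap by (simp add: transpose_commute)
  qed
  then obtain js where js: "set js \<subseteq> {1..r}" "word_product js = Transposition.transpose a b" by blast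
  then have "set (js @ is) \<subseteq> {1..r} \<and> word_product (js @ is) = Transposition.transpose a b \<circ> p"
    using "is" by (simp add: word_product_append)
  then show ?case by blast
qed

text \<open>Gives meaning to the choice of a reduced word in \<open>e_weyl\<close>.\<close>

lemma reduced_word_exists:
  assumes "w \<in> weyl_group r"
  shows "\<exists>is. reduced_word r w is"
proof -
  obtain "is" where "set is \<subseteq> {1..r} \<and> word_product is = w"
    using permutation_word assms unfolding weyl_group_def by blast
  from ex_has_least_nat[of "\<lambda>is. set is \<subseteq> {1..r} \<and> word_product is = w", OF this, of length]
  show ?thesis unfolding reduced_word_def by auto
qed

lemma word_product_length2:
  assumes "word_product js = word_product [i, j]" "i \<noteq> j"
  shows "length [i, j] \<le> length js"
proof (rule ccontr)
  assume "\<not> ?thesis"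
  then have "length js = 0 \<or> length js = 1" by (simp only: list.size) arith
  moreover have "length js \<noteq> 1"
    using sign_word_product[of js] sign_word_product[of "[i, j]"] assms(1) by auto
  ultimately have "word_product [i, j] = id" using assms(1) by auto
  \<comment> \<open>If s_i s_j were the identity, s_i would exchange \<open>j\<close> and
    \<open>j + 1\<close>, which forces \<open>i = j\<close>.\<close>
  then have "simple_reflection i (simple_reflection j j) = j"
      "simple_reflection i (simple_reflection j (j + 1)) = j + 1"
    by (auto simp: fun_eq_iff)
  then show False using assms(2) by (auto simp: simple_reflection_apply split: if_splits)
qed

text \<open>Parity excludes lengths 0 and 2. A single letter sends \<open>i\<close> to at most
  \<open>i + 1\<close>, whereas s_i s_{i+1} s_i sends it to \<open>i + 2\<close>.\<close>

lemma word_product_length3: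
  assumes "word_product js = word_product [i, i + 1, i]"
  shows "length [i, i + 1, i] \<le> length js"
proof (rule ccontr)
  assume "\<not> ?thesis"
  then have "length js = 0 \<or> length js = 1 \<or> length js = 2" by (simp only: list.size) arith
  moreover have "length js \<noteq> 0" "length js \<noteq> 2"
    using sign_word_product[of js] sign_word_product[of "[i, i + 1, i]"] assms by auto
  ultimately obtain m where "js = [m]" by (auto simp: length_Suc_conv)
  then have "simple_reflection m i = word_product [i, i + 1, i] i"
    unfolding assms[symmetric] by simp
  moreover have "word_product [i, i + 1, i] i = i + 2" by (simp add: simple_reflection_apply)
  moreover have "simple_reflection m i \<le> i + 1" by (simp add: simple_reflection_apply)
  ultimately show False by linarith
qed

lemma reduced_word_commuting:
  assumes "i \<in> {1..r}" "j \<in> {1..r}" "i + 1 < j"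
  shows "reduced_word r (word_product [i, j]) [i, j]" "reduced_word r (word_product [i, j]) [j, i]"
proof -
  have eq: "word_product [j, i] = word_product [i, j]"
  proof
    fix x
    consider "x = i" | "x = i + 1" | "x = j" | "x = j + 1" | "x \<notin> {i, i + 1, j, j + 1}" by blast
    then show "word_product [j, i] x = word_product [i, j] x"
      using assms(3) by cases (simp_all add: simple_reflection_apply)
  qed
  have len: "length [i, j] \<le> length js" if "word_product js = word_product [i, j]" for js
    using that assms(3) by (intro word_product_length2) auto
  have sub: "set [i, j] \<subseteq> {1..r}" "set [j, i] \<subseteq> {1..r}" using assms(1,2) by simp_all
  show "reduced_word r (word_product [i, j]) [i, j]"
    unfolding reduced_word_def using len sub by (intro conjI allI impI refl)
  show "reduced_word r (word_product [i, j]) [j, i]"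
    unfolding reduced_word_def
  proof (intro conjI allI impI eq sub)
    show "length [j, i] \<le> length js" if "word_product js = word_product [i, j]" for js
      using len[OF that] by simp
  qed
qed

lemma reduced_word_braid:
  assumes "i \<in> {1..r}" "i + 1 \<in> {1..r}"
  shows "reduced_word r (word_product [i, i + 1, i]) [i, i + 1, i]"
    "reduced_word r (word_product [i, i + 1, i]) [i + 1, i, i + 1]"
proof -
  have eq: "word_product [i + 1, i, i + 1] = word_product [i, i + 1, i]"
  proof
    fix x
    consider "x = i" | "x = i + 1" | "x = i + 2" | "x \<notin> {i, i + 1, i + 2}" by blast
    then show "word_product [i + 1, i, i + 1] x = word_product [i, i + 1, i] x"
      by cases (simp_all add: simple_reflection_apply)
  qed
  have sub: "set [i, i + 1, i] \<subseteq> {1..r}" "set [i + 1, i, i + 1] \<subseteq> {1..r}"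
    using assms by simp_all
  show "reduced_word r (word_product [i, i + 1, i]) [i, i + 1, i]"
    unfolding reduced_word_def using word_product_length3 sub by (intro conjI allI impI refl)
  show "reduced_word r (word_product [i, i + 1, i]) [i + 1, i, i + 1]"
    unfolding reduced_word_def
  proof (intro conjI allI impI eq sub)
    show "length [i + 1, i, i + 1] \<le> length js"
      if "word_product js = word_product [i, i + 1, i]" for js
      using word_product_length3[OF that] by simp
  qed
qed

text \<open>The inverses in the actions on the torus and on characters cancel: the character
  obtained from a root by \<open>w\<close> reads the entries of \<open>t\<close> at the images under
  \<open>w\<close>.\<close>

lemma word_root_eq:
  "word_root is k t = t (word_product (rev (drop (Suc k) is)) (is ! k)) /
     t (word_product (rev (drop (Suc k) is)) (is ! k + 1))"
  unfolding word_root_def weyl_char_def weyl_torus_def simple_root_def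
  by (simp add: inv_inv_eq permutation_bijective[OF permutation_word_product])

text \<open>The root at a position depends only on the letter there and the letters to its right,
  which makes recursion on the head of the word possible.\<close>

lemma word_root_Cons: "word_root (i # is) (Suc k) = word_root is k"
  unfolding word_root_def by simp

lemma e_word_Nil: "e_word e [] (t, x) = Some x"
  unfolding e_word_def by simp

lemma e_word_Cons:
  "e_word e (i # is) (t, x) =
     Option.bind (e_word e is (t, x)) (\<lambda>z. e i (word_root (i # is) 0 t, z))"
proof -
  have "map (\<lambda>k. ((i # is) ! k, word_root (i # is) k t)) [0..<length (i # is)] =
      (i, word_root (i # is) 0 t) # map (\<lambda>k. (is ! k, word_root is k t)) [0..<length is]"
    by (simp only: length_Cons upt_conv_Cons[OF zero_less_Suc] map_Suc_upt[symmetric])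
      (simp add: word_root_Cons comp_def)
  then show ?thesis unfolding e_word_def by simp
qed

text \<open>Turns relations parametrized by the torus into relations with independent exponents: the
  values of the simple roots can be prescribed at will.\<close>

lemma simple_roots_surjective:
  assumes "\<And>i. i \<in> {1..r} \<Longrightarrow> d i \<noteq> 0"
  shows "\<exists>t\<in>torus_points r. \<forall>i\<in>{1..r}. simple_root i t = d i"
proof -
  \<comment> \<open>Since q_{i+1} = d_i q_i, the entries s / q_j have the required consecutive
    quotients for every nonzero scalar \<open>s\<close>.\<close>
  define q where "q j = (\<Prod>k=1..j - 1. d k)" for j
  have q: "q j \<noteq> 0" if "j \<in> {1..r+1}" for j
  proof -
    have "\<forall>k\<in>{1..j - 1}. d k \<noteq> 0"
    proof
      fix k assume "k \<in> {1..j - 1}"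
      then have "k \<in> {1..r}" using that by auto
      then show "d k \<noteq> 0" by (rule assms)
    qed
    then show ?thesis unfolding q_def by (simp add: prod_zero_iff)
  qed
  define P where "P = (\<Prod>j=1..r+1. q j)"
  have P: "P \<noteq> 0" unfolding P_def using q prod_zero_iff[OF finite_atLeastAtMost] by blast
  \<comment> \<open>An (r+1)-st root of \<open>P\<close>; it normalizes the product of the entries,
    s^{r+1} / P, to 1.\<close>
  define s where "s = exp (Ln P / of_nat (r + 1))"
  have "s ^ (r + 1) = exp (of_nat (r + 1) * (Ln P / of_nat (r + 1)))"
    unfolding s_def exp_of_nat_mult ..
  also have "\<dots> = P" using P by (simp del: of_nat_Suc of_nat_add)
  finally have s: "s ^ (r + 1) = P" .
  define t where "t j = (if j \<in> {1..r+1} then s / q j else 1)" for j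
  have "(\<Prod>j=1..r+1. t j) = (\<Prod>j=1..r+1. s / q j)"
    by (rule prod.cong) (auto simp: t_def)
  also have "\<dots> = s ^ (r + 1) / P" unfolding P_def by (simp only: prod_dividef) simp
  also have "\<dots> = 1" using s P by simp
  finally have "t \<in> torus_points r" unfolding torus_points_def t_def by auto
  moreover have "simple_root i t = d i" if i: "i \<in> {1..r}" for i
  proof -
    have "q (i + 1) = d i * q i"
      using i unfolding q_def by (cases i) auto
    moreover have "q i \<noteq> 0" "q (i + 1) \<noteq> 0" "s \<noteq> 0" using q i unfolding s_def by auto
    ultimately show ?thesis unfolding simple_root_def t_def using i by simp
  qed
  ultimately show ?thesis by blast
qed
section \<open>Pointwise relations in a geometric crystal\<close>

lemma unit_function_one:
  assumes "ring_space Y" shows "unit_function Y (\<lambda>_. 1)"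
  using ring_space.regular_const[OF assms openin_topspace, of 1] unfolding unit_function_def by simp

locale crystal =
  fixes r :: nat
    and X :: "'p qspace"
    and \<gamma> :: "'p \<rightharpoonup> nat \<Rightarrow> complex"
    and e :: "nat \<Rightarrow> complex \<times> 'p \<rightharpoonup> 'p"
  assumes crystal: "geometric_crystal r X \<gamma> e"
    and dom_\<gamma>: "dom \<gamma> = points X"
    and ran_\<gamma>: "ran \<gamma> = torus_points r"
begin

definition tor :: "'p \<Rightarrow> nat \<Rightarrow> complex" where
  "tor x = the (\<gamma> x)"

lemma precrystal: "geometric_precrystal r X \<gamma> e"
  using crystal unfolding geometric_crystal_def by simp

lemma irreducible_X: "irreducible_variety X"
  using precrystal unfolding geometric_precrystal_def by simp

lemma ring_space_X: "ring_space X"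
  using irreducible_X unfolding irreducible_variety_def by (simp add: ring_space_rat_variety)

sublocale ring_space X by (rule ring_space_X)

lemma separated_X: "separated X"
  using irreducible_X unfolding irreducible_variety_def rat_variety_def by simp

lemma ring_space_GmX: "ring_space (Gm \<times>\<^sub>q X)"
  by (rule ring_space_product[OF ring_space_Gm ring_space_X])

lemma partial_morphism_\<gamma>: "partial_morphism X (torus r) \<gamma>"
  using precrystal rational_morphism_iff[OF ring_space_X]
  unfolding geometric_precrystal_def by metis

lemma action:
  assumes "i \<in> {1..r}" shows "unital_rational_action Gm (*) 1 X (e i)"
  using precrystal assms unfolding geometric_precrystal_def by simp

lemma partial_morphism_e:
  assumes "i \<in> {1..r}" shows "partial_morphism (Gm \<times>\<^sub>q X) X (e i)"
  using action[OF assms] rational_morphism_iff[OF ring_space_GmX]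
  unfolding unital_rational_action_def by metis

lemma e_one:
  assumes "i \<in> {1..r}" "x \<in> points X" shows "e i (1, x) = Some x"
  using action[OF assms(1)] assms(2) unfolding unital_rational_action_def by simp

lemma \<gamma>_tor: "x \<in> points X \<Longrightarrow> \<gamma> x = Some (tor x)"
  using dom_\<gamma> unfolding tor_def by (metis domD option.sel)

lemma tor_torus: "x \<in> points X \<Longrightarrow> tor x \<in> torus_points r"
  using \<gamma>_tor ran_\<gamma> by (metis ranI)

lemma e_defined:
  assumes "i \<in> {1..r}" "e i (c, x) = Some y"
  shows "c \<noteq> 0" "x \<in> points X" "y \<in> points X"
proof -
  have "(c, x) \<in> points (Gm \<times>\<^sub>q X)"
    using openin_subset[OF partial_morphism_dom[OF partial_morphism_e[OF assms(1)]]] assms(2)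
    by auto
  then show "c \<noteq> 0" "x \<in> points X"
    by (simp_all add: points_product[OF ring_space_Gm ring_space_X] points_Gm)
  show "y \<in> points X" by (rule partial_morphism_ran[OF partial_morphism_e[OF assms(1)] assms(2)])
qed

text \<open>Upgrades a rational identity to an identity at each point. \<open>F\<close> and
  \<open>G\<close> are the two sides as an axiom states them; rewriting them as words exhibits them
  as partial morphisms into the separated space \<open>X\<close>.\<close>

lemma e_fun_agree:
  assumes Y: "ring_space Y" and p: "partial_morphism Y X p"
    and u: "\<And>i c. (i, c) \<in> set u \<Longrightarrow> i \<in> {1..r} \<and> unit_function Y c"
    and v: "\<And>i c. (i, c) \<in> set v \<Longrightarrow> i \<in> {1..r} \<and> unit_function Y c"
    and eq: "rat_eq Y F G"
    and F: "\<And>y. y \<in> points Y \<Longrightarrow> F y = e_fun e u p y"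
    and G: "\<And>y. y \<in> points Y \<Longrightarrow> G y = e_fun e v p y"
    and y: "y \<in> points Y" "F y = Some a" "G y = Some b"
  shows "a = b"
proof -
  have pu: "partial_morphism Y X (e_fun e u p)"
    by (rule partial_morphism_e_fun[OF Y ring_space_X p]) (use u partial_morphism_e in blast)
  have pv: "partial_morphism Y X (e_fun e v p)"
    by (rule partial_morphism_e_fun[OF Y ring_space_X p]) (use v partial_morphism_e in blast)
  obtain D where D: "dense_open Y D" "\<forall>x\<in>D. F x = G x"
    using eq unfolding rat_eq_def by metis
  have "D \<subseteq> points Y" using D(1) unfolding dense_open_def by (simp add: openin_subset)
  then have eq': "e_fun e u p x = e_fun e v p x" if "x \<in> D" for x
    using D(2) F G that by (metis subsetD)
  show ?thesis
    using partial_morphism_eq[OF Y ring_space_X separated_X pu pv D(1), of y a b] eq' F G y by simp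
qed

text \<open>The action axiom, evaluated at the single point \<open>(c, d, x)\<close> of G_m x G_m x
  X. The starting point \<open>p\<close> is the projection to the last factor, and the two letters
  have the first two coordinates as exponents.\<close>

lemma e_mult:
  assumes i: "i \<in> {1..r}" and "e_seq e [(i, c), (i, d)] x = Some z" and z': "e_seq e [(i, c * d)] x = Some z'"
  shows "z = z'"
proof -
  let ?Y = "Gm \<times>\<^sub>q Gm \<times>\<^sub>q X"
  have Y: "ring_space ?Y" by (rule ring_space_product[OF ring_space_Gm ring_space_GmX])
  define p where "p y = Option.bind (((\<lambda>y. Some (snd y)) |` points ?Y) y)
      ((\<lambda>y. Some (snd y)) |` points (Gm \<times>\<^sub>q X))" for y
  have p: "partial_morphism ?Y X p"
    unfolding p_def
    by (rule partial_morphism_bind[OF Y partial_morphism_snd[OF ring_space_Gm ring_space_GmX]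
          partial_morphism_snd[OF ring_space_Gm ring_space_X]])
  have pts: "points ?Y = points Gm \<times> points Gm \<times> points X" "points (Gm \<times>\<^sub>q X) = points Gm \<times> points X"
    by (simp_all add: points_product[OF ring_space_Gm ring_space_GmX]
        points_product[OF ring_space_Gm ring_space_X])
  have pS: "p y = Some (snd (snd y))" if "y \<in> points ?Y" for y
    using that unfolding p_def restrict_map_def pts by auto
  have h: "unit_function ?Y fst"
    using unit_function_fst[OF ring_space_Gm ring_space_GmX unit_function_Gm] .
  have h': "unit_function ?Y (\<lambda>y. fst (snd y))"
    using unit_function_snd[OF ring_space_Gm ring_space_GmX
        unit_function_fst[OF ring_space_Gm ring_space_X unit_function_Gm]] .
  obtain y where y: "e i (d, x) = Some y" "e i (c, y) = Some z"
    using assms(2) by (auto simp: bind_eq_Some_conv)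
  have dx: "d \<noteq> 0" "x \<in> points X" "c \<noteq> 0"
    using e_defined[OF i y(1)] e_defined[OF i y(2)] by simp_all
  show ?thesis
  proof (rule e_fun_agree[OF Y p, where y = "(c, d, x)"])
    show "rat_eq ?Y (\<lambda>(h, h', x). Option.bind (e i (h', x)) (\<lambda>y. e i (h, y)))
       (\<lambda>(h, h', x). e i (h * h', x))"
      using action[OF i] unfolding unital_rational_action_def by simp
    show "j \<in> {1..r} \<and> unit_function ?Y c'"
      if "(j, c') \<in> set [(i, fst), (i, \<lambda>y. fst (snd y))]" for j c'
      using that i h h' by auto
    show "j \<in> {1..r} \<and> unit_function ?Y c'"
      if "(j, c') \<in> set [(i, \<lambda>y. fst y * fst (snd y))]" for j c'
      using that i unit_function_mult[OF Y h h'] by auto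
    show "(case y of (h, h', x) \<Rightarrow> Option.bind (e i (h', x)) (\<lambda>y. e i (h, y))) =
        e_fun e [(i, fst), (i, \<lambda>y. fst (snd y))] p y" if "y \<in> points ?Y" for y
      using pS[OF that] by (cases y) (simp add: e_fun_Cons e_fun_Nil)
    show "(case y of (h, h', x) \<Rightarrow> e i (h * h', x)) =
        e_fun e [(i, \<lambda>y. fst y * fst (snd y))] p y" if "y \<in> points ?Y" for y
      using pS[OF that] by (cases y) (simp add: e_fun_Cons e_fun_Nil)
    show "(c, d, x) \<in> points ?Y" using dx by (simp add: pts points_Gm)
  qed (use y z' in simp_all)
qed

lemma e_word_agree:
  assumes w: "reduced_word r w is" "reduced_word r w js" and t: "t \<in> torus_points r" and x: "x \<in> points X"
    and z: "e_word e is (t, x) = Some z" "e_word e js (t, x) = Some z'"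
  shows "z = z'"
proof -
  let ?Y = "torus r \<times>\<^sub>q X"
  let ?p = "(\<lambda>y. Some (snd y)) |` points ?Y"
  let ?u = "\<lambda>is. map (\<lambda>k. (is ! k, \<lambda>y. word_root is k (fst y))) [0..<length is]"
  have Y: "ring_space ?Y" by (rule ring_space_product[OF ring_space_torus ring_space_X])
  have sub: "set is \<subseteq> {1..r}" "set js \<subseteq> {1..r}" and "word_product is = w"
    using w unfolding reduced_word_def by simp_all
  then have wW: "w \<in> weyl_group r" using word_product_permutes unfolding weyl_group_def by blast
  \<comment> \<open>The root is a quotient of two entries of \<open>t\<close>; a word in the simple
    reflections permutes {1..r+1}, so both are genuine coordinates of the torus.\<close>
  have root: "unit_function (torus r) (word_root is k)" if "set is \<subseteq> {1..r}" "k < length is" for "is" k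
  proof -
    let ?w = "word_product (rev (drop (Suc k) is))"
    have "set (rev (drop (Suc k) is)) \<subseteq> {1..r}" using that(1) set_drop_subset[of "Suc k" "is"] by auto
    then have perm: "?w permutes {1..r+1}" by (rule word_product_permutes)
    have "is ! k \<in> {1..r}" using that nth_mem by blast
    then have "?w (is ! k) \<in> {1..r+1}" "?w (is ! k + 1) \<in> {1..r+1}"
      using permutes_in_image[OF perm] by auto
    then show ?thesis
      unfolding word_root_eq[abs_def] by (intro unit_function_divide ring_space_torus unit_function_torus)
  qed
  have good: "i \<in> {1..r} \<and> unit_function ?Y c" if "is": "set is \<subseteq> {1..r}" and ic: "(i, c) \<in> set (?u is)" for "is" i c
  proof -
    obtain k where k: "k < length is" "i = is ! k" "c = (\<lambda>y. word_root is k (fst y))"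
      using ic by auto
    then show ?thesis
      using subsetD[OF "is" nth_mem[OF k(1)]]
        unit_function_fst[OF ring_space_torus ring_space_X root[OF "is" k(1)]]
      by simp
  qed
  have ev: "e_word e is y = e_fun e (?u is) ?p y" if "y \<in> points ?Y" for "is" y
    using that unfolding e_word_def e_fun_def by (cases y) (simp add: comp_def)
  show ?thesis
  proof (rule e_fun_agree[OF Y partial_morphism_snd[OF ring_space_torus ring_space_X],
        where y = "(t, x)"])
    show "rat_eq ?Y (e_word e is) (e_word e js)"
      using crystal wW w unfolding geometric_crystal_def by metis
    show "(t, x) \<in> points ?Y"
      using t x by (simp add: points_product[OF ring_space_torus ring_space_X] points_torus)
    show "i \<in> {1..r} \<and> unit_function ?Y c" if "(i, c) \<in> set (?u is)" for i c
      by (rule good[OF sub(1) that])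
    show "i \<in> {1..r} \<and> unit_function ?Y c" if "(i, c) \<in> set (?u js)" for i c
      by (rule good[OF sub(2) that])
  qed (rule ev z, assumption?)+
qed

text \<open>For non-adjacent letters s_j fixes alpha_i and s_i fixes alpha_j, so both orders attach
  the same roots. A torus element with alpha_i(t) = c and alpha_j(t) = d yields the two given
  words.\<close>

lemma e_comm:
  assumes ij: "i \<in> {1..r}" "j \<in> {1..r}" "i + 1 < j"
    and z: "e_seq e [(i, c), (j, d)] x = Some z" "e_seq e [(j, d), (i, c)] x = Some z'"
  shows "z = z'"
proof -
  obtain y where y: "e j (d, x) = Some y" "e i (c, y) = Some z"
    using z by (auto simp: bind_eq_Some_conv)
  have dx: "d \<noteq> 0" "x \<in> points X" "c \<noteq> 0"
    using e_defined[OF ij(2) y(1)] e_defined[OF ij(1) y(2)] by simp_all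
  have "\<exists>t\<in>torus_points r. \<forall>k\<in>{1..r}. simple_root k t = (if k = i then c else d)"
    using dx by (intro simple_roots_surjective) simp
  then obtain t where t: "t \<in> torus_points r" "\<forall>k\<in>{1..r}. simple_root k t = (if k = i then c else d)"
    by (elim bexE)
  have root: "t i / t (i + 1) = c" "t j / t (j + 1) = d"
    using t(2) ij unfolding simple_root_def by auto
  show ?thesis
  proof (rule e_word_agree[OF reduced_word_commuting[OF ij] t(1) dx(2)])
    show "e_word e [i, j] (t, x) = Some z"
      using z(1) ij root by (simp add: e_word_Cons e_word_Nil word_root_eq simple_reflection_apply)
    show "e_word e [j, i] (t, x) = Some z'"
      using z(2) ij root by (simp add: e_word_Cons e_word_Nil word_root_eq simple_reflection_apply)
  qed
qed

text \<open>Take alpha_i(t) = d and alpha_{i+1}(t) = c. Along i, i+1, i the attached roots are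
  alpha_{i+1}, alpha_i + alpha_{i+1}, alpha_i, and along i+1, i, i+1 they are the same in opposite
  order; this accounts for the exponents c, cd, d.\<close>

lemma e_braid:
  assumes i: "i \<in> {1..r}" "i + 1 \<in> {1..r}"
    and z: "e_seq e [(i, c), (i + 1, c * d), (i, d)] x = Some z"
      "e_seq e [(i + 1, d), (i, c * d), (i + 1, c)] x = Some z'"
  shows "z = z'"
proof -
  obtain y y' where y: "e i (d, x) = Some y" "e (i + 1) (c * d, y) = Some y'"
    using z(1) by (auto simp: bind_eq_Some_conv)
  have dx: "d \<noteq> 0" "x \<in> points X" "c \<noteq> 0"
    using e_defined[OF i(1) y(1)] e_defined[OF i(2) y(2)] by simp_all
  have "\<exists>t\<in>torus_points r. \<forall>k\<in>{1..r}. simple_root k t = (if k = i then d else c)"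
    using dx by (intro simple_roots_surjective) simp
  then obtain t where t: "t \<in> torus_points r" "\<forall>k\<in>{1..r}. simple_root k t = (if k = i then d else c)"
    by (elim bexE)
  have root: "t i / t (i + 1) = d" "t (i + 1) / t (i + 2) = c"
    using t(2) i unfolding simple_root_def by auto
  moreover have "t (i + 1) \<noteq> 0" by (rule torus_coordinate_nonzero[OF t(1)])
  ultimately have root2: "t i / t (i + 2) = c * d" by auto
  show ?thesis
  proof (rule e_word_agree[OF reduced_word_braid[OF i] t(1) dx(2)])
    show "e_word e [i, i + 1, i] (t, x) = Some z"
      using z(1) root root2 by (simp add: e_word_Cons e_word_Nil word_root_eq simple_reflection_apply)
    show "e_word e [i + 1, i, i + 1] (t, x) = Some z'"
      using z(2) root root2 by (simp add: e_word_Cons e_word_Nil word_root_eq simple_reflection_apply)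
  qed
qed

lemma unit_function_tor:
  assumes "j \<in> {1..r+1}" shows "unit_function X (\<lambda>x. tor x j)"
  unfolding tor_def
  by (rule unit_function_pullback[OF partial_morphism_\<gamma> dom_\<gamma> unit_function_torus[OF assms]])

text \<open>The equivariance of gamma, upgraded to every point where e_i^c is defined. Each
  coordinate is compared as a regular function on the domain of the composite; entries outside
  {1..r+1} are 1 by convention.\<close>

lemma tor_e:
  assumes i: "i \<in> {1..r}" and y: "e i (c, x) = Some y"
  shows "tor y = torus_mult (simple_coroot i c) (tor x)"
proof
  fix j
  let ?Y = "Gm \<times>\<^sub>q X"
  interpret Y: ring_space ?Y by (rule ring_space_GmX)
  note d = e_defined[OF i y]
  show "tor y j = torus_mult (simple_coroot i c) (tor x) j"
  proof (cases "j \<in> {1..r+1}")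
    case False
    then show ?thesis
      using tor_torus[OF d(2)] tor_torus[OF d(3)] i
      by (auto simp: torus_points_def torus_mult_def simple_coroot_def)
  next
    case True
    let ?F = "\<lambda>z. Option.bind (e i z) \<gamma>"
    have F: "partial_morphism ?Y (torus r) ?F"
      by (rule partial_morphism_bind[OF ring_space_GmX partial_morphism_e[OF i] partial_morphism_\<gamma>])
    have f: "(\<lambda>z. the (?F z) j) \<in> regular ?Y (dom ?F)"
      using partial_morphism_regular[OF F openin_topspace, of "\<lambda>t. t j"] unit_function_torus[OF True]
      unfolding partial_morphism_dom_eq[OF F] unit_function_def by simp
    have fst: "unit_function ?Y fst"
      using unit_function_fst[OF ring_space_Gm ring_space_X unit_function_Gm] .
    have "unit_function ?Y (\<lambda>z. simple_coroot i (fst z) j)"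
      unfolding simple_coroot_def
      using fst unit_function_one[OF ring_space_GmX]
        unit_function_divide[OF ring_space_GmX unit_function_one[OF ring_space_GmX] fst]
      by (cases "j = i"; cases "j = i + 1") (simp_all add: inverse_eq_divide)
    from unit_function_mult[OF ring_space_GmX this
        unit_function_snd[OF ring_space_Gm ring_space_X unit_function_tor[OF True]]]
    have "(\<lambda>z. simple_coroot i (fst z) j * tor (snd z) j) \<in> regular ?Y (points ?Y)"
      unfolding unit_function_def by simp
    then have g: "(\<lambda>z. simple_coroot i (fst z) j * tor (snd z) j) \<in> regular ?Y (dom ?F)"
      by (rule Y.regular_mono[OF openin_topspace _ partial_morphism_dom[OF F]
            openin_subset[OF partial_morphism_dom[OF F]]])
    have "rat_eq ?Y (\<lambda>(c, x). Option.bind (e i (c, x)) \<gamma>)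
          (\<lambda>(c, x). map_option (torus_mult (simple_coroot i c)) (\<gamma> x))"
      using precrystal i unfolding geometric_precrystal_def by simp
    then obtain D where D: "dense_open ?Y D"
        "\<forall>z\<in>D. (case z of (c, x) \<Rightarrow> Option.bind (e i (c, x)) \<gamma>) =
          (case z of (c, x) \<Rightarrow> map_option (torus_mult (simple_coroot i c)) (\<gamma> x))"
      unfolding rat_eq_def by metis
    have "the (?F (c, x)) j = simple_coroot i (fst (c, x)) j * tor (snd (c, x)) j"
    proof (rule Y.openin_equal_dense[OF partial_morphism_dom[OF F] f g D(1)])
      show "(c, x) \<in> dom ?F" using y \<gamma>_tor[OF d(3)] by auto
      fix z assume z: "z \<in> D \<inter> dom ?F"
      obtain c' x' where zz: "z = (c', x')" by (cases z)
      from z obtain s where s: "?F z = Some s" by auto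
      have "map_option (torus_mult (simple_coroot i c')) (\<gamma> x') = Some s"
        using D(2) z s zz by auto
      then show "the (?F z) j = simple_coroot i (fst z) j * tor (snd z) j"
        using s zz unfolding tor_def torus_mult_def by auto
    qed
    then show ?thesis using y \<gamma>_tor[OF d(3)] by (simp add: torus_mult_def)
  qed
qed

end
section \<open>Words with variable exponents\<close>

context crystal
begin

definition fibre :: "'p set" where
  "fibre = {x \<in> points X. tor x = torus_one}"

lemma fibre_eq: "unit_fibre \<gamma> = fibre"
proof (intro set_eqI iffI)
  fix x assume "x \<in> unit_fibre \<gamma>"
  then show "x \<in> fibre" using dom_\<gamma> unfolding unit_fibre_def fibre_def tor_def by auto
next
  fix x assume "x \<in> fibre"
  then show "x \<in> unit_fibre \<gamma>" using \<gamma>_tor unfolding unit_fibre_def fibre_def by simp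
qed

lemma fibre_nonempty: "fibre \<noteq> {}"
proof -
  have "torus_one \<in> ran \<gamma>" unfolding ran_\<gamma> torus_points_def torus_one_def by simp
  then show ?thesis unfolding fibre_eq[symmetric] unit_fibre_def ran_def by auto
qed

text \<open>Irreducibility in the form in which it is used: a single point suffices to make an open
  domain dense.\<close>

lemma dense_open_iff: "dense_open X U \<longleftrightarrow> openin (zariski X) U \<and> U \<noteq> {}"
proof -
  have "points X \<noteq> {}" and int: "\<And>U V. openin (zariski X) U \<Longrightarrow> openin (zariski X) V \<Longrightarrow> U \<noteq> {} \<Longrightarrow>
      V \<noteq> {} \<Longrightarrow> U \<inter> V \<noteq> {}"
    using irreducible_X unfolding irreducible_variety_def by simp_all
  show ?thesis
  proof
    assume "dense_open X U"
    then show "openin (zariski X) U \<and> U \<noteq> {}"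
      using \<open>points X \<noteq> {}\<close> unfolding dense_open_def by (metis closure_of_empty)
  next
    assume "openin (zariski X) U \<and> U \<noteq> {}"
    then show "dense_open X U"
      unfolding dense_open_def dense_intersects_open using int by blast
  qed
qed

lemma dense_open_Int: "dense_open X U \<Longrightarrow> dense_open X V \<Longrightarrow> dense_open X (U \<inter> V)"
  using irreducible_X unfolding dense_open_iff irreducible_variety_def by auto

text \<open>Every word occurring below has trivial exponents on the unit fibre, which forces its (open)
  domain of definition to be nonempty, hence dense.\<close>

definition good :: "(nat \<times> ('p \<Rightarrow> complex)) list \<Rightarrow> bool" where
  "good u \<longleftrightarrow> (\<forall>(i, c)\<in>set u. i \<in> {1..r} \<and> unit_function X c \<and> (\<forall>x\<in>fibre. c x = 1))"

lemma good_simps [simp]: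
  "good []" "good (u @ v) \<longleftrightarrow> good u \<and> good v"
  "good ((i, c) # u) \<longleftrightarrow> i \<in> {1..r} \<and> unit_function X c \<and> (\<forall>x\<in>fibre. c x = 1) \<and> good u"
  unfolding good_def by auto

text \<open>The exponents are read at \<open>x\<close> while the letters act on \<open>y\<close>. In
  tau the exponents stay at the original point although the letters move it, and with
  \<open>x\<close> fixed concatenation of words is composition.\<close>

definition eval_word :: "(nat \<times> ('p \<Rightarrow> complex)) list \<Rightarrow> 'p \<Rightarrow> 'p \<rightharpoonup> 'p" where
  "eval_word u x = e_seq e (map (\<lambda>(i, c). (i, c x)) u)"

lemma eval_word_append: "eval_word (u @ v) x y = Option.bind (eval_word v x y) (eval_word u x)"
  unfolding eval_word_def by (simp add: e_seq_append)

lemma partial_morphism_eval_word: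
  assumes "good u"
  shows "partial_morphism X X (e_fun e u (Some |` points X))"
  by (rule partial_morphism_e_fun[OF ring_space_X ring_space_X partial_morphism_id[OF ring_space_X]])
    (use assms partial_morphism_e in \<open>auto simp: good_def\<close>)

lemma e_fun_eval_word: "x \<in> points X \<Longrightarrow> e_fun e u (Some |` points X) x = eval_word u x x"
  unfolding e_fun_def eval_word_def by simp

lemma e_fun_outside: "x \<notin> points X \<Longrightarrow> e_fun e u (Some |` points X) x = None"
  unfolding e_fun_def by simp

lemma e_fun_fibre:
  assumes "good u" "x \<in> fibre"
  shows "e_fun e u (Some |` points X) x = Some x"
  using assms(1)
proof (induction u)
  case Nil
  then show ?case using assms(2) by (simp add: e_fun_Nil fibre_def)
next
  case (Cons a u)
  then show ?case
    using assms(2) by (cases a) (simp add: e_fun_Cons e_one fibre_def)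
qed

lemma dense_dom_e_fun:
  assumes "good u" shows "dense_open X (dom (e_fun e u (Some |` points X)))"
  unfolding dense_open_iff
proof
  show "openin (zariski X) (dom (e_fun e u (Some |` points X)))"
    by (rule partial_morphism_dom[OF partial_morphism_eval_word[OF assms]])
  obtain x where "x \<in> fibre" using fibre_nonempty by blast
  from e_fun_fibre[OF assms this] show "dom (e_fun e u (Some |` points X)) \<noteq> {}" by auto
qed

section \<open>A congruence on words\<close>

definition agree :: "(nat \<times> ('p \<Rightarrow> complex)) list \<Rightarrow> (nat \<times> ('p \<Rightarrow> complex)) list \<Rightarrow> bool" where
  "agree u v \<longleftrightarrow> (\<forall>x\<in>points X. \<forall>z z'. eval_word u x x = Some z \<longrightarrow> eval_word v x x = Some z' \<longrightarrow> z = z')"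

lemma agreeD:
  "agree u v \<Longrightarrow> x \<in> points X \<Longrightarrow> eval_word u x x = Some z \<Longrightarrow> eval_word v x x = Some z' \<Longrightarrow> z = z'"
  unfolding agree_def by blast

lemma agree_sym: "agree u v \<Longrightarrow> agree v u"
  unfolding agree_def[of v u] by (intro ballI allI impI, rule sym, rule agreeD)

text \<open>At a given point the middle word may be undefined. But it is defined on a dense open
  set, where \<open>u\<close> and \<open>w\<close> therefore agree, and agreement spreads from there
  to all common points of definition.\<close>

lemma agree_trans:
  assumes "good u" "good v" "good w" and uv: "agree u v" and vw: "agree v w"
  shows "agree u w"
  unfolding agree_def
proof (intro ballI allI impI)
  fix x z z' assume x: "x \<in> points X" and z: "eval_word u x x = Some z" "eval_word w x x = Some z'"
  let ?E = "\<lambda>u. e_fun e u (Some |` points X)"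
  show "z = z'"
  proof (rule partial_morphism_eq[OF ring_space_X ring_space_X separated_X])
    show "partial_morphism X X (?E u)" "partial_morphism X X (?E w)" "dense_open X (dom (?E v))"
      using assms partial_morphism_eval_word dense_dom_e_fun by blast+
    show "?E u x = Some z" "?E w x = Some z'" using x z by (simp_all add: e_fun_eval_word)
    fix y assume y: "y \<in> dom (?E v)" "y \<in> dom (?E u)" "y \<in> dom (?E w)"
    have yX: "y \<in> points X" using y(1) e_fun_outside by (metis domIff)
    from y obtain a b c where abc: "eval_word v y y = Some a" "eval_word u y y = Some b"
        "eval_word w y y = Some c"
      by (auto simp: e_fun_eval_word[OF yX])
    have "b = a" by (rule agreeD[OF uv yX abc(2,1)])
    moreover have "a = c" by (rule agreeD[OF vw yX abc(1,3)])
    ultimately show "?E u y = ?E w y" using abc by (simp add: e_fun_eval_word[OF yX])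
  qed
qed

text \<open>Contexts are part of the definition because \<open>agree\<close> starts each word at the
  very point where the exponents are read. A suffix moves the starting point without moving the
  exponents, a situation on which \<open>agree u v\<close> alone is silent.\<close>

definition equiv_word :: "(nat \<times> ('p \<Rightarrow> complex)) list \<Rightarrow> (nat \<times> ('p \<Rightarrow> complex)) list \<Rightarrow> bool"
    (infix "\<doteq>" 50) where
  "u \<doteq> v \<longleftrightarrow> good u \<and> good v \<and> (\<forall>p s. good p \<longrightarrow> good s \<longrightarrow> agree (p @ u @ s) (p @ v @ s))"

lemma equiv_word_trans [trans]: "u \<doteq> v \<Longrightarrow> v \<doteq> w \<Longrightarrow> u \<doteq> w"
  unfolding equiv_word_def
proof (elim conjE, intro conjI allI impI)
  fix p s
  assume g: "good u" "good v" "good w" "good p" "good s"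
    and *: "\<forall>p s. good p \<longrightarrow> good s \<longrightarrow> agree (p @ u @ s) (p @ v @ s)"
      "\<forall>p s. good p \<longrightarrow> good s \<longrightarrow> agree (p @ v @ s) (p @ w @ s)"
  show "agree (p @ u @ s) (p @ w @ s)"
    by (rule agree_trans[of _ "p @ v @ s"]) (use g * in simp_all)
qed

lemma equiv_word_sym: "u \<doteq> v \<Longrightarrow> v \<doteq> u"
  unfolding equiv_word_def by (simp add: agree_sym)

lemma equiv_word_context:
  assumes "u \<doteq> v" "good p" "good s" shows "p @ u @ s \<doteq> p @ v @ s"
  unfolding equiv_word_def
proof (intro conjI allI impI)
  fix p' s' assume "good p'" "good s'"
  then have "good (p' @ p)" "good (s @ s')" using assms by simp_all
  then have "agree ((p' @ p) @ u @ (s @ s')) ((p' @ p) @ v @ (s @ s'))"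
    using assms(1) unfolding equiv_word_def by (elim conjE allE impE)
  then show "agree (p' @ (p @ u @ s) @ s') (p' @ (p @ v @ s) @ s')" by simp
qed (use assms in \<open>auto simp: equiv_word_def\<close>)

text \<open>A relation that holds with the exponents at \<open>x\<close> and an unrelated starting
  point \<open>y\<close> survives in every context, since a suffix only changes \<open>y\<close>.
  The crystal relations have this strength.\<close>

lemma equiv_wordI:
  assumes "good u" "good v"
    and "\<And>x y z z'. x \<in> points X \<Longrightarrow> eval_word u x y = Some z \<Longrightarrow> eval_word v x y = Some z' \<Longrightarrow> z = z'"
  shows "u \<doteq> v"
  unfolding equiv_word_def agree_def
proof (intro conjI allI impI ballI assms(1,2))
  fix p s x z z'
  assume x: "x \<in> points X" and z: "eval_word (p @ u @ s) x x = Some z" "eval_word (p @ v @ s) x x = Some z'"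
  obtain y a where a: "eval_word s x x = Some y" "eval_word u x y = Some a" "eval_word p x a = Some z"
    using z(1) by (auto simp: eval_word_append bind_eq_Some_conv)
  obtain b where b: "eval_word v x y = Some b" "eval_word p x b = Some z'"
    using z(2) a(1) by (auto simp: eval_word_append bind_eq_Some_conv)
  have "a = b" by (rule assms(3)[OF x a(2) b(1)])
  then show "z = z'" using a(3) b(2) by simp
qed

lemma equiv_word_refl: "good u \<Longrightarrow> u \<doteq> u"
  by (rule equiv_wordI) auto

lemma equiv_word_left: "u \<doteq> v \<Longrightarrow> good s \<Longrightarrow> u @ s \<doteq> v @ s"
  using equiv_word_context[of u v "[]" s] by simp

lemma equiv_word_right: "u \<doteq> v \<Longrightarrow> good p \<Longrightarrow> p @ u \<doteq> p @ v"
  using equiv_word_context[of u v p "[]"] by simp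

lemma equiv_word_agree: "u \<doteq> v \<Longrightarrow> agree u v"
  unfolding equiv_word_def using good_simps(1) by (metis append.left_neutral append.right_neutral)

lemma equiv_mult:
  assumes "good [(i, c), (i, d), (i, cd)]" and "\<And>x. x \<in> points X \<Longrightarrow> cd x = c x * d x"
  shows "[(i, c), (i, d)] \<doteq> [(i, cd)]"
proof (rule equiv_wordI)
  fix x y z z' assume x: "x \<in> points X"
    and z: "eval_word [(i, c), (i, d)] x y = Some z" "eval_word [(i, cd)] x y = Some z'"
  show "z = z'"
    by (rule e_mult[of i "c x" "d x" y]) (use assms x z in \<open>simp_all add: eval_word_def\<close>)
qed (use assms in simp_all)

lemma equiv_comm:
  assumes "good [(i, c), (j, d)]" and ij: "i + 1 < j \<or> j + 1 < i"
  shows "[(i, c), (j, d)] \<doteq> [(j, d), (i, c)]"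
proof (rule equiv_wordI)
  fix x y z z' assume x: "x \<in> points X"
    and z: "eval_word [(i, c), (j, d)] x y = Some z" "eval_word [(j, d), (i, c)] x y = Some z'"
  have z2: "e_seq e [(i, c x), (j, d x)] y = Some z" "e_seq e [(j, d x), (i, c x)] y = Some z'"
    using z by (simp_all add: eval_word_def)
  have ir: "i \<in> {1..r}" "j \<in> {1..r}" using assms(1) by simp_all
  show "z = z'"
    using ij e_comm[OF ir _ z2] e_comm[OF ir(2,1) _ z2(2,1)] by blast
qed (use assms in simp_all)

lemma equiv_braid:
  assumes "good [(i, c), (i + 1, cd), (i, d)]" and "\<And>x. x \<in> points X \<Longrightarrow> cd x = c x * d x"
  shows "[(i, c), (i + 1, cd), (i, d)] \<doteq> [(i + 1, d), (i, cd), (i + 1, c)]"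
proof (rule equiv_wordI)
  fix x y z z' assume x: "x \<in> points X"
    and z: "eval_word [(i, c), (i + 1, cd), (i, d)] x y = Some z"
      "eval_word [(i + 1, d), (i, cd), (i + 1, c)] x y = Some z'"
  show "z = z'"
    by (rule e_braid[of i "c x" "d x" y]) (use assms x z in \<open>simp_all add: eval_word_def\<close>)
qed (use assms in simp_all)

section \<open>The exchange identity for two consecutive blocks\<close>

definition block :: "nat \<Rightarrow> ('p \<Rightarrow> complex) \<Rightarrow> (nat \<times> ('p \<Rightarrow> complex)) list" where
  "block m c = map (\<lambda>i. (i, c)) [1..<m + 1]"

lemma block_simps [simp]: "block 0 c = []" "block (Suc m) c = block m c @ [(Suc m, c)]"
  unfolding block_def by simp_all

lemma good_block:
  assumes "unit_function X c" "\<And>x. x \<in> fibre \<Longrightarrow> c x = 1" "m \<le> r"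
  shows "good (block m c)"
  using assms unfolding good_def block_def by auto

lemma equiv_comm_word:
  assumes "good u" "good [(k, d)]" "\<forall>(i, c)\<in>set u. i + 1 < k"
  shows "u @ [(k, d)] \<doteq> [(k, d)] @ u"
  using assms(1,3)
proof (induction u)
  case Nil
  then show ?case using equiv_word_refl[OF assms(2)] by simp
next
  case (Cons a u)
  obtain i c where a: "a = (i, c)" by (cases a)
  have g: "good [(i, c)]" "good u" "good [(i, c), (k, d)]" using Cons.prems(1) assms(2) a by auto
  have "[a] @ (u @ [(k, d)]) \<doteq> [a] @ ([(k, d)] @ u)"
    by (rule equiv_word_right) (use Cons g a in auto)
  also have "[a] @ ([(k, d)] @ u) = [(i, c), (k, d)] @ u" by (simp add: a)
  also have "\<dots> \<doteq> [(k, d), (i, c)] @ u"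
    by (rule equiv_word_left[OF equiv_comm[OF g(3)] g(2)]) (use Cons.prems(2) a in auto)
  finally show ?case by (simp add: a)
qed

text \<open>Here \<open>d\<close> stands for the quotient b / a. For \<open>n = 0\<close> the claim
  is e_1^a e_1^d = e_1^b. In the step the top letter of the left block is brought next to the last
  two letters, so that a braid move produces e_{m+1}^d, the very letter which the induction
  hypothesis absorbs.\<close>

lemma equiv_blocks:
  assumes a: "unit_function X a" "\<And>x. x \<in> fibre \<Longrightarrow> a x = 1"
    and b: "unit_function X b" "\<And>x. x \<in> fibre \<Longrightarrow> b x = 1"
    and d: "unit_function X d" "\<And>x. x \<in> fibre \<Longrightarrow> d x = 1"
    and eq: "\<And>x. x \<in> points X \<Longrightarrow> b x = d x * a x"
    and n: "Suc n \<le> r"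
  shows "block (Suc n) a @ block n b @ [(Suc n, d)] \<doteq> block (Suc n) b @ block n a"
  using n
proof (induction n)
  case 0
  then show ?case using equiv_mult[of 1 a d b] a b d eq by (simp add: mult.commute)
next
  case (Suc m)
  have gl: "good [(i, c)]" if "i \<in> {1..r}" "c \<in> {a, b, d}" for i c using that a b d by auto
  have gb: "good (block i c)" if "i \<le> r" "c \<in> {a, b, d}" for i c
    using that a b d by (auto intro!: good_block)
  have g: "good (block (Suc m) a)" "good (block (Suc m) b)" "good (block m a)" "good (block m b)"
      "good [(Suc (Suc m), a)]" "good [(Suc (Suc m), b)]" "good [(Suc m, b), (Suc (Suc m), d)]"
      "good [(Suc m, a)]" "good [(Suc (Suc m), b), (Suc m, a)]"
    using Suc.prems by (auto simp del: block_simps intro!: gb simp: a b d)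
  have far: "\<forall>(i, c)\<in>set (block m f). i + 1 < Suc (Suc m)" for f unfolding block_def by auto
  have "block (Suc m) a @ ([(Suc (Suc m), a)] @ block m b) @ [(Suc m, b), (Suc (Suc m), d)] \<doteq>
      block (Suc m) a @ (block m b @ [(Suc (Suc m), a)]) @ [(Suc m, b), (Suc (Suc m), d)]"
    by (rule equiv_word_context[OF equiv_word_sym[OF equiv_comm_word[OF g(4,5) far]] g(1,7)])
  also have "\<dots> = (block (Suc m) a @ block m b) @ [(Suc (Suc m), a), (Suc m, b), (Suc (Suc m), d)]"
    by (simp del: block_simps)
  \<comment> \<open>The braid relation read from right to left, with exponents \<open>d\<close>,
    \<open>b = d a\<close>, \<open>a\<close>.\<close>
  also have "\<dots> \<doteq> (block (Suc m) a @ block m b) @ [(Suc m, d), (Suc (Suc m), b), (Suc m, a)]"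
    by (rule equiv_word_right) (use equiv_word_sym[OF equiv_braid[of "Suc m" d b a]] a b d eq Suc.prems g in auto)
  also have "\<dots> = (block (Suc m) a @ block m b @ [(Suc m, d)]) @ [(Suc (Suc m), b), (Suc m, a)]"
    by (simp del: block_simps)
  \<comment> \<open>Induction hypothesis, applied to everything left of the last two
    letters.\<close>
  also have "\<dots> \<doteq> (block (Suc m) b @ block m a) @ [(Suc (Suc m), b), (Suc m, a)]"
    by (rule equiv_word_left[OF _ g(9)]) (use Suc in simp)
  also have "\<dots> = block (Suc m) b @ (block m a @ [(Suc (Suc m), b)]) @ [(Suc m, a)]"
    by (simp del: block_simps)
  \<comment> \<open>The letter with index m + 2 commutes back past the block of length m and
    completes the left block; the remaining letter completes the right one.\<close>
  also have "\<dots> \<doteq> block (Suc m) b @ ([(Suc (Suc m), b)] @ block m a) @ [(Suc m, a)]"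
    by (rule equiv_word_context[OF equiv_comm_word[OF g(3,6) far] g(2,8)])
  finally show ?case by simp
qed

end
section \<open>The trivialization\<close>

lemma tau_exponent_eq:
  assumes t: "t \<in> torus_points r" and m: "m \<in> {1..r}"
  shows "tau_exponent r m t = t (m + 1)"
proof -
  have nz: "fundamental_weight m t \<noteq> 0"
    unfolding fundamental_weight_def using torus_coordinate_nonzero[OF t] by simp
  have step: "fundamental_weight (m + 1) t = fundamental_weight m t * t (m + 1)"
    unfolding fundamental_weight_def by simp
  \<comment> \<open>For \<open>m = r\<close> the missing numerator would be the product of all r + 1
    entries, the determinant, which is 1.\<close>
  have "(if m = r then 1 else fundamental_weight (m + 1) t) = fundamental_weight (m + 1) t"
    using t unfolding torus_points_def fundamental_weight_def by simp
  then show ?thesis unfolding tau_exponent_def step using nz by simp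
qed

text \<open>The exponent in s_k(x) is 1 / alpha_k(t) = t_{k+1} / t_k. Its coroot multiplies entry k
  by this ratio and divides entry k + 1 by it, which exchanges the two entries.\<close>

lemma torus_mult_reflection:
  assumes t: "t \<in> torus_points r"
  shows "torus_mult (simple_coroot k (t (k + 1) / t k)) t = t \<circ> simple_reflection k"
  using torus_coordinate_nonzero[OF t]
  by (auto simp: torus_mult_def simple_coroot_def simple_reflection_apply fun_eq_iff)

context crystal
begin

definition coord :: "nat \<Rightarrow> 'p \<Rightarrow> complex" where
  "coord j x = tor x j"

lemma unit_function_coord: "j \<in> {1..r+1} \<Longrightarrow> unit_function X (coord j)"
  unfolding coord_def[abs_def] by (rule unit_function_tor)

lemma coord_fibre: "x \<in> fibre \<Longrightarrow> coord j x = 1"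
  unfolding fibre_def coord_def torus_one_def by simp

text \<open>The exponent functions are left free, so that the same word describes tau at
  \<open>x\<close> and, with permuted coordinates of gamma(x), tau at s_k(x).\<close>

fun tau_word :: "nat \<Rightarrow> (nat \<Rightarrow> 'p \<Rightarrow> complex) \<Rightarrow> (nat \<times> ('p \<Rightarrow> complex)) list" where
  "tau_word 0 c = []"
| "tau_word (Suc n) c = block (Suc n) (c (Suc n)) @ tau_word n c"

declare block_simps [simp del]

lemma good_tau_word:
  assumes "n \<le> r" "\<And>m. m \<in> {1..n} \<Longrightarrow> \<exists>j\<in>{1..r+1}. c m = coord j"
  shows "good (tau_word n c)"
  using assms
proof (induction n)
  case (Suc n)
  obtain j where "j \<in> {1..r+1}" "c (Suc n) = coord j" using Suc.prems(2)[of "Suc n"] by auto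
  then have "good (block (Suc n) (c (Suc n)))"
    using Suc.prems(1) by (intro good_block) (simp_all add: unit_function_coord coord_fibre)
  moreover have "good (tau_word n c)" by (rule Suc.IH) (use Suc.prems in auto)
  ultimately show ?case by simp
qed simp

lemma tau_word_cong: "(\<And>m. m \<in> {1..n} \<Longrightarrow> c m = d m) \<Longrightarrow> tau_word n c = tau_word n d"
  by (induction n) auto

lemma letters_tau_word: "(i, c') \<in> set (tau_word n c) \<Longrightarrow> i \<le> n"
  by (induction n) (auto simp: block_def)

definition ratio :: "nat \<Rightarrow> 'p \<Rightarrow> complex" where
  "ratio k x = tor x (k + 1) / tor x k"

lemma good_ratio:
  assumes "k \<in> {1..r}" shows "good [(k, ratio k)]"
  using assms unit_function_divide[OF ring_space_X unit_function_tor unit_function_tor, of "k + 1" k]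
  unfolding ratio_def[abs_def] by (simp add: fibre_def torus_one_def)

text \<open>Block m carries the coordinate m + 1, so the exchange of t_k and t_{k+1} touches only
  blocks k - 1 and k. The induction starts at \<open>n = k\<close>, where the exchange identity
  applies; larger blocks are unchanged and enter as a prefix.\<close>

lemma tau_word_reflection:
  assumes k: "k \<in> {1..r}"
  shows "tau_word r (\<lambda>m. coord (simple_reflection k (m + 1))) @ [(k, ratio k)] \<doteq>
    tau_word r (\<lambda>m. coord (m + 1))"
proof -
  let ?c = "\<lambda>m. coord (m + 1)"
  let ?c' = "\<lambda>m. coord (simple_reflection k (m + 1))"
  have "tau_word n ?c' @ [(k, ratio k)] \<doteq> tau_word n ?c" if "k \<le> n" "n \<le> r" for n
    using that
  proof (induction n rule: nat_induct_at_least)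
    case base
    obtain p where p: "k = Suc p" using k by (cases k) auto
    have a: "unit_function X (coord k)" "\<And>x. x \<in> fibre \<Longrightarrow> coord k x = 1"
      and b: "unit_function X (coord (k + 1))" "\<And>x. x \<in> fibre \<Longrightarrow> coord (k + 1) x = 1"
      and d: "unit_function X (ratio k)" "\<And>x. x \<in> fibre \<Longrightarrow> ratio k x = 1"
      using k good_ratio[OF k] by (simp_all add: unit_function_coord coord_fibre)
    have eq: "coord (k + 1) x = ratio k x * coord k x" if "x \<in> points X" for x
      using torus_coordinate_nonzero[OF tor_torus[OF that]] unfolding coord_def ratio_def by simp
    have key: "block k (coord k) @ block p (coord (k + 1)) @ [(k, ratio k)] \<doteq>
        block k (coord (k + 1)) @ block p (coord k)"
      using equiv_blocks[OF a b d eq, of p] k p by simp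
    show ?case
    \<comment> \<open>For k = 1 the block of index k - 1 is empty and nothing stands to its right;
      otherwise \<open>q = k - 2\<close> is the number of blocks that e_k has to pass.\<close>
    proof (cases p)
      case 0
      then show ?thesis using key p by (simp add: simple_reflection_apply block_simps)
    next
      case (Suc q)
      \<comment> \<open>These blocks carry t_2, ..., t_{k-1}, which s_k leaves alone.\<close>
      have same: "tau_word q ?c' = tau_word q ?c"
        by (rule tau_word_cong) (use p Suc in \<open>simp add: simple_reflection_apply\<close>)
      have gq: "good (tau_word q ?c)"
        by (rule good_tau_word) (use p Suc k in auto)
      have gb: "good (block k (coord k) @ block p (coord (k + 1)))"
        using a b k p by (auto intro!: good_block)
      have "tau_word k ?c' @ [(k, ratio k)] =
          (block k (coord k) @ block p (coord (k + 1))) @ tau_word q ?c @ [(k, ratio k)]"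
        unfolding p Suc tau_word.simps same[unfolded p Suc] by (simp add: simple_reflection_apply)
      also have "\<dots> \<doteq> (block k (coord k) @ block p (coord (k + 1))) @ [(k, ratio k)] @ tau_word q ?c"
        by (rule equiv_word_right[OF equiv_comm_word[OF gq good_ratio[OF k]] gb])
          (use letters_tau_word[of _ _ q ?c] p Suc in fastforce)
      also have "\<dots> = (block k (coord k) @ block p (coord (k + 1)) @ [(k, ratio k)]) @ tau_word q ?c"
        by simp
      also have "\<dots> \<doteq> (block k (coord (k + 1)) @ block p (coord k)) @ tau_word q ?c"
        by (rule equiv_word_left[OF key gq])
      also have "\<dots> = tau_word k ?c" unfolding p Suc tau_word.simps by simp
      finally show ?thesis .
    qed
  next
    case (Suc n)
    have "good (block (Suc n) (coord (n + 2)))"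
      using Suc.prems by (intro good_block) (simp_all add: unit_function_coord coord_fibre)
    from equiv_word_right[OF Suc.IH this] Suc.prems Suc.hyps
    show ?case by (simp add: simple_reflection_apply)
  qed
  then show ?thesis using k by simp
qed

lemma tau_eq:
  assumes "x \<in> points X"
  shows "tau r \<gamma> e x =
    e_seq e (concat (map (\<lambda>m. map (\<lambda>i. (i, tor x (m + 1))) [1..<m+1]) (rev [1..<r+1]))) x"
proof -
  have "map (\<lambda>m. map (\<lambda>i. (i, tau_exponent r m (tor x))) [1..<m+1]) (rev [1..<r+1]) =
      map (\<lambda>m. map (\<lambda>i. (i, tor x (m + 1))) [1..<m+1]) (rev [1..<r+1])"
    by (rule map_cong[OF refl]) (use tau_exponent_eq[OF tor_torus[OF assms]] in auto)
  then show ?thesis unfolding tau_def \<gamma>_tor[OF assms] bind.bind_lunit by (simp only:)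
qed

lemma eval_tau_word:
  "eval_word (tau_word n c) x =
    e_seq e (concat (map (\<lambda>m. map (\<lambda>i. (i, c m x)) [1..<m+1]) (rev [1..<n+1])))"
proof -
  have "map (\<lambda>(i, c). (i, c x)) (tau_word n c) =
      concat (map (\<lambda>m. map (\<lambda>i. (i, c m x)) [1..<m+1]) (rev [1..<n+1]))"
    by (induction n) (simp_all add: block_def comp_def)
  then show ?thesis unfolding eval_word_def by simp
qed

lemma tau_eval_word:
  "x \<in> points X \<Longrightarrow> tau r \<gamma> e x = eval_word (tau_word r (\<lambda>m. coord (m + 1))) x x"
  unfolding tau_eq eval_tau_word coord_def ..

lemma good_tau: "good (tau_word r (\<lambda>m. coord (m + 1)))"
  by (rule good_tau_word) auto

text \<open>Places tau among the good words, whence regularity, the dense domain and the identity on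
  X_0.\<close>

lemma tau_e_fun: "tau r \<gamma> e = e_fun e (tau_word r (\<lambda>m. coord (m + 1))) (Some |` points X)"
proof
  fix x
  show "tau r \<gamma> e x = e_fun e (tau_word r (\<lambda>m. coord (m + 1))) (Some |` points X) x"
  proof (cases "x \<in> points X")
    case True
    then show ?thesis by (simp add: e_fun_eval_word tau_eval_word)
  next
    case False
    then have "\<gamma> x = None" using dom_\<gamma> by (metis domIff)
    then show ?thesis using False by (simp add: tau_def e_fun_outside)
  qed
qed

lemma partial_morphism_tau: "partial_morphism X X (tau r \<gamma> e)"
  unfolding tau_e_fun by (rule partial_morphism_eval_word[OF good_tau])

lemma dense_dom_tau: "dense_open X (dom (tau r \<gamma> e))"
  unfolding tau_e_fun by (rule dense_dom_e_fun[OF good_tau])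

lemma tau_fibre: "x \<in> fibre \<Longrightarrow> tau r \<gamma> e x = Some x"
  unfolding tau_e_fun by (rule e_fun_fibre[OF good_tau])

lemma tau_reflection:
  assumes k: "k \<in> {1..r}" and y: "e k (ratio k x, x) = Some y"
    and z: "tau r \<gamma> e y = Some z" "tau r \<gamma> e x = Some z'"
  shows "z = z'"
proof -
  note d = e_defined[OF k y]
  have t: "tor y = tor x \<circ> simple_reflection k"
    using tor_e[OF k y] torus_mult_reflection[OF tor_torus[OF d(2)]] unfolding ratio_def by simp
  \<comment> \<open>The exponents of tau at \<open>y\<close> are coordinates of gamma(y), that is,
    permuted coordinates of gamma(x). Hence tau(y) is a word with exponents at \<open>x\<close>
    started at \<open>y\<close>, and the letter leading from \<open>x\<close> to \<open>y\<close>
    can be appended to it.\<close>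
  have "tau r \<gamma> e y = eval_word (tau_word r (\<lambda>m. coord (simple_reflection k (m + 1)))) x y"
    unfolding tau_eq[OF d(3)] eval_tau_word coord_def t comp_def ..
  then have "eval_word (tau_word r (\<lambda>m. coord (simple_reflection k (m + 1))) @ [(k, ratio k)]) x x = Some z"
    using y z(1) unfolding eval_word_append by (simp add: eval_word_def[of "[(k, ratio k)]"])
  then show ?thesis
    using agreeD[OF equiv_word_agree[OF tau_word_reflection[OF k]] d(2)] z(2) tau_eval_word[OF d(2)]
    by simp
qed

section \<open>The image of tau lies in the unit fibre\<close>

lemma tor_block:
  assumes "e_seq e (map (\<lambda>i. (i, c)) [1..<Suc m]) y = Some z" "m \<le> r" "c \<noteq> 0" "y \<in> points X"
  shows "tor z j = (if m = 0 then tor y j else if j = 1 then c * tor y 1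
    else if j = m + 1 then tor y j / c else tor y j)"
  using assms(1,2,4)
proof (induction m arbitrary: y j)
  case 0
  then show ?case by simp
next
  case (Suc m)
  obtain y' where y': "e (Suc m) (c, y) = Some y'" "e_seq e (map (\<lambda>i. (i, c)) [1..<Suc m]) y' = Some z"
    using Suc.prems(1) by (auto simp: e_seq_append bind_eq_Some_conv)
  have m: "Suc m \<in> {1..r}" using Suc.prems(2) by simp
  have t: "tor y' = torus_mult (simple_coroot (Suc m) c) (tor y)" by (rule tor_e[OF m y'(1)])
  have "tor z j = (if m = 0 then tor y' j else if j = 1 then c * tor y' 1
    else if j = m + 1 then tor y' j / c else tor y' j)"
    by (rule Suc.IH[OF y'(2)]) (use Suc.prems e_defined[OF m y'(1)] in simp_all)
  \<comment> \<open>The coroots telescope: the letter applied first multiplies entry m + 1 by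
    \<open>c\<close> and divides entry m + 2, and the shorter block then divides entry m + 1
    again.\<close>
  then show ?case
    using assms(3) unfolding t torus_mult_def simple_coroot_def by (auto simp: field_simps)
qed

lemma e_seq_points:
  assumes "\<forall>(i, c)\<in>set u. i \<in> {1..r}" "x \<in> points X" "e_seq e u x = Some z"
  shows "z \<in> points X"
  using assms(1,3)
proof (induction u arbitrary: z)
  case (Cons a u)
  then show ?case using e_defined(3) by (cases a) (auto simp: bind_eq_Some_conv)
qed (use assms(2) in simp)

text \<open>Block m divides entry m + 1 by its original value t_{m+1} and multiplies the first entry
  by it. The blocks up to n thus collect the first n + 1 entries in position 1 and leave 1 behind;
  for \<open>n = r\<close> the collected product is the determinant.\<close>

lemma tor_tau_word:
  assumes x: "x \<in> points X"
    and "e_seq e (concat (map (\<lambda>m. map (\<lambda>i. (i, tor x (m + 1))) [1..<m+1]) (rev [1..<n+1]))) x = Some z"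
    and "n \<le> r"
  shows "tor z j = (if j = 1 then (\<Prod>i=1..n+1. tor x i) else if 2 \<le> j \<and> j \<le> n + 1 then 1 else tor x j)"
  using assms(2,3)
proof (induction n arbitrary: z j)
  case 0
  then show ?case by simp
next
  case (Suc n)
  let ?u = "concat (map (\<lambda>m. map (\<lambda>i. (i, tor x (m + 1))) [1..<m+1]) (rev [1..<n+1]))"
  let ?b = "map (\<lambda>i. (i, tor x (n + 2))) [1..<Suc (Suc n)]"
  have "e_seq e (?b @ ?u) x = Some z" using Suc.prems(1) by simp
  then obtain y where y: "e_seq e ?u x = Some y" "e_seq e ?b y = Some z"
    unfolding e_seq_append by (auto simp: bind_eq_Some_conv simp del: upt_Suc)
  have nz: "tor x (n + 2) \<noteq> 0" by (rule torus_coordinate_nonzero[OF tor_torus[OF x]])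
  have yX: "y \<in> points X"
    by (rule e_seq_points[OF _ x y(1)]) (use Suc.prems(2) in auto)
  have IH: "tor y j = (if j = 1 then (\<Prod>i=1..n+1. tor x i) else
      if 2 \<le> j \<and> j \<le> n + 1 then 1 else tor x j)" for j
    by (rule Suc.IH[OF y(1)]) (use Suc.prems(2) in simp)
  have "tor z j = (if j = 1 then tor x (n + 2) * tor y 1
    else if j = n + 2 then tor y j / tor x (n + 2) else tor y j)"
    using tor_block[OF y(2) Suc.prems(2) nz yX, of j] by simp
  moreover have "tor x (n + 2) * tor y 1 = (\<Prod>i=1..Suc n+1. tor x i)"
    unfolding IH by (simp add: mult.commute)
  moreover have "tor y (n + 2) / tor x (n + 2) = 1"
    unfolding IH using nz by simp
  ultimately show ?case using IH[of j] by auto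
qed

lemma ran_tau: "ran (tau r \<gamma> e) \<subseteq> fibre"
proof
  fix z assume "z \<in> ran (tau r \<gamma> e)"
  then obtain x where xz: "tau r \<gamma> e x = Some z" by (auto simp: ran_def)
  have "x \<in> points X" using xz e_fun_outside unfolding tau_e_fun by (metis option.distinct(1))
  note x = this
  note t = tor_tau_word[OF x xz[unfolded tau_eq[OF x]] order_refl]
  have "tor z j = torus_one j" for j
  proof (cases "j = 1 \<or> 2 \<le> j \<and> j \<le> r + 1")
    case True
    then show ?thesis using t[of j] tor_torus[OF x] by (auto simp: torus_points_def torus_one_def)
  next
    case False
    then have "tor z j = tor x j" using t[of j] by auto
    also have "\<dots> = 1" using tor_torus[OF x] False by (auto simp: torus_points_def)
    finally show ?thesis by (simp add: torus_one_def)
  qed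
  then show "z \<in> fibre"
    using partial_morphism_ran[OF partial_morphism_tau xz] unfolding fibre_def by auto
qed

section \<open>The Weyl group action along a word\<close>

definition act :: "nat list \<Rightarrow> 'p \<rightharpoonup> 'p" where
  "act is x = Option.bind (\<gamma> x) (\<lambda>t. e_word e is (torus_inverse t, x))"

text \<open>Along any word the action is a composition of the maps s_i, although
  \<open>e_word\<close> reads every exponent at the original point. The two claims are proved
  together: the value of gamma at the current point is what identifies the next exponent.\<close>

lemma act_Cons_tor:
  assumes "set is \<subseteq> {1..r}" "x \<in> points X"
  shows "(act is x = Some y \<longrightarrow> y \<in> points X \<and> tor y = tor x \<circ> word_product (rev is)) \<and>
    act (i # is) x = Option.bind (act is x) (\<lambda>y. e i (ratio i y, y))"
  using assms(1)
proof (induction "is" arbitrary: y i)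
  \<comment> \<open>At the inverse of gamma(x) the root at the head becomes the quotient of entries
    i + 1 and i of gamma(y), the exponent of s_i at \<open>y\<close>.\<close>
  have root: "word_root (i # is) 0 (torus_inverse (tor x)) = ratio i y"
    if "tor y = tor x \<circ> word_product (rev is)" for y i "is"
    using torus_coordinate_nonzero[OF tor_torus[OF assms(2)]]
    unfolding word_root_eq torus_inverse_def ratio_def that by (simp add: field_simps)
  have step: "act (i # is) x = Option.bind (act is x) (\<lambda>y. e i (ratio i y, y))"
    if "\<And>y. act is x = Some y \<Longrightarrow> tor y = tor x \<circ> word_product (rev is)" for i "is"
  proof (cases "act is x")
    case None
    then show ?thesis unfolding act_def \<gamma>_tor[OF assms(2)] by (simp add: e_word_Cons)
  next
    case (Some y)
    then show ?thesis using root[OF that[OF Some], of i]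
      unfolding act_def \<gamma>_tor[OF assms(2)] by (simp add: e_word_Cons)
  qed
  {
    case Nil
    have nil: "act [] x = Some x" unfolding act_def \<gamma>_tor[OF assms(2)] by (simp add: e_word_Nil)
    show ?case using step[of "[]" i] nil assms(2) by auto
  next
    case (Cons k "is")
    have k: "k \<in> {1..r}" and sub: "set is \<subseteq> {1..r}" using Cons.prems by auto
    have *: "y \<in> points X \<and> tor y = tor x \<circ> word_product (rev (k # is))"
      if y: "act (k # is) x = Some y" for y
    proof -
      obtain y' where y': "act is x = Some y'" "e k (ratio k y', y') = Some y"
        using Cons.IH[OF sub] y by (auto simp: bind_eq_Some_conv)
      have t': "tor y' = tor x \<circ> word_product (rev is)" using Cons.IH[OF sub] y'(1) by blast
      note d = e_defined[OF k y'(2)]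
      have "tor y = tor y' \<circ> simple_reflection k"
        using tor_e[OF k y'(2)] torus_mult_reflection[OF tor_torus[OF d(2)]] unfolding ratio_def by simp
      then show ?thesis using d(3) unfolding t' by (simp add: word_product_append comp_assoc)
    qed
    then show ?case using step[of "k # is" i] by blast
  }
qed

lemma partial_morphism_ratio_e:
  assumes k: "k \<in> {1..r}"
  shows "partial_morphism X X (e_fun e [(k, ratio k)] (Some |` points X))"
  by (rule partial_morphism_eval_word[OF good_ratio[OF k]])

lemma act_outside: "x \<notin> points X \<Longrightarrow> act is x = None"
  using dom_\<gamma> unfolding act_def by (metis bind.bind_lzero domIff)

lemma act_Nil: "act [] = Some |` points X"
proof
  show "act [] x = (Some |` points X) x" for x
    using act_outside[of x "[]"] unfolding act_def
    by (cases "x \<in> points X") (simp_all add: \<gamma>_tor e_word_Nil)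
qed

lemma act_Cons:
  assumes "set (k # is) \<subseteq> {1..r}"
  shows "act (k # is) = (\<lambda>x. Option.bind (act is x) (e_fun e [(k, ratio k)] (Some |` points X)))"
proof
  fix x
  show "act (k # is) x = Option.bind (act is x) (e_fun e [(k, ratio k)] (Some |` points X))"
  proof (cases "x \<in> points X")
    case True
    then have "act is x = Some y \<Longrightarrow> y \<in> points X" for y
      using act_Cons_tor[of "is" x y k] assms by simp
    then show ?thesis
      using act_Cons_tor[of "is" x _ k] True assms
      by (cases "act is x") (simp_all add: e_fun_Cons e_fun_Nil)
  qed (simp add: act_outside)
qed

lemma act_morphism:
  assumes "set is \<subseteq> {1..r}"
  shows "partial_morphism X X (act is)" "\<And>x. x \<in> fibre \<Longrightarrow> act is x = Some x"
proof -
  have "partial_morphism X X (act is) \<and> (\<forall>x\<in>fibre. act is x = Some x)"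
    using assms
  proof (induction "is")
    case Nil
    then show ?case unfolding act_Nil using partial_morphism_id[OF ring_space_X] by (simp add: fibre_def)
  next
    case (Cons k "is")
    have k: "k \<in> {1..r}" using Cons.prems by simp
    have IH: "partial_morphism X X (act is)" "\<forall>x\<in>fibre. act is x = Some x" using Cons by simp_all
    show ?case
      unfolding act_Cons[OF Cons.prems]
      using partial_morphism_bind[OF ring_space_X IH(1) partial_morphism_ratio_e[OF k]] IH(2)
        e_fun_fibre[OF good_ratio[OF k]] by simp
  qed
  then show "partial_morphism X X (act is)" "\<And>x. x \<in> fibre \<Longrightarrow> act is x = Some x" by auto
qed

text \<open>Induction on the word. Invariance under a single s_k holds at every point where both
  sides are defined, so it may be applied at the intermediate point \<open>y\<close> without asking
  whether the map leading from \<open>x\<close> to \<open>y\<close> is dominant.\<close>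

lemma tau_act:
  assumes "set is \<subseteq> {1..r}"
  shows "rat_eq X (\<lambda>x. Option.bind (act is x) (tau r \<gamma> e)) (tau r \<gamma> e)"
  using assms
proof (induction "is")
  case Nil
  have "dom (tau r \<gamma> e) \<subseteq> points X" using e_fun_outside unfolding tau_e_fun by (meson domIff subsetI)
  then have "Option.bind (act [] x) (tau r \<gamma> e) = Some z" if "tau r \<gamma> e x = Some z" for x z
    using that by (auto simp: act_Nil restrict_map_def)
  then show ?case unfolding rat_eq_def using dense_dom_tau by (intro exI[of _ "dom (tau r \<gamma> e)"]) auto
next
  case (Cons k "is")
  have k: "k \<in> {1..r}" and sub: "set is \<subseteq> {1..r}" using Cons.prems by auto
  let ?F = "\<lambda>x. Option.bind (act (k # is) x) (tau r \<gamma> e)"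
  have F: "partial_morphism X X ?F"
    by (rule partial_morphism_bind[OF ring_space_X act_morphism(1)[OF Cons.prems] partial_morphism_tau])
  obtain U where U: "dense_open X U" "U \<subseteq> dom (\<lambda>x. Option.bind (act is x) (tau r \<gamma> e)) \<inter> dom (tau r \<gamma> e)"
      "\<forall>x\<in>U. Option.bind (act is x) (tau r \<gamma> e) = tau r \<gamma> e x"
    using Cons.IH[OF sub] unfolding rat_eq_def by (elim exE conjE)
  \<comment> \<open>Equality of rational maps includes definedness on a dense open set; a point of
    X_0 is fixed by all maps involved and hence lies in the domain.\<close>
  have "dense_open X (dom ?F)"
    unfolding dense_open_iff
  proof
    show "openin (zariski X) (dom ?F)" by (rule partial_morphism_dom[OF F])
    obtain x where x: "x \<in> fibre" using fibre_nonempty by auto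
    have "?F x = Some x" using act_morphism(2)[OF Cons.prems x] tau_fibre[OF x] by simp
    then have "x \<in> dom ?F" by (rule domI)
    then show "dom ?F \<noteq> {}" by (metis empty_iff)
  qed
  then have "dense_open X (U \<inter> dom ?F)" using U(1) by (rule dense_open_Int[rotated])
  moreover have "?F x = tau r \<gamma> e x" if x: "x \<in> U \<inter> dom ?F" for x
  proof -
    obtain y' z where y': "act (k # is) x = Some y'" "tau r \<gamma> e y' = Some z"
      using x by (auto simp: bind_eq_Some_conv)
    have xX: "x \<in> points X" using y'(1) act_outside by fastforce
    obtain y where y: "act is x = Some y" "e k (ratio k y, y) = Some y'"
      using y'(1) act_Cons_tor[OF sub xX] by (auto simp: bind_eq_Some_conv)
    have "tau r \<gamma> e y = tau r \<gamma> e x" using U(3) x y(1) by auto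
    moreover obtain z' where z': "tau r \<gamma> e x = Some z'" using U(2) x by auto
    ultimately show ?thesis using tau_reflection[OF k y(2) y'(2)] y' by simp
  qed
  ultimately show ?case
    unfolding rat_eq_def using U(2) by (intro exI[of _ "U \<inter> dom ?F"]) auto
qed

end

theorem theorem2p13:
  fixes r :: nat
    and X :: "'p qspace"
    and \<gamma> :: "'p \<rightharpoonup> nat \<Rightarrow> complex"
    and e :: "nat \<Rightarrow> complex \<times> 'p \<rightharpoonup> 'p"
  assumes "r > 1"
    and "geometric_crystal r X \<gamma> e"
    and "dom \<gamma> = points X"
    and "ran \<gamma> = torus_points r"
  shows "trivialization r X \<gamma> e (tau r \<gamma> e)"
proof -
  interpret crystal r X \<gamma> e by standard (use assms in simp_all)
  show ?thesis
    unfolding trivialization_def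
  proof (intro conjI ballI)
    show "rational_morphism X (subspace_of X (unit_fibre \<gamma>)) (tau r \<gamma> e)"
      unfolding rational_morphism_iff[OF ring_space_X] fibre_eq
      using dense_dom_tau partial_morphism_subspace[OF ring_space_X partial_morphism_tau ran_tau] by simp
    show "tau r \<gamma> e x = Some x" if "x \<in> unit_fibre \<gamma>" for x
      using that tau_fibre by (simp add: fibre_eq)
    fix w assume "w \<in> weyl_group r"
    \<comment> \<open>Invariance holds along every word in the simple reflections, in particular
      along the reduced word chosen for \<open>w\<close>.\<close>
    from someI_ex[OF reduced_word_exists[OF this]]
    have "set (SOME is. reduced_word r w is) \<subseteq> {1..r}" unfolding reduced_word_def by simp
    from tau_act[OF this]
    show "rat_eq X (\<lambda>x. Option.bind (weyl_action r \<gamma> e w x) (tau r \<gamma> e)) (tau r \<gamma> e)"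
      unfolding weyl_action_def e_weyl_def act_def .
  qed
qed
end
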